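(* Let $m,n\in\mathbb{Z}$ and let $$\Gamma=\langle y,z\mid y^{-1}z^{m+1}w^{n+1}=z^{m+1}w^{n+1}y^{-1}\rangle,\qquad w=z^{-(m+1)}yz^{m}y,$$ which is the fundamental group of the complement of the double twist link $J(2m+1,2n+1)$. Let $\mathcal{X}^{\rm sym,irr}_{{\rm SL}(3,\mathbb{C})}(\Gamma)$ be the set of characters of irreducible representations $\rho:\Gamma\to{\rm SL}(3,\mathbb{C})$ such that, with $\mathbf{y}=\rho(y)$, $\mathbf{z}=\rho(z)$, one has ${\rm tr}(\mathbf{y}\mathbf{z}\mathbf{y}^{-1}\mathbf{z}^{-1})={\rm tr}(\mathbf{z}\mathbf{y}\mathbf{z}^{-1}\mathbf{y}^{-1})$ (equivalently, $\mathbf{y},\mathbf{z}$ can be simultaneously conjugated to be symmetric). Then $$\mathcal{X}^{\rm sym,irr}_{{\rm SL}(3,\mathbb{C})}(\Gamma)=\mathcal{X}_{\rm sp,od}\cup\mathcal{X}_{\rm od,sp}\cup\mathcal{X}_{\rm od,od},$$ where $\mathcal{X}_{\rm sp,od}$ (respectively $\mathcal{X}_{\rm od,sp}$, $\mathcal{X}_{\rm od,od}$) is the part of those characters with $\mathbf{y}$ special and $\mathbf{z}$ ordinary (respectively $\mathbf{y}$ ordinary and $\mathbf{z}$ special; $\mathbf{y},\mathbf{z}$ both ordinary). Moreover, among characters of irreducible pairs $(\mathbf{y},\mathbf{z})\in{\rm SL}(3,\mathbb{C})^2$ with ${\rm tr}(\mathbf{y}\mathbf{z}\mathbf{y}^{-1}\mathbf{z}^{-1})={\rm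 tr}(\mathbf{z}\mathbf{y}\mathbf{z}^{-1}\mathbf{y}^{-1})$: (a) $\mathcal{X}_{\rm sp,od}$ is determined by: for some $\lambda\in\mathbb{C}^\ast$, \begin{align*} &t_1=2\lambda+\lambda^{-2},\qquad t_{\bar1}=2\lambda^{-1}+\lambda^2,\\ &t_{\bar12}=(\lambda^2+\lambda^{-1})t_2-\lambda t_{12},\qquad t_{\bar1\bar2}=(\lambda^2+\lambda^{-1})t_{\bar2}-\lambda t_{1\bar2},\\ &\eta_1-\lambda\eta_2+(\lambda^2+\lambda^{-1})\eta_5=\eta_3-\lambda\eta_4+(\lambda^2+\lambda^{-1})\eta_6=0; \end{align*} (b) $\mathcal{X}_{\rm od,sp}$ is determined by: for some $\lambda\in\mathbb{C}^\ast$, \begin{align*} &t_2=2\lambda+\lambda^{-2},\qquad t_{\bar2}=2\lambda^{-1}+\lambda^2,\\ &t_{1\bar2}=(\lambda^2+\lambda^{-1})t_1-\lambda t_{12},\qquad t_{\bar1\bar2}=(\lambda^2+\lambda^{-1})t_{\bar1}-\lambda t_{\bar12},\\ &\eta_1-\lambda\eta_3=\eta_2-\lambda\eta_4=\eta_5-\lambda\eta_6=0; \end{align*} (c) $\mathcal{X}_{\rm od,od}$ is determined (among such characters with $\mathbf{y},\mathbf{z}$ both ordinary) by $[\eta_1,\ldots,\eta_6]A=0$, with $$A=\left[\begin{array}{cccc} t_{1212}-t_{1^22^2} & t_{12\bar12}-t_{2^2} & t_{121\bar2}-t_{1^2} & t_{12\bar1\bar2}-3\\ t_{12\bar12}-t_{2^2}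 & t_{\bar12\bar12}-t_{\bar1^22^2} & t_{12\bar1\bar2}-3 & t_{\bar12\bar1\bar2}-t_{\bar1^2}\\ t_{121\bar2}-t_{1^2} & t_{12\bar1\bar2}-3 & t_{1\bar21\bar2}-t_{1^2\bar2^2} & t_{1\bar2\bar1\bar2}-t_{\bar2^2}\\ t_{12\bar1\bar2}-3 & t_{\bar12\bar1\bar2}-t_{\bar1^2} & t_{1\bar2\bar1\bar2}-t_{\bar2^2} & t_{\bar1\bar2\bar1\bar2}-t_{\bar1^2\bar2^2}\\ t_{12^2}-t_{1^22\bar12} & t_{12\bar1^22}-t_{\bar12^2} & t_1-t_{1^22\bar1\bar2} & t_{12\bar1^2\bar2}-t_{\bar1}\\ t_1-t_{1^2\bar2\bar12} & t_{1\bar2\bar1^22}-t_{\bar1} & t_{1\bar2^2}-t_{1^2\bar2\bar1\bar2} & t_{1\bar2\bar1^2\bar2}-t_{\bar1\bar2^2} \end{array}\right].$$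
   Context: An element $\mathbf{x}\in{\rm SL}(3,\mathbb{C})$ is ordinary if its minimal polynomial has degree $3$ (equivalently, each eigenspace is one-dimensional), and special otherwise. The character of a representation $\rho$ is the function $g\mapsto{\rm tr}(\rho(g))$. A pair $(\mathbf{y},\mathbf{z})$ in ${\rm SL}(3,\mathbb{C})$ is irreducible if the representation of the free group of rank two on $\mathbb{C}^3$ sending its two free generators to $\mathbf{y},\mathbf{z}$ is irreducible; its character is the character of that representation. Characters of irreducible representations of $\Gamma$ are viewed as characters of irreducible pairs $(\mathbf{y},\mathbf{z})=(\rho(y),\rho(z))$. Trace notation: $t_{\ast}$ is the trace of the word obtained from the subscript by replacing $1,\bar1,2,\bar2$ by $\mathbf{y},\mathbf{y}^{-1},\mathbf{z},\mathbf{z}^{-1}$, with exponents denoting powers; e.g. $t_1={\rm tr}(\mathbf{y})$, $t_{\bar12}={\rm tr}(\mathbf{y}^{-1}\mathbf{z})$, $t_{12\bar1^2\bar2}={\rm tr}(\mathbf{y}\mathbf{z}\mathbf{y}^{-2}\mathbf{z}^{-1})$. For $k\in\mathbb{Z}$ and $\mathbf{x}\in{\rm SL}(3,\mathbb{C})$, let $\alpha_k(\mathbf{x}),\beta_k(\mathbf{x}),\gamma_k(\mathbf{x})$ be the polynomials in ${\rm tr}(\mathbf{x}),{\rm tr}(\mathbf{x}^{-1})$ obtained from the Cayley-Hamilton theorem with $\mathbf{x}^k=\alpha_k(\mathbf{x})\mathbf{x}+\beta_k(\mathbf{x})\mathbf{e}+\gamma_k(\mathbf{x})\mathbf{x}^{-1}$,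 where $\mathbf{e}$ is the identity matrix; explicitly, $(\alpha_0,\beta_0,\gamma_0)=(0,1,0)$ and, for all $k\in\mathbb{Z}$, $\alpha_{k+1}={\rm tr}(\mathbf{x})\alpha_k+\beta_k$, $\beta_{k+1}=\gamma_k-{\rm tr}(\mathbf{x}^{-1})\alpha_k$, $\gamma_{k+1}=\alpha_k$. Put $\alpha_k=\alpha_k(\mathbf{z})$, $\beta_k=\beta_k(\mathbf{z})$, $\gamma_k=\gamma_k(\mathbf{z})$; $\mathbf{w}=\mathbf{z}^{-(m+1)}\mathbf{y}\mathbf{z}^m\mathbf{y}$; $\tilde\alpha=\alpha_{n+1}(\mathbf{w})$, $\tilde\beta=\beta_{n+1}(\mathbf{w})$, $\tilde\gamma=\gamma_{n+1}(\mathbf{w})$; $p_k={\rm tr}(\mathbf{y}\mathbf{z}^k)$, $q_k={\rm tr}(\mathbf{y}^{-1}\mathbf{z}^k)$. Define \begin{align*} \varsigma_1&=q_{-m}q_{m+1}\alpha_{m+1}-p_m\alpha_{3m+2}+p_{2m+1}\alpha_{2m+1}+p_0\alpha_{-2m-1},\\ \varsigma_2&=q_{-m}q_{m+1}\gamma_{m+1}-p_m\gamma_{3m+2}+p_{2m+1}\gamma_{2m+1}+p_0\gamma_{-2m-1},\\ \eta_1&=-\tilde\gamma q_{-m}\alpha_{-m-1}-\tilde\alpha\alpha_m,\qquad \eta_2=\tilde\gamma\varsigma_1+\tilde\beta\alpha_{m+1},\\ \eta_3&=-\tilde\gamma q_{-m}\gamma_{-m-1}-\tilde\alpha\gamma_m,\qquad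 \eta_4=\tilde\gamma\varsigma_2+\tilde\beta\gamma_{m+1},\\ \eta_5&=\tilde\gamma\alpha_{-2m-1},\qquad \eta_6=\tilde\gamma\gamma_{-2m-1}. \end{align*} *)

theory Defs
  imports
    "HOL-Analysis.Analysis"
    "HOL-Computational_Algebra.Polynomial"
    "HOL-Algebra.Group"
begin

section \<open>Group presentations\<close>

text \<open>The letter \<open>(True, x)\<close> is the generator \<open>x\<close>, and \<open>(False, x)\<close> is its formal inverse.\<close>

type_synonym 'a word = "(bool \<times> 'a) list"

definition inv_word :: "'a word \<Rightarrow> 'a word" where
  "inv_word w = rev (map (\<lambda>(b, x). (\<not> b, x)) w)"

definition word_power :: "'a word \<Rightarrow> int \<Rightarrow> 'a word" where
  "word_power w k =
     (if 0 \<le> k then concat (replicate (nat k) w)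
      else concat (replicate (nat (- k)) (inv_word w)))"

inductive word_eq :: "('a word \<times> 'a word) set \<Rightarrow> 'a word \<Rightarrow> 'a word \<Rightarrow> bool"
  for R where
  refl: "word_eq R u u"
| sym: "word_eq R u v \<Longrightarrow> word_eq R v u"
| trans: "word_eq R u v \<Longrightarrow> word_eq R v w \<Longrightarrow> word_eq R u w"
| cancel: "word_eq R (u @ [(b, x), (\<not> b, x)] @ v) (u @ v)"
| relator: "(r, s) \<in> R \<Longrightarrow> word_eq R (u @ r @ v) (u @ s @ v)"

definition word_class :: "('a word \<times> 'a word) set \<Rightarrow> 'a word \<Rightarrow> 'a word set" where
  "word_class R u = {v. word_eq R u v}"

text \<open>A pair \<open>(r, s) \<in> R\<close> stands for the defining relation \<open>r = s\<close>.\<close>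

definition presented_group :: "('a word \<times> 'a word) set \<Rightarrow> 'a word set monoid" where
  "presented_group R =
     \<lparr>carrier = range (word_class R),
      mult = (\<lambda>A B. \<Union>u\<in>A. \<Union>v\<in>B. word_class R (u @ v)),
      one = word_class R []\<rparr>"

lemma word_eq_append:
  assumes "word_eq R u u'" "word_eq R v v'"
  shows "word_eq R (u @ v) (u' @ v')"
proof -
  have l: "word_eq R (u @ v) (u' @ v)" for v
    using assms(1)
  proof (induction)
    case (cancel u b x w)
    then show ?case using word_eq.cancel[of R u b x "w @ v"] by simp
  next
    case (relator r s u w)
    then show ?case using word_eq.relator[of r s R u "w @ v"] by simp
  qed (rule word_eq.refl, erule word_eq.sym, erule (1) word_eq.trans)
  have r: "word_eq R (u @ v) (u @ v')" for u
    using assms(2)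
  proof (induction)
    case (cancel w b x v)
    then show ?case using word_eq.cancel[of R "u @ w" b x v] by simp
  next
    case (relator r s w v)
    then show ?case using word_eq.relator[of r s R "u @ w" v] by simp
  qed (rule word_eq.refl, erule word_eq.sym, erule (1) word_eq.trans)
  show ?thesis by (rule word_eq.trans[OF l r])
qed

lemma word_class_eq_iff: "word_class R u = word_class R v \<longleftrightarrow> word_eq R u v"
proof
  assume "word_class R u = word_class R v"
  moreover have "v \<in> word_class R v" by (simp add: word_class_def word_eq.refl)
  ultimately show "word_eq R u v" by (simp add: word_class_def set_eq_iff)
next
  assume uv: "word_eq R u v"
  then have "word_eq R u x \<longleftrightarrow> word_eq R v x" for x
    using word_eq.trans[OF uv, of x] word_eq.trans[OF word_eq.sym[OF uv], of x] by argo
  then show "word_class R u = word_class R v" by (simp add: word_class_def)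
qed

lemma word_class_mult:
  "word_class R u \<otimes>\<^bsub>presented_group R\<^esub> word_class R v = word_class R (u @ v)"
proof -
  have *: "word_class R (u' @ v') = word_class R (u @ v)"
    if "u' \<in> word_class R u" "v' \<in> word_class R v" for u' v'
  proof -
    have "word_eq R u u'" "word_eq R v v'"
      using that by (simp_all add: word_class_def)
    then have "word_eq R (u' @ v') (u @ v)"
      by (rule word_eq.sym[OF word_eq_append])
    then show ?thesis by (simp only: word_class_eq_iff)
  qed
  have "u \<in> word_class R u" "v \<in> word_class R v"
    by (simp_all add: word_class_def word_eq.refl)
  then have "(\<Union>u'\<in>word_class R u. \<Union>v'\<in>word_class R v. word_class R (u' @ v')) =
      word_class R (u @ v)"
    using * by blast
  then show ?thesis by (simp add: presented_group_def)
qed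

lemma word_eq_inv_word: "word_eq R (inv_word u @ u) []"
proof (induction u)
  case Nil
  then show ?case by (simp add: inv_word_def word_eq.refl)
next
  case (Cons a u)
  obtain b x where a: "a = (b, x)" by (cases a)
  have "word_eq R (inv_word u @ [(\<not> b, x), (\<not> \<not> b, x)] @ u) (inv_word u @ u)"
    by (rule word_eq.cancel)
  then show ?case
    using word_eq.trans[OF _ Cons] a by (simp add: inv_word_def)
qed

lemma group_presented_group: "group (presented_group R)"
proof (rule groupI)
  fix A B C
  assume "A \<in> carrier (presented_group R)" "B \<in> carrier (presented_group R)"
    "C \<in> carrier (presented_group R)"
  then obtain u v w where
    "A = word_class R u" "B = word_class R v" "C = word_class R w"
    by (auto simp: presented_group_def)
  then show "A \<otimes>\<^bsub>presented_group R\<^esub> B \<otimes>\<^bsub>presented_group R\<^esub> C =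
      A \<otimes>\<^bsub>presented_group R\<^esub> (B \<otimes>\<^bsub>presented_group R\<^esub> C)"
    by (simp add: word_class_mult)
next
  fix A B
  assume "A \<in> carrier (presented_group R)" "B \<in> carrier (presented_group R)"
  then obtain u v where "A = word_class R u" "B = word_class R v"
    by (auto simp: presented_group_def)
  then have "A \<otimes>\<^bsub>presented_group R\<^esub> B = word_class R (u @ v)"
    by (simp add: word_class_mult)
  then show "A \<otimes>\<^bsub>presented_group R\<^esub> B \<in> carrier (presented_group R)"
    by (simp add: presented_group_def)
next
  show "\<one>\<^bsub>presented_group R\<^esub> \<in> carrier (presented_group R)"
    by (simp add: presented_group_def)
next
  fix A assume "A \<in> carrier (presented_group R)"
  then obtain u where u: "A = word_class R u" by (auto simp: presented_group_def)
  have o: "\<one>\<^bsub>presented_group R\<^esub> = word_class R []" by (simp add: presented_group_def)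
  show "\<one>\<^bsub>presented_group R\<^esub> \<otimes>\<^bsub>presented_group R\<^esub> A = A"
    unfolding o u word_class_mult by simp
  have "word_class R (inv_word u) \<otimes>\<^bsub>presented_group R\<^esub> A = \<one>\<^bsub>presented_group R\<^esub>"
    unfolding o u word_class_mult word_class_eq_iff by (rule word_eq_inv_word)
  moreover have "word_class R (inv_word u) \<in> carrier (presented_group R)"
    by (simp add: presented_group_def)
  ultimately show "\<exists>B\<in>carrier (presented_group R).
      B \<otimes>\<^bsub>presented_group R\<^esub> A = \<one>\<^bsub>presented_group R\<^esub>" by blast
qed


section \<open>Representations in SL(3,C) and their characters\<close>

type_synonym mat3 = "complex ^ 3 ^ 3"

definition SL3 :: "mat3 monoid" where
  "SL3 = \<lparr>carrier = {A. det A = 1}, mult = (**), one = mat 1\<rparr>"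

lemma group_SL3: "group SL3"
proof (rule groupI)
  fix A assume A: "A \<in> carrier SL3"
  then have "invertible A" by (simp add: SL3_def invertible_det_nz)
  then obtain B where B: "B ** A = mat 1" unfolding invertible_def by auto
  then have "det B * det A = 1" by (metis det_I det_mul)
  with A B show "\<exists>B\<in>carrier SL3. B \<otimes>\<^bsub>SL3\<^esub> A = \<one>\<^bsub>SL3\<^esub>"
    by (auto simp: SL3_def)
qed (auto simp: SL3_def det_mul matrix_mul_assoc)

lemma inv_SL3: "A \<in> carrier SL3 \<Longrightarrow> inv\<^bsub>SL3\<^esub> A = matrix_inv A"
proof -
  assume A: "A \<in> carrier SL3"
  interpret group SL3 by (rule group_SL3)
  have r: "A ** inv\<^bsub>SL3\<^esub> A = mat 1" and l: "inv\<^bsub>SL3\<^esub> A ** A = mat 1"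
    using r_inv[OF A] l_inv[OF A] by (simp_all add: SL3_def)
  have "A ** matrix_inv A = mat 1 \<and> matrix_inv A ** A = mat 1"
    unfolding matrix_inv_def
    by (rule someI[where P = "\<lambda>B. A ** B = mat 1 \<and> B ** A = mat 1" and x = "inv\<^bsub>SL3\<^esub> A"])
      (simp add: r l)
  then have "A ** matrix_inv A = mat 1" ..
  then have "inv\<^bsub>SL3\<^esub> A ** (A ** matrix_inv A) = inv\<^bsub>SL3\<^esub> A" by simp
  then show ?thesis by (simp add: matrix_mul_assoc l)
qed

definition irreducible_rep :: "('g, 'b) monoid_scheme \<Rightarrow> ('g \<Rightarrow> mat3) \<Rightarrow> bool" where
  "irreducible_rep G \<rho> \<longleftrightarrow>
     (\<forall>W. vec.subspace W \<and> (\<forall>g\<in>carrier G. \<forall>v\<in>W. \<rho> g *v v \<in> W)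
        \<longrightarrow> W = {0} \<or> W = UNIV)"

definition rep_character :: "('g, 'b) monoid_scheme \<Rightarrow> ('g \<Rightarrow> mat3) \<Rightarrow> 'g \<Rightarrow> complex" where
  "rep_character G \<rho> = (\<lambda>g\<in>carrier G. trace (\<rho> g))"


section \<open>Pairs of matrices as representations of the free group of rank two\<close>

datatype gen = Gen_y | Gen_z

abbreviation gy :: "gen word" where "gy \<equiv> [(True, Gen_y)]"
abbreviation gz :: "gen word" where "gz \<equiv> [(True, Gen_z)]"

definition F2 :: "gen word set monoid" where
  "F2 = presented_group {}"

fun letter_eval :: "mat3 \<Rightarrow> mat3 \<Rightarrow> bool \<times> gen \<Rightarrow> mat3" where
  "letter_eval y z (True, Gen_y) = y"
| "letter_eval y z (False, Gen_y) = inv\<^bsub>SL3\<^esub> y"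
| "letter_eval y z (True, Gen_z) = z"
| "letter_eval y z (False, Gen_z) = inv\<^bsub>SL3\<^esub> z"

definition word_eval :: "mat3 \<Rightarrow> mat3 \<Rightarrow> gen word \<Rightarrow> mat3" where
  "word_eval y z u = foldr (\<lambda>a M. letter_eval y z a ** M) u (mat 1)"

text \<open>The elements of \<open>F2\<close> are classes of words, on which evaluation at two matrices of
  determinant one is constant; see \<open>pair_rep_word_class\<close>.\<close>

definition pair_rep :: "mat3 \<Rightarrow> mat3 \<Rightarrow> gen word set \<Rightarrow> mat3" where
  "pair_rep y z A = the_elem (word_eval y z ` A)"

lemma word_eval_append: "word_eval y z (u @ v) = word_eval y z u ** word_eval y z v"
  unfolding word_eval_def by (induction u) (simp_all add: matrix_mul_assoc)

lemma letter_eval_in_SL3: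
  assumes "y \<in> carrier SL3" "z \<in> carrier SL3"
  shows "letter_eval y z a \<in> carrier SL3"
proof -
  interpret group SL3 by (rule group_SL3)
  show ?thesis using assms by (cases "(y, z, a)" rule: letter_eval.cases) auto
qed

lemma word_eval_in_SL3:
  assumes "y \<in> carrier SL3" "z \<in> carrier SL3"
  shows "word_eval y z u \<in> carrier SL3"
  using letter_eval_in_SL3[OF assms]
  by (induction u) (auto simp: word_eval_def SL3_def det_mul)

lemma letter_eval_cancel:
  assumes "y \<in> carrier SL3" "z \<in> carrier SL3"
  shows "letter_eval y z (b, x) ** letter_eval y z (\<not> b, x) = mat 1"
proof -
  interpret group SL3 by (rule group_SL3)
  have "A ** inv\<^bsub>SL3\<^esub> A = mat 1" "inv\<^bsub>SL3\<^esub> A ** A = mat 1" if "A \<in> carrier SL3" for A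
    using r_inv[OF that] l_inv[OF that] by (simp_all add: SL3_def)
  then show ?thesis using assms by (cases b; cases x) simp_all
qed

lemma word_eval_cong:
  assumes "y \<in> carrier SL3" "z \<in> carrier SL3" "word_eq {} u v"
  shows "word_eval y z u = word_eval y z v"
  using assms(3)
proof (induction)
  case (cancel u b x v)
  have "word_eval y z [(b, x), (\<not> b, x)] = mat 1"
    using letter_eval_cancel[OF assms(1,2)] by (simp add: word_eval_def)
  then show ?case by (simp only: word_eval_append) simp
qed auto

lemma pair_rep_word_class:
  assumes "y \<in> carrier SL3" "z \<in> carrier SL3"
  shows "pair_rep y z (word_class {} u) = word_eval y z u"
proof -
  have "word_eval y z v = word_eval y z u" if "v \<in> word_class {} u" for v
    using word_eval_cong[OF assms, of u v] that by (simp add: word_class_def)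
  moreover have "u \<in> word_class {} u" by (simp add: word_class_def word_eq.refl)
  ultimately have "word_eval y z ` word_class {} u = {word_eval y z u}" by blast
  then show ?thesis by (simp add: pair_rep_def)
qed

lemma pair_rep_hom:
  assumes "y \<in> carrier SL3" "z \<in> carrier SL3"
  shows "pair_rep y z \<in> hom F2 SL3"
proof (rule homI)
  fix A assume "A \<in> carrier F2"
  then show "pair_rep y z A \<in> carrier SL3"
    using pair_rep_word_class[OF assms] word_eval_in_SL3[OF assms]
    by (auto simp: F2_def presented_group_def)
next
  fix A B assume "A \<in> carrier F2" "B \<in> carrier F2"
  then obtain u v where "A = word_class {} u" "B = word_class {} v"
    by (auto simp: F2_def presented_group_def)
  then show "pair_rep y z (A \<otimes>\<^bsub>F2\<^esub> B) = pair_rep y z A \<otimes>\<^bsub>SL3\<^esub> pair_rep y z B"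
    by (simp add: F2_def word_class_mult pair_rep_word_class[OF assms] word_eval_append)
      (simp add: SL3_def)
qed

lemma pair_rep_generators:
  assumes "y \<in> carrier SL3" "z \<in> carrier SL3"
  shows "pair_rep y z (word_class {} gy) = y" "pair_rep y z (word_class {} gz) = z"
  by (simp_all add: pair_rep_word_class[OF assms] word_eval_def)

definition pair_character :: "mat3 \<Rightarrow> mat3 \<Rightarrow> gen word set \<Rightarrow> complex" where
  "pair_character y z = rep_character F2 (pair_rep y z)"

definition irreducible_pair :: "mat3 \<Rightarrow> mat3 \<Rightarrow> bool" where
  "irreducible_pair y z \<longleftrightarrow>
     y \<in> carrier SL3 \<and> z \<in> carrier SL3 \<and> irreducible_rep F2 (pair_rep y z)"


section \<open>Ordinary and special elements\<close>

definition poly_mat :: "complex poly \<Rightarrow> mat3 \<Rightarrow> mat3" where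
  "poly_mat p A = (\<Sum>i\<le>degree p. mat (coeff p i) ** (((**) A) ^^ i) (mat 1))"

definition is_minimal_poly :: "complex poly \<Rightarrow> mat3 \<Rightarrow> bool" where
  "is_minimal_poly p A \<longleftrightarrow>
     lead_coeff p = 1 \<and> poly_mat p A = 0 \<and>
     (\<forall>q. q \<noteq> 0 \<and> poly_mat q A = 0 \<longrightarrow> degree p \<le> degree q)"

definition ordinary :: "mat3 \<Rightarrow> bool" where
  "ordinary A \<longleftrightarrow> (\<exists>p. is_minimal_poly p A \<and> degree p = 3)"

definition special :: "mat3 \<Rightarrow> bool" where
  "special A \<longleftrightarrow> \<not> ordinary A"


section \<open>The group of the double twist link and its characters\<close>

definition w_word :: "int \<Rightarrow> gen word" where
  "w_word m = word_power gz (- (m + 1)) @ gy @ word_power gz m @ gy"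

definition \<Gamma>_relations :: "int \<Rightarrow> int \<Rightarrow> (gen word \<times> gen word) set" where
  "\<Gamma>_relations m n =
     {(inv_word gy @ word_power gz (m + 1) @ word_power (w_word m) (n + 1),
       word_power gz (m + 1) @ word_power (w_word m) (n + 1) @ inv_word gy)}"

definition \<Gamma> :: "int \<Rightarrow> int \<Rightarrow> gen word set monoid" where
  "\<Gamma> m n = presented_group (\<Gamma>_relations m n)"

definition \<Gamma>_y :: "int \<Rightarrow> int \<Rightarrow> gen word set" where
  "\<Gamma>_y m n = word_class (\<Gamma>_relations m n) gy"

definition \<Gamma>_z :: "int \<Rightarrow> int \<Rightarrow> gen word set" where
  "\<Gamma>_z m n = word_class (\<Gamma>_relations m n) gz"

text \<open>The trace of a word, given as a list of matrices: \<open>tr_word [y, z, y', y', z']\<close>, where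
  \<open>y'\<close> and \<open>z'\<close> are the inverses of \<open>y\<close> and \<open>z\<close>, is the trace written with subscript
  \<open>1 2 -1^2 -2\<close>, a minus sign standing for a bar.\<close>

definition tr_word :: "mat3 list \<Rightarrow> complex" where
  "tr_word As = trace (foldr (**) As (mat 1))"

definition trace_symmetric :: "mat3 \<Rightarrow> mat3 \<Rightarrow> bool" where
  "trace_symmetric y z \<longleftrightarrow>
     tr_word [y, z, inv\<^bsub>SL3\<^esub> y, inv\<^bsub>SL3\<^esub> z] = tr_word [z, y, inv\<^bsub>SL3\<^esub> z, inv\<^bsub>SL3\<^esub> y]"

definition simultaneously_symmetrizable :: "mat3 \<Rightarrow> mat3 \<Rightarrow> bool" where
  "simultaneously_symmetrizable y z \<longleftrightarrow>
     (\<exists>P :: mat3. invertible P \<and>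
        transpose (P ** y ** matrix_inv P) = P ** y ** matrix_inv P \<and>
        transpose (P ** z ** matrix_inv P) = P ** z ** matrix_inv P)"

definition irr_reps :: "int \<Rightarrow> int \<Rightarrow> (gen word set \<Rightarrow> mat3) set" where
  "irr_reps m n = {\<rho> \<in> hom (\<Gamma> m n) SL3. irreducible_rep (\<Gamma> m n) \<rho>}"

definition sym_irr_reps :: "int \<Rightarrow> int \<Rightarrow> (gen word set \<Rightarrow> mat3) set" where
  "sym_irr_reps m n = {\<rho> \<in> irr_reps m n. trace_symmetric (\<rho> (\<Gamma>_y m n)) (\<rho> (\<Gamma>_z m n))}"

text \<open>A character of \<open>\<Gamma>\<close> is viewed as the character of the pair of images of the two
  generators, that is, it is pulled back along the surjection from \<open>F2\<close> to \<open>\<Gamma>\<close>.\<close>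

definition view_character :: "int \<Rightarrow> int \<Rightarrow> (gen word set \<Rightarrow> mat3) \<Rightarrow> gen word set \<Rightarrow> complex" where
  "view_character m n \<rho> = pair_character (\<rho> (\<Gamma>_y m n)) (\<rho> (\<Gamma>_z m n))"

definition X_sym_irr :: "int \<Rightarrow> int \<Rightarrow> (gen word set \<Rightarrow> complex) set" where
  "X_sym_irr m n = view_character m n ` sym_irr_reps m n"

definition X_sp_od :: "int \<Rightarrow> int \<Rightarrow> (gen word set \<Rightarrow> complex) set" where
  "X_sp_od m n = view_character m n `
     {\<rho> \<in> sym_irr_reps m n. special (\<rho> (\<Gamma>_y m n)) \<and> ordinary (\<rho> (\<Gamma>_z m n))}"

definition X_od_sp :: "int \<Rightarrow> int \<Rightarrow> (gen word set \<Rightarrow> complex) set" where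
  "X_od_sp m n = view_character m n `
     {\<rho> \<in> sym_irr_reps m n. ordinary (\<rho> (\<Gamma>_y m n)) \<and> special (\<rho> (\<Gamma>_z m n))}"

definition X_od_od :: "int \<Rightarrow> int \<Rightarrow> (gen word set \<Rightarrow> complex) set" where
  "X_od_od m n = view_character m n `
     {\<rho> \<in> sym_irr_reps m n. ordinary (\<rho> (\<Gamma>_y m n)) \<and> ordinary (\<rho> (\<Gamma>_z m n))}"


section \<open>Powers via the Cayley--Hamilton theorem\<close>

text \<open>\<open>ch_coeffs a b k\<close> is the triple \<open>(\<alpha>\<^sub>k, \<beta>\<^sub>k, \<gamma>\<^sub>k)\<close> for \<open>tr x = a\<close> and \<open>tr x\<^sup>-\<^sup>1 = b\<close>; negative
  indices are reached by inverting the recursion step, see \<open>ch_coeffs_Suc\<close>.\<close>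

definition ch_step :: "complex \<Rightarrow> complex \<Rightarrow> complex \<times> complex \<times> complex \<Rightarrow> complex \<times> complex \<times> complex" where
  "ch_step a b = (\<lambda>(\<alpha>, \<beta>, \<gamma>). (a * \<alpha> + \<beta>, \<gamma> - b * \<alpha>, \<alpha>))"

definition ch_step_inv :: "complex \<Rightarrow> complex \<Rightarrow> complex \<times> complex \<times> complex \<Rightarrow> complex \<times> complex \<times> complex" where
  "ch_step_inv a b = (\<lambda>(\<alpha>, \<beta>, \<gamma>). (\<gamma>, \<alpha> - a * \<gamma>, \<beta> + b * \<gamma>))"

definition ch_coeffs :: "complex \<Rightarrow> complex \<Rightarrow> int \<Rightarrow> complex \<times> complex \<times> complex" where
  "ch_coeffs a b k =
     (if 0 \<le> k then (ch_step a b ^^ nat k) (0, 1, 0)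
      else (ch_step_inv a b ^^ nat (- k)) (0, 1, 0))"

lemma ch_coeffs_0: "ch_coeffs a b 0 = (0, 1, 0)"
  by (simp add: ch_coeffs_def)

lemma ch_coeffs_Suc: "ch_coeffs a b (k + 1) = ch_step a b (ch_coeffs a b k)"
proof (cases "0 \<le> k")
  case True
  then have "nat (k + 1) = Suc (nat k)" by simp
  with True show ?thesis by (simp add: ch_coeffs_def)
next
  case False
  have *: "ch_step a b (ch_step_inv a b p) = p" for p
    by (cases p) (simp add: ch_step_def ch_step_inv_def)
  have "nat (- k) = Suc (nat (- (k + 1)))" using False by simp
  then have "ch_coeffs a b k = ch_step_inv a b ((ch_step_inv a b ^^ nat (- (k + 1))) (0, 1, 0))"
    using False by (simp add: ch_coeffs_def)
  also have "(ch_step_inv a b ^^ nat (- (k + 1))) (0, 1, 0) = ch_coeffs a b (k + 1)"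
    using False by (cases "k + 1 = 0") (simp_all add: ch_coeffs_def)
  finally show ?thesis by (simp add: *)
qed

definition ch_alpha :: "mat3 \<Rightarrow> int \<Rightarrow> complex" where
  "ch_alpha x k = fst (ch_coeffs (trace x) (trace (inv\<^bsub>SL3\<^esub> x)) k)"

definition ch_beta :: "mat3 \<Rightarrow> int \<Rightarrow> complex" where
  "ch_beta x k = fst (snd (ch_coeffs (trace x) (trace (inv\<^bsub>SL3\<^esub> x)) k))"

definition ch_gamma :: "mat3 \<Rightarrow> int \<Rightarrow> complex" where
  "ch_gamma x k = snd (snd (ch_coeffs (trace x) (trace (inv\<^bsub>SL3\<^esub> x)) k))"

lemma ch_recursion:
  "ch_alpha x 0 = 0" "ch_beta x 0 = 1" "ch_gamma x 0 = 0"
  "ch_alpha x (k + 1) = trace x * ch_alpha x k + ch_beta x k"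
  "ch_beta x (k + 1) = ch_gamma x k - trace (inv\<^bsub>SL3\<^esub> x) * ch_alpha x k"
  "ch_gamma x (k + 1) = ch_alpha x k"
  by (simp_all add: ch_alpha_def ch_beta_def ch_gamma_def ch_coeffs_0 ch_coeffs_Suc
      ch_step_def split: prod.splits)


section \<open>The polynomials in the traces\<close>

context
  fixes m n :: int and y z :: mat3
begin

private abbreviation (input) "zpow k \<equiv> z [^]\<^bsub>SL3\<^esub> (k::int)"
private abbreviation (input) "\<alpha> k \<equiv> ch_alpha z k"
private abbreviation (input) "\<gamma> k \<equiv> ch_gamma z k"

definition w_mat :: mat3 where
  "w_mat = zpow (- (m + 1)) ** y ** zpow m ** y"

definition p_tr :: "int \<Rightarrow> complex" where "p_tr k = trace (y ** zpow k)"
definition q_tr :: "int \<Rightarrow> complex" where "q_tr k = trace (inv\<^bsub>SL3\<^esub> y ** zpow k)"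

private abbreviation (input) "\<alpha>w \<equiv> ch_alpha w_mat (n + 1)"
private abbreviation (input) "\<beta>w \<equiv> ch_beta w_mat (n + 1)"
private abbreviation (input) "\<gamma>w \<equiv> ch_gamma w_mat (n + 1)"

definition \<sigma>\<^sub>1 :: complex where
  "\<sigma>\<^sub>1 = q_tr (- m) * q_tr (m + 1) * \<alpha> (m + 1) - p_tr m * \<alpha> (3 * m + 2)
     + p_tr (2 * m + 1) * \<alpha> (2 * m + 1) + p_tr 0 * \<alpha> (- 2 * m - 1)"

definition \<sigma>\<^sub>2 :: complex where
  "\<sigma>\<^sub>2 = q_tr (- m) * q_tr (m + 1) * \<gamma> (m + 1) - p_tr m * \<gamma> (3 * m + 2)
     + p_tr (2 * m + 1) * \<gamma> (2 * m + 1) + p_tr 0 * \<gamma> (- 2 * m - 1)"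

definition \<eta>\<^sub>1 :: complex where "\<eta>\<^sub>1 = - \<gamma>w * q_tr (- m) * \<alpha> (- m - 1) - \<alpha>w * \<alpha> m"
definition \<eta>\<^sub>2 :: complex where "\<eta>\<^sub>2 = \<gamma>w * \<sigma>\<^sub>1 + \<beta>w * \<alpha> (m + 1)"
definition \<eta>\<^sub>3 :: complex where "\<eta>\<^sub>3 = - \<gamma>w * q_tr (- m) * \<gamma> (- m - 1) - \<alpha>w * \<gamma> m"
definition \<eta>\<^sub>4 :: complex where "\<eta>\<^sub>4 = \<gamma>w * \<sigma>\<^sub>2 + \<beta>w * \<gamma> (m + 1)"
definition \<eta>\<^sub>5 :: complex where "\<eta>\<^sub>5 = \<gamma>w * \<alpha> (- 2 * m - 1)"
definition \<eta>\<^sub>6 :: complex where "\<eta>\<^sub>6 = \<gamma>w * \<gamma> (- 2 * m - 1)"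

definition \<eta> :: "complex ^ 6" where
  "\<eta> = vector [\<eta>\<^sub>1, \<eta>\<^sub>2, \<eta>\<^sub>3, \<eta>\<^sub>4, \<eta>\<^sub>5, \<eta>\<^sub>6]"

end

definition A_mat :: "mat3 \<Rightarrow> mat3 \<Rightarrow> complex ^ 4 ^ 6" where
  "A_mat y z =
     (let y' = inv\<^bsub>SL3\<^esub> y; z' = inv\<^bsub>SL3\<^esub> z in
      vector [
        vector [tr_word [y,z,y,z] - tr_word [y,y,z,z],   tr_word [y,z,y',z] - tr_word [z,z],
                tr_word [y,z,y,z'] - tr_word [y,y],      tr_word [y,z,y',z'] - 3],
        vector [tr_word [y,z,y',z] - tr_word [z,z],      tr_word [y',z,y',z] - tr_word [y',y',z,z],
                tr_word [y,z,y',z'] - 3,           tr_word [y',z,y',z'] - tr_word [y',y']],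
        vector [tr_word [y,z,y,z'] - tr_word [y,y],      tr_word [y,z,y',z'] - 3,
                tr_word [y,z',y,z'] - tr_word [y,y,z',z'], tr_word [y,z',y',z'] - tr_word [z',z']],
        vector [tr_word [y,z,y',z'] - 3,           tr_word [y',z,y',z'] - tr_word [y',y'],
                tr_word [y,z',y',z'] - tr_word [z',z'],  tr_word [y',z',y',z'] - tr_word [y',y',z',z']],
        vector [tr_word [y,z,z] - tr_word [y,y,z,y',z],  tr_word [y,z,y',y',z] - tr_word [y',z,z],
                tr_word [y] - tr_word [y,y,z,y',z'],     tr_word [y,z,y',y',z'] - tr_word [y']],
        vector [tr_word [y] - tr_word [y,y,z',y',z],     tr_word [y,z',y',y',z] - tr_word [y'],
                tr_word [y,z',z'] - tr_word [y,y,z',y',z'], tr_word [y,z',y',y',z'] - tr_word [y',z',z']]])"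

text \<open>\<open>vector\<close> lists entries in the order of the indices \<open>1, 2, \<dots>\<close>, although the greatest index
  is the numeral congruent to \<open>0\<close>.\<close>

lemma vector_4:
  "(vector [a, b, c, d] :: 'a::zero ^ 4) $ 1 = a" "(vector [a, b, c, d] :: 'a::zero ^ 4) $ 2 = b"
  "(vector [a, b, c, d] :: 'a::zero ^ 4) $ 3 = c" "(vector [a, b, c, d] :: 'a::zero ^ 4) $ 4 = d"
  unfolding vector_def by simp_all

lemma vector_6:
  "(vector [a, b, c, d, e, f] :: 'a::zero ^ 6) $ 1 = a"
  "(vector [a, b, c, d, e, f] :: 'a::zero ^ 6) $ 2 = b"
  "(vector [a, b, c, d, e, f] :: 'a::zero ^ 6) $ 3 = c"
  "(vector [a, b, c, d, e, f] :: 'a::zero ^ 6) $ 4 = d"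
  "(vector [a, b, c, d, e, f] :: 'a::zero ^ 6) $ 5 = e"
  "(vector [a, b, c, d, e, f] :: 'a::zero ^ 6) $ 6 = f"
  unfolding vector_def by simp_all

end

theory Submission
  imports Defs "HOL-Computational_Algebra.Fundamental_Theorem_Algebra"
begin

text \<open>Expanding \<open>w\<^sup>n\<^sup>+\<^sup>1\<close> and the powers of \<open>z\<close> by the Cayley--Hamilton theorem, and using it again in the
  form \<open>x b x = tr(x b) x - tr(b\<^sup>-\<^sup>1 x\<^sup>-\<^sup>1) b\<^sup>-\<^sup>1 + b\<^sup>-\<^sup>1 x\<^sup>-\<^sup>1 b\<^sup>-\<^sup>1\<close>, turns the defining relation into the vanishing of
  \<open>D = \<eta>\<^sub>1 [y, z] + \<eta>\<^sub>2 [y\<^sup>-\<^sup>1, z] + \<eta>\<^sub>3 [y, z\<^sup>-\<^sup>1] + \<eta>\<^sub>4 [y\<^sup>-\<^sup>1, z\<^sup>-\<^sup>1] + \<eta>\<^sub>5 (y z y\<^sup>-\<^sup>1 - y\<^sup>-\<^sup>1 z y)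
  + \<eta>\<^sub>6 (y z\<^sup>-\<^sup>1 y\<^sup>-\<^sup>1 - y\<^sup>-\<^sup>1 z\<^sup>-\<^sup>1 y)\<close>.
  A special matrix is a scalar plus a matrix of rank at most one, so two special matrices have a common
  eigenvector. If one of \<open>y, z\<close> is special, its inverse is an affine function of it and \<open>D\<close> reduces to
  a combination of two or three linearly independent matrices.

  The condition on the commutator traces says \<open>det [y, z] = 0\<close>. A kernel vector and a left kernel
  vector of \<open>[y, z]\<close> yield a nonzero symmetric bilinear form for which \<open>y\<close> and \<open>z\<close> are self-adjoint;
  by irreducibility it is nondegenerate, and an orthonormal basis symmetrizes the pair. Then \<open>D\<close> is
  antisymmetric, the columns of \<open>A\<close> are the traces of \<open>D\<close> against \<open>y z, y\<^sup>-\<^sup>1 z, y z\<^sup>-\<^sup>1, y\<^sup>-\<^sup>1 z\<^sup>-\<^sup>1\<close>, and the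
  antisymmetric parts of these four products span all antisymmetric matrices when \<open>y\<close> and \<open>z\<close> are ordinary.\<close>

section \<open>Matrices of size three\<close>

definition smat :: "complex \<Rightarrow> mat3 \<Rightarrow> mat3" (infixr "\<cdot>" 75) where
  "c \<cdot> A = (\<chi> i j. c * A $ i $ j)"

lemma smat_nth [simp]: "(c \<cdot> A) $ i $ j = c * A $ i $ j"
  by (simp add: smat_def)

lemma smat_simps [simp]: "1 \<cdot> A = A" "0 \<cdot> A = 0" "c \<cdot> 0 = 0"
  by (simp_all add: vec_eq_iff)

lemma mat_eqI: "(\<And>i j. A $ i $ j = B $ i $ j) \<Longrightarrow> A = (B :: mat3)"
  by (simp add: vec_eq_iff)

lemma mat3_mul_nth: "((A :: mat3) ** B) $ i $ j = A$i$1 * B$1$j + A$i$2 * B$2$j + A$i$3 * B$3$j"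
  by (simp add: matrix_matrix_mult_def sum_3)

lemma mat3_vec_nth: "((A :: mat3) *v x) $ i = A$i$1 * x$1 + A$i$2 * x$2 + A$i$3 * x$3"
  by (simp add: matrix_vector_mult_def sum_3)

lemma mat3_nth:
  "(mat c :: mat3) $ 1 $ 1 = c" "(mat c :: mat3) $ 2 $ 2 = c" "(mat c :: mat3) $ 3 $ 3 = c"
  "(mat c :: mat3) $ 1 $ 2 = 0" "(mat c :: mat3) $ 1 $ 3 = 0" "(mat c :: mat3) $ 2 $ 1 = 0"
  "(mat c :: mat3) $ 2 $ 3 = 0" "(mat c :: mat3) $ 3 $ 1 = 0" "(mat c :: mat3) $ 3 $ 2 = 0"
  by (simp_all add: mat_def)

lemma trace3: "trace (A :: mat3) = A$1$1 + A$2$2 + A$3$3"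
  by (simp add: trace_def sum_3)

lemma mat_conv_smat: "mat c = c \<cdot> mat 1"
  by (rule mat_eqI) (simp add: mat_def)

lemmas coords = vec_eq_iff forall_3 mat3_mul_nth mat3_vec_nth mat3_nth

lemma mat_ring:
  fixes A B C :: mat3
  shows "A ** (B ** C) = A ** B ** C"
    "A ** (B + C) = A ** B + A ** C" "(A + B) ** C = A ** C + B ** C"
    "A ** (B - C) = A ** B - A ** C" "(A - B) ** C = A ** C - B ** C"
    "A ** (- B) = - (A ** B)" "(- A) ** B = - (A ** B)"
    "A ** (c \<cdot> B) = c \<cdot> (A ** B)" "(c \<cdot> A) ** B = c \<cdot> (A ** B)"
    "A ** 0 = 0" "0 ** A = 0"
  by (rule matrix_mul_assoc) (simp_all add: coords algebra_simps)

lemma trace_ring: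
  fixes A B :: mat3
  shows "trace (A + B) = trace A + trace B" "trace (A - B) = trace A - trace B"
    "trace (- A) = - trace A" "trace (c \<cdot> A) = c * trace A" "trace (mat c :: mat3) = 3 * c"
    "trace (0 :: mat3) = 0"
  by (simp_all add: trace3 mat3_nth algebra_simps)

lemma trace_mul_commute: "trace (A ** B) = trace (B ** (A :: mat3))"
  by (simp add: trace3 mat3_mul_nth algebra_simps)

lemma trace_transpose3: "trace (transpose A) = trace (A :: mat3)"
  by (simp add: trace3 transpose_def)

text \<open>The coefficient of A is the second elementary symmetric function of the eigenvalues,
  rewritten in power sums as an expression in traces.\<close>

lemma cayley_hamilton:
  fixes A :: mat3
  shows "A ** A ** A = trace A \<cdot> (A ** A) - (((trace A)\<^sup>2 - trace (A ** A)) / 2) \<cdot> A + det A \<cdot> mat 1"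
  by (simp add: coords trace3 det_3 power2_eq_square field_simps)

lemma SL3_iff: "A \<in> carrier SL3 \<longleftrightarrow> det A = 1"
  by (simp add: SL3_def)

abbreviation inv3 :: "mat3 \<Rightarrow> mat3" where "inv3 A \<equiv> inv\<^bsub>SL3\<^esub> A"

lemma SL3_inv:
  assumes "A \<in> carrier SL3"
  shows "A ** inv3 A = mat 1" "inv3 A ** A = mat 1" "inv3 A \<in> carrier SL3"
  using group.r_inv[OF group_SL3 assms] group.l_inv[OF group_SL3 assms]
    group.inv_closed[OF group_SL3 assms] by (simp_all add: SL3_def)

lemma SL3_inv_unique:
  assumes "A \<in> carrier SL3" "A ** B = mat 1"
  shows "inv3 A = B"
proof -
  have "inv3 A ** (A ** B) = inv3 A" using assms by simp
  then show ?thesis using SL3_inv[OF assms(1)] by (simp add: matrix_mul_assoc)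
qed

text \<open>Multiplying Cayley-Hamilton by A^-1 lowers every power by one; the trace of the result
  identifies the middle coefficient as tr(A^-1).\<close>

lemma trace_inv3:
  assumes "A \<in> carrier SL3"
  shows "trace (inv3 A) = ((trace A)\<^sup>2 - trace (A ** A)) / 2"
    and "A ** A = trace A \<cdot> A - trace (inv3 A) \<cdot> mat 1 + inv3 A"
proof -
  define s where "s = ((trace A)\<^sup>2 - trace (A ** A)) / 2"
  have "A ** A ** A ** inv3 A = (trace A \<cdot> (A ** A) - s \<cdot> A + mat 1) ** inv3 A"
    using cayley_hamilton[of A] assms by (simp add: s_def SL3_iff)
  moreover have "B ** A ** inv3 A = B" for B :: mat3
    using SL3_inv[OF assms] by (simp add: matrix_mul_assoc[symmetric])
  ultimately have *: "A ** A = trace A \<cdot> A - s \<cdot> mat 1 + inv3 A"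
    using SL3_inv[OF assms] by (simp add: mat_ring)
  have "trace (A ** A) = trace A * trace A - s * 3 + trace (inv3 A)"
    by (subst *) (simp add: trace_ring)
  then show s: "trace (inv3 A) = ((trace A)\<^sup>2 - trace (A ** A)) / 2"
    by (simp add: s_def power2_eq_square field_simps)
  show "A ** A = trace A \<cdot> A - trace (inv3 A) \<cdot> mat 1 + inv3 A"
    using * by (simp add: s s_def)
qed

section \<open>Rank one matrices and irreducible pairs\<close>

type_synonym vec3 = "complex ^ 3"

text \<open>Bilinear, without complex conjugation, to fit transposition; nonzero vectors may
  therefore be isotropic.\<close>

definition dot :: "vec3 \<Rightarrow> vec3 \<Rightarrow> complex" where
  "dot x y = x$1 * y$1 + x$2 * y$2 + x$3 * y$3"

definition cross :: "vec3 \<Rightarrow> vec3 \<Rightarrow> vec3" where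
  "cross x y = vector [x$2 * y$3 - x$3 * y$2, x$3 * y$1 - x$1 * y$3, x$1 * y$2 - x$2 * y$1]"

definition outer :: "vec3 \<Rightarrow> vec3 \<Rightarrow> mat3" where
  "outer a f = (\<chi> i j. a $ i * f $ j)"

lemma cross_nth:
  "cross x y $ 1 = x$2 * y$3 - x$3 * y$2" "cross x y $ 2 = x$3 * y$1 - x$1 * y$3"
  "cross x y $ 3 = x$1 * y$2 - x$2 * y$1"
  by (simp_all add: cross_def)

lemma outer_nth [simp]: "outer a f $ i $ j = a $ i * f $ j"
  by (simp add: outer_def)

lemma vmat3_nth: "(x v* (A :: mat3)) $ i = x$1 * A$1$i + x$2 * A$2$i + x$3 * A$3$i"
  by (simp add: vector_matrix_mult_def sum_3 mult.commute)

lemmas vcoords = coords dot_def cross_nth vmat3_nth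

lemma dot_commute: "dot x y = dot y x"
  by (simp add: dot_def mult.commute)

lemma dot_simps:
  "dot (x + x') y = dot x y + dot x' y" "dot y (x + x') = dot y x + dot y x'"
  "dot (x - x') y = dot x y - dot x' y" "dot y (x - x') = dot y x - dot y x'"
  "dot (c *s x) y = c * dot x y" "dot y (c *s x) = c * dot y x"
  "dot 0 y = 0" "dot y 0 = 0"
  by (simp_all add: dot_def algebra_simps)

lemma dot_mult: "dot f (A *v x) = dot (f v* A) x"
  by (simp add: vcoords algebra_simps)

lemma outer_vec: "outer a f *v x = dot f x *s a"
  by (simp add: vcoords algebra_simps)

lemma vec_outer: "x v* outer a f = dot x a *s f"
  by (simp add: vcoords algebra_simps)

lemma outer_mul: "A ** outer a f = outer (A *v a) f" "outer a f ** A = outer a (f v* A)"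
  by (simp_all add: vcoords algebra_simps)

lemma outer_add: "outer a (f + g) = outer a f + outer a g" "outer a (c *s f) = c \<cdot> outer a f"
   "outer (c *s a) f = c \<cdot> outer a f" "outer (a + b) f = outer a f + outer b f"
  by (simp_all add: vec_eq_iff algebra_simps)

lemma trace_outer: "trace (outer a f) = dot f a"
  by (simp add: trace3 dot_def)

lemma smat_vec: "(c \<cdot> A) *v x = c *s (A *v x)" "A *v (c *s x) = c *s (A *v x)"
  "mat c *v x = c *s (x :: vec3)" "x v* mat c = c *s (x :: vec3)" "x v* (c \<cdot> A) = c *s (x v* A)"
  "(c *s x) v* A = c *s (x v* A)"
  by (simp_all add: vcoords algebra_simps)

text \<open>The inverse is a quadratic polynomial in A. Hence A-invariant subspaces are invariant
  under A^-1, and A^-1 x lies in the span of x, A x, A^2 x.\<close>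

lemma inv3_vec:
  assumes "A \<in> carrier SL3"
  shows "inv3 A *v x = A *v (A *v x) - trace A *s (A *v x) + trace (inv3 A) *s x"
proof -
  have "inv3 A = A ** A - trace A \<cdot> A + trace (inv3 A) \<cdot> mat 1"
    using trace_inv3(2)[OF assms] by simp
  then have "inv3 A *v x = (A ** A - trace A \<cdot> A + trace (inv3 A) \<cdot> mat 1) *v x" by (rule arg_cong)
  then show ?thesis
    by (simp only: matrix_vector_mult_add_rdistrib matrix_vector_mult_diff_rdistrib smat_vec(1)
        matrix_vector_mul_assoc matrix_vector_mul_lid)
qed

lemma outer_eq_0: "outer a f = 0 \<longleftrightarrow> a = 0 \<or> f = 0"
  by (auto simp: vec_eq_iff)

lemma outer_eqD:
  assumes "outer a f = outer b g" "f \<noteq> 0"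
  shows "\<exists>c. a = c *s b"
proof -
  obtain j where j: "f $ j \<noteq> 0" using assms(2) by (auto simp: vec_eq_iff)
  have "a $ i * f $ j = b $ i * g $ j" for i
    using assms(1) by (simp add: vec_eq_iff)
  then have "a = (g $ j / f $ j) *s b"
    using j by (simp add: vec_eq_iff field_simps)
  then show ?thesis ..
qed

lemma outer_eqD':
  assumes "outer a f = outer b g" "a \<noteq> 0"
  shows "\<exists>c. f = c *s g"
proof -
  obtain j where j: "a $ j \<noteq> 0" using assms(2) by (auto simp: vec_eq_iff)
  have "a $ j * f $ i = b $ j * g $ i" for i
    using assms(1) by (simp add: vec_eq_iff)
  then have "f = (b $ j / a $ j) *s g"
    using j by (simp add: vec_eq_iff field_simps)
  then show ?thesis ..
qed

text \<open>The coordinates of the cross product are the 2x2 minors of the pair; if they vanish,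
  \<open>outer x y\<close> is symmetric.\<close>

lemma cross_eq_0D:
  assumes "cross x y = 0" "x \<noteq> 0"
  shows "\<exists>c. y = c *s x"
proof -
  have "outer x y = outer y x"
    using assms(1) by (simp add: vcoords algebra_simps)
  from outer_eqD'[OF this assms(2)] show ?thesis .
qed

text \<open>By the double cross product identity, r is parallel to the normal of the plane of x and
  y.\<close>

lemma orthogonal_to_both:
  assumes "dot r x = 0" "dot r y = 0" "cross x y \<noteq> 0"
  shows "\<exists>c. r = c *s cross x y"
proof -
  have "cross (cross x y) r = dot r x *s y - dot r y *s x"
    by (simp add: vcoords algebra_simps)
  then have "cross (cross x y) r = 0" using assms by simp
  then show ?thesis using assms by (blast dest: cross_eq_0D)
qed

text \<open>Cramer's rule in the two coordinates that give a nonzero minor of x and y; the vanishing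
  triple product settles the third coordinate.\<close>

lemma coplanarD:
  assumes "dot v (cross x y) = 0" "cross x y \<noteq> 0"
  shows "\<exists>s t. v = s *s x + t *s y"
proof -
  have scale: ?thesis if "d \<noteq> 0" "d *s v = s *s x + t *s y" for d s t
  proof -
    have "v = (1 / d) *s (d *s v)" using that(1) by simp
    also have "\<dots> = (s / d) *s x + (t / d) *s y"
      by (simp add: that(2) vector_add_ldistrib)
    finally show ?thesis by blast
  qed
  have v: "v$1 * (x$2 * y$3 - x$3 * y$2) + v$2 * (x$3 * y$1 - x$1 * y$3)
      + v$3 * (x$1 * y$2 - x$2 * y$1) = 0"
    using assms(1) by (simp add: dot_def cross_nth)
  consider "cross x y $ 1 \<noteq> 0" | "cross x y $ 2 \<noteq> 0" | "cross x y $ 3 \<noteq> 0"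
    using assms(2) by (auto simp: vec_eq_iff forall_3)
  then show ?thesis
  proof cases
    case 1
    have "cross x y $ 1 *s v = (v$2 * y$3 - v$3 * y$2) *s x + (x$2 * v$3 - x$3 * v$2) *s y"
      using v by (simp add: vec_eq_iff forall_3 cross_nth) algebra
    with 1 show ?thesis by (rule scale)
  next
    case 2
    have "cross x y $ 2 *s v = (v$3 * y$1 - v$1 * y$3) *s x + (x$3 * v$1 - x$1 * v$3) *s y"
      using v by (simp add: vec_eq_iff forall_3 cross_nth) algebra
    with 2 show ?thesis by (rule scale)
  next
    case 3
    have "cross x y $ 3 *s v = (v$1 * y$2 - v$2 * y$1) *s x + (x$1 * v$2 - x$2 * v$1) *s y"
      using v by (simp add: vec_eq_iff forall_3 cross_nth) algebra
    with 3 show ?thesis by (rule scale)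
  qed
qed

text \<open>A dichotomy on the rank: if two independent vectors are killed, every row is a multiple
  of their cross product. It takes the place of Jordan normal forms throughout.\<close>

lemma outer_or_kernel_line:
  "(\<exists>a f. M = outer a f) \<or> (\<exists>k. \<forall>x. M *v x = 0 \<longrightarrow> (\<exists>c. x = c *s k))"
proof (cases "\<exists>x y. M *v x = 0 \<and> M *v y = 0 \<and> cross x y \<noteq> 0")
  case True
  then obtain x y where xy: "M *v x = 0" "M *v y = 0" "cross x y \<noteq> 0" by blast
  have "dot (M $ i) x = 0" "dot (M $ i) y = 0" for i
    using xy(1,2) by (simp_all add: vec_eq_iff mat3_vec_nth dot_def)
  then have "\<exists>c. M $ i = c *s cross x y" for i
    using orthogonal_to_both xy(3) by blast
  then obtain c where "\<And>i. M $ i = c i *s cross x y" by metis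
  then have "M = outer (\<chi> i. c i) (cross x y)" by (simp add: vec_eq_iff)
  then show ?thesis by blast
next
  case False
  show ?thesis
  proof (cases "\<exists>k. k \<noteq> 0 \<and> M *v k = 0")
    case True
    with False show ?thesis using cross_eq_0D by metis
  next
    case F: False
    \<comment> \<open>For a trivial kernel the degenerate line spanned by 0 serves.\<close>
    then have "\<forall>x. M *v x = 0 \<longrightarrow> (\<exists>c. x = c *s 0)" by auto
    then show ?thesis by blast
  qed
qed

section \<open>Kernels, eigenvectors and commutants\<close>

lemma det_0_kernel:
  assumes "det (M :: mat3) = 0"
  shows "\<exists>x. x \<noteq> 0 \<and> M *v x = 0"
proof -
  have "\<not> invertible M" using assms by (simp add: invertible_det_nz)
  then show ?thesis
    using matrix_left_invertible_ker[of M] by (auto simp: invertible_left_inverse)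
qed

lemma char_poly_3:
  "det (M - mat c :: mat3) = det M - ((trace M)\<^sup>2 - trace (M ** M)) / 2 * c + trace M * c\<^sup>2 - c ^ 3"
proof -
  have "((trace M)\<^sup>2 - trace (M ** M)) / 2
    = M$1$1 * M$2$2 - M$1$2 * M$2$1 + M$1$1 * M$3$3 - M$1$3 * M$3$1 + M$2$2 * M$3$3 - M$2$3 * M$3$2"
    by (simp add: trace3 mat3_mul_nth power2_eq_square field_simps)
  note minors = this
  show ?thesis
    unfolding minors by (simp add: det_3 trace3 mat3_nth) algebra
qed

lemma eigenvector_exists: "\<exists>c x. x \<noteq> 0 \<and> (M :: mat3) *v x = c *s x"
proof -
  define p where "p = [: det M, - (((trace M)\<^sup>2 - trace (M ** M)) / 2), trace M, - 1 :]"
  have "\<not> constant (poly p)" by (simp add: p_def constant_degree)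
  then obtain c where c: "poly p c = 0" using fundamental_theorem_of_algebra by blast
  have "det (M - mat c) = poly p c"
    unfolding char_poly_3 p_def by (simp add: power2_eq_square power3_eq_cube algebra_simps)
  then obtain x where "x \<noteq> 0" "(M - mat c) *v x = 0"
    using det_0_kernel[of "M - mat c"] c by auto
  then show ?thesis by (auto simp: matrix_vector_mult_diff_rdistrib smat_vec)
qed

text \<open>Let M = p - c for an eigenvalue c. If M has rank one, its image is a line preserved by
  everything that commutes with p; otherwise its kernel is such a line. The same vector thus works
  for all q.\<close>

lemma commutant_eigenvector:
  fixes p :: mat3
  assumes "\<And>c. p \<noteq> mat c"
  shows "\<exists>a. a \<noteq> 0 \<and> (\<forall>q. p ** q = q ** p \<longrightarrow> (\<exists>\<mu>. q *v a = \<mu> *s a))"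
proof -
  obtain c x where x: "x \<noteq> 0" "p *v x = c *s x" using eigenvector_exists[of p] by auto
  define M where "M = p - mat c"
  have comm: "M ** q = q ** M" if "p ** q = q ** p" for q
    using that by (simp add: M_def mat_ring mat_conv_smat[of c])
  have Mx: "M *v x = 0" using x by (simp add: M_def matrix_vector_mult_diff_rdistrib smat_vec)
  from outer_or_kernel_line[of M] show ?thesis
  proof (elim disjE exE)
    fix a f assume M: "M = outer a f"
    have "M \<noteq> 0" using assms[of c] by (simp add: M_def)
    then have af: "a \<noteq> 0" "f \<noteq> 0" by (auto simp: M outer_eq_0)
    have "\<exists>\<mu>. q *v a = \<mu> *s a" if "p ** q = q ** p" for q
    proof -
      have "outer (q *v a) f = outer a (f v* q)"
        using comm[OF that] by (simp add: M outer_mul)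
      from outer_eqD[OF this af(2)] show ?thesis .
    qed
    with af show ?thesis by blast
  next
    fix k assume k: "\<forall>x. M *v x = 0 \<longrightarrow> (\<exists>c. x = c *s k)"
    from k Mx obtain d where d: "x = d *s k" by blast
    with x have "d \<noteq> 0" by auto
    have "\<exists>\<mu>. q *v x = \<mu> *s x" if "p ** q = q ** p" for q
    proof -
      have "M *v (q *v x) = 0"
        unfolding matrix_vector_mul_assoc comm[OF that]
        unfolding matrix_vector_mul_assoc[symmetric] Mx by simp
      then obtain e where "q *v x = e *s k" using k by blast
      then have "q *v x = (e / d) *s x" using d \<open>d \<noteq> 0\<close> by simp
      then show ?thesis ..
    qed
    with x show ?thesis by blast
  qed
qed

text \<open>For matrices in SL(3,C) this agrees with irreducibility of the representation, because
  inverses are polynomials in the matrices; see \<open>irreducible_rep_iff_irr\<close>.\<close>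

definition irr :: "mat3 \<Rightarrow> mat3 \<Rightarrow> bool" where
  "irr y z \<longleftrightarrow> (\<forall>W. vec.subspace W \<longrightarrow> (\<forall>v\<in>W. y *v v \<in> W \<and> z *v v \<in> W) \<longrightarrow> W = {0} \<or> W = UNIV)"

lemma irr_commute: "irr y z \<longleftrightarrow> irr z y"
  unfolding irr_def by metis

lemma irr_no_eigenvector:
  assumes "irr y z" "a \<noteq> 0" "y *v a = \<alpha> *s a" "z *v a = \<beta> *s a"
  shows False
proof -
  have "vec.subspace (range (\<lambda>c. c *s a))"
    unfolding vec.subspace_def
    by (auto simp flip: vector_sadd_rdistrib)
  moreover have "\<forall>v\<in>range (\<lambda>c. c *s a). y *v v \<in> range (\<lambda>c. c *s a) \<and> z *v v \<in> range (\<lambda>c. c *s a)"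
    using assms by (auto simp: smat_vec)
  ultimately have "range (\<lambda>c. c *s a) = {0} \<or> range (\<lambda>c. c *s a) = UNIV"
    using assms(1) unfolding irr_def by blast
  then show False
  proof
    assume "range (\<lambda>c. c *s a) = {0}"
    then have "1 *s a = 0" by blast
    then show False using assms(2) by simp
  next
    assume "range (\<lambda>c. c *s a) = UNIV"
    \<comment> \<open>A line cannot contain two different axes.\<close>
    then obtain c d where "axis 1 1 = c *s a" "axis 2 1 = d *s a" by blast
    then have "axis 1 1 $ i = c * a $ i" "axis 2 1 $ i = d * a $ i" for i
      by (simp_all flip: vector_smult_component)
    from this(1)[of 1] this(1)[of 2] this(2)[of 2] show False by (auto simp: axis_def)
  qed
qed

lemma irr_no_left_eigenvector:
  assumes "irr y z" "f \<noteq> 0" "f v* y = \<alpha> *s f" "f v* z = \<beta> *s f"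
  shows False
proof -
  have "vec.subspace {x. dot f x = 0}"
    by (auto simp: vec.subspace_def dot_simps)
  moreover have "\<forall>v\<in>{x. dot f x = 0}. y *v v \<in> {x. dot f x = 0} \<and> z *v v \<in> {x. dot f x = 0}"
    using assms by (auto simp: dot_mult dot_simps)
  ultimately have "{x. dot f x = 0} = {0} \<or> {x. dot f x = 0} = UNIV"
    using assms(1) unfolding irr_def by blast
  then show False
  proof
    assume *: "{x. dot f x = 0} = {0}"
    \<comment> \<open>The singular matrix \<open>outer f f\<close> supplies a nonzero vector in the
      plane annihilated by f.\<close>
    have "\<exists>x. x \<noteq> 0 \<and> outer f f *v x = 0"
      by (rule det_0_kernel) (simp add: det_3)
    then have "\<exists>x. x \<noteq> 0 \<and> dot f x = 0" using assms(2) by (auto simp: outer_vec)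
    with * show False by blast
  next
    assume *: "{x. dot f x = 0} = UNIV"
    then have "dot f (axis 1 1) = 0" "dot f (axis 2 1) = 0" "dot f (axis 3 1) = 0" by blast+
    then show False using assms(2) by (simp add: dot_def axis_def vec_eq_iff forall_3)
  qed
qed

text \<open>For a nonscalar p, \<open>commutant_eigenvector\<close> would give y and z a common
  eigenvector.\<close>

lemma irr_schur:
  assumes "irr y z" "p ** y = y ** p" "p ** z = z ** p"
  shows "\<exists>c. p = mat c"
  using assms commutant_eigenvector[of p] irr_no_eigenvector by metis

section \<open>Special matrices\<close>

text \<open>If the kernel of M is at most a line, that line contains all columns of M'.\<close>

lemma product_zero_outer:
  assumes "M ** M' = (0 :: mat3)"
  shows "(\<exists>a f. M = outer a f) \<or> (\<exists>a f. M' = outer a f)"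
  using outer_or_kernel_line[of M]
proof (elim disjE exE)
  fix k assume k: "\<forall>x. M *v x = 0 \<longrightarrow> (\<exists>c. x = c *s k)"
  have "\<exists>c. column j M' = c *s k" for j
  proof -
    have "M *v column j M' = 0"
      using assms by (simp add: vec_eq_iff mat3_vec_nth mat3_mul_nth column_def)
    with k show ?thesis by blast
  qed
  then obtain c where "\<And>j. column j M' = c j *s k" by metis
  then have "M' = outer k (\<chi> j. c j)"
    by (simp add: vec_eq_iff column_def mult.commute)
  then show ?thesis by blast
qed blast

lemma poly_mat_le:
  assumes "degree p \<le> N"
  shows "poly_mat p A = (\<Sum>i\<le>N. mat (coeff p i) ** (((**) A) ^^ i) (mat 1))"
  unfolding poly_mat_def using assms
  by (intro sum.mono_neutral_left) (auto simp: coeff_eq_0 mat_conv_smat[of 0] mat_ring)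

lemma poly_mat_2:
  assumes "degree p \<le> 2"
  shows "poly_mat p A = mat (coeff p 0) + coeff p 1 \<cdot> A + coeff p 2 \<cdot> (A ** A)"
  unfolding poly_mat_le[OF assms]
  by (simp add: numeral_2_eq_2 mat_conv_smat[of "coeff p _"] mat_ring)

lemma poly_mat_3:
  assumes "degree p \<le> 3"
  shows "poly_mat p A = mat (coeff p 0) + coeff p 1 \<cdot> A + coeff p 2 \<cdot> (A ** A) + coeff p 3 \<cdot> (A ** A ** A)"
  unfolding poly_mat_le[OF assms]
  by (simp add: numeral_2_eq_2 numeral_3_eq_3 mat_conv_smat[of "coeff p _"] mat_ring)

text \<open>The eigenvalues are c, c and c + f.a, and the quadratic with roots c and c + f.a already
  annihilates A.\<close>

lemma outer_shift_square:
  assumes "A = mat c + outer a f"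
  shows "A ** A = (2 * c + dot f a) \<cdot> A - mat (c * (c + dot f a))"
  unfolding assms
  by (simp add: coords dot_def) algebra

text \<open>The quadratic factors over C, so two shifts of A by scalars have product zero and one of
  them has rank at most one.\<close>

lemma quadratic_outer_shift:
  assumes "mat c\<^sub>0 + c\<^sub>1 \<cdot> A + c\<^sub>2 \<cdot> (A ** A) = 0" "c\<^sub>2 \<noteq> 0"
  shows "\<exists>c a f. A = mat c + outer a f"
proof -
  have "\<not> constant (poly [:c\<^sub>0, c\<^sub>1, c\<^sub>2:])" using assms(2) by (simp add: constant_degree)
  then obtain r where "poly [:c\<^sub>0, c\<^sub>1, c\<^sub>2:] r = 0" using fundamental_theorem_of_algebra by blast
  then have r: "c\<^sub>0 = - c\<^sub>1 * r - c\<^sub>2 * r * r" by simp algebra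
  \<comment> \<open>The second root, by Vieta.\<close>
  define s where "s = - c\<^sub>1 / c\<^sub>2 - r"
  have s: "c\<^sub>1 = - c\<^sub>2 * (r + s)" using assms(2) by (simp add: s_def field_simps)
  have "c\<^sub>2 \<cdot> ((A - mat r) ** (A - mat s)) = mat c\<^sub>0 + c\<^sub>1 \<cdot> A + c\<^sub>2 \<cdot> (A ** A)"
    unfolding r s by (simp add: mat_ring mat_conv_smat[of r] mat_conv_smat[of s] mat_conv_smat[of "- _ - _"] mat_conv_smat[of "_ * _"] vec_eq_iff algebra_simps)
  then have "(A - mat r) ** (A - mat s) = 0" using assms by (simp add: vec_eq_iff)
  from product_zero_outer[OF this] have "\<exists>c a f. A - mat c = outer a f" by blast
  then show ?thesis by (metis add.commute diff_add_cancel)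
qed

text \<open>A scalar plus a rank one matrix satisfies a quadratic equation. Conversely, if A is not
  of this form, no nonzero polynomial of degree at most two kills it and its characteristic
  polynomial is minimal.\<close>

lemma special_iff: "special A \<longleftrightarrow> (\<exists>c a f. A = mat c + outer a f)"
proof
  assume "\<exists>c a f. A = mat c + outer a f"
  then obtain c a f where A: "A = mat c + outer a f" by blast
  define q where "q = [: c * (c + dot f a), - (2 * c + dot f a), 1 :]"
  have q: "degree q = 2" "q \<noteq> 0" by (simp_all add: q_def)
  then have "poly_mat q A = mat (c * (c + dot f a)) + (- (2 * c + dot f a)) \<cdot> A + 1 \<cdot> (A ** A)"
    by (simp add: poly_mat_2) (simp add: q_def numeral_2_eq_2)
  also have "\<dots> = 0"
    unfolding outer_shift_square[OF A] by (simp add: vec_eq_iff algebra_simps)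
  finally show "special A"
    using q unfolding special_def ordinary_def is_minimal_poly_def
    by (auto intro!: exI[of _ q])
next
  assume "special A"
  show "\<exists>c a f. A = mat c + outer a f"
  proof (rule ccontr)
    assume no: "\<nexists>c a f. A = mat c + outer a f"
    \<comment> \<open>The characteristic polynomial.\<close>
    define p where "p = [: - det A, ((trace A)\<^sup>2 - trace (A ** A)) / 2, - trace A, 1 :]"
    have p: "degree p = 3" "lead_coeff p = 1" by (simp_all add: p_def)
    have "poly_mat p A = mat (- det A) + (((trace A)\<^sup>2 - trace (A ** A)) / 2) \<cdot> A
       + (- trace A) \<cdot> (A ** A) + 1 \<cdot> (A ** A ** A)"
      using p by (simp add: poly_mat_3) (simp add: p_def numeral_2_eq_2 numeral_3_eq_3)
    also have "\<dots> = 0"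
      unfolding cayley_hamilton mat_conv_smat[of "- det A"] by (simp add: vec_eq_iff)
    finally have p0: "poly_mat p A = 0" .
    have "degree p \<le> degree q" if q: "q \<noteq> 0" "poly_mat q A = 0" for q
    proof (rule ccontr)
      assume "\<not> degree p \<le> degree q"
      then have dq: "degree q \<le> 2" using p by simp
      have eq: "mat (coeff q 0) + coeff q 1 \<cdot> A + coeff q 2 \<cdot> (A ** A) = 0"
        using q(2) by (simp add: poly_mat_2[OF dq])
      then have c2: "coeff q 2 = 0" using quadratic_outer_shift no by blast
      \<comment> \<open>A linear relation would make A scalar, which is the excluded form with zero
        rank one part.\<close>
      have "A = mat (- coeff q 0 / coeff q 1) + outer 0 0" if "coeff q 1 \<noteq> 0"
        using eq that by (simp add: c2 coords field_simps eq_neg_iff_add_eq_0)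
      then have c1: "coeff q 1 = 0" using no by blast
      have c0: "coeff q 0 = 0" using eq by (simp add: c2 c1[simplified] coords)
      have "coeff q i = 0" for i
      proof (cases "i \<le> 2")
        case True
        then have "i = 0 \<or> i = 1 \<or> i = 2" by auto
        then show ?thesis using c0 c1 c2 by auto
      qed (use dq in \<open>simp add: coeff_eq_0\<close>)
      then show False using q(1) by (simp add: poly_eq_iff)
    qed
    then show False
      using p p0 \<open>special A\<close> unfolding special_def ordinary_def is_minimal_poly_def by blast
  qed
qed

text \<open>The last hypothesis says that the eigenvalues are l, l, l^-2. The quadratic relation A^2
  = (l + l^-2) A - l^-1 is then solved for the inverse.\<close>

lemma outer_shift_inverse:
  assumes "A \<in> carrier SL3" "A = mat l + outer a f" "l \<noteq> 0" "dot f a = l powi (-2) - l"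
  shows "inv3 A = mat (l\<^sup>2 + l powi (-1)) - l \<cdot> A"
proof (rule SL3_inv_unique[OF assms(1)])
  have "A ** (mat (l\<^sup>2 + l powi (-1)) - l \<cdot> A) = (l\<^sup>2 + l powi (-1)) \<cdot> A - l \<cdot> (A ** A)"
    by (simp add: mat_conv_smat[of "_ + _"] mat_ring)
  also have "\<dots> = mat 1"
    unfolding outer_shift_square[OF assms(2)] assms(4) mat_conv_smat[of "_ * _"]
    using assms(3) by (simp add: vec_eq_iff power_int_minus power2_eq_square field_simps)
  finally show "A ** (mat (l\<^sup>2 + l powi (-1)) - l \<cdot> A) = mat 1" .
qed

lemma special_SL3:
  assumes "special A" "A \<in> carrier SL3"
  obtains l a f where "A = mat l + outer a f" "l \<noteq> 0" "dot f a = l powi (-2) - l"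
    "inv3 A = mat (l\<^sup>2 + l powi (-1)) - l \<cdot> A" "trace A = 2 * l + l powi (-2)"
    "trace (inv3 A) = 2 * l powi (-1) + l\<^sup>2"
proof -
  obtain l a f where A: "A = mat l + outer a f" using assms(1) special_iff by blast
  \<comment> \<open>The determinant being 1 forces the third eigenvalue to be l^-2.\<close>
  have "det A = l * l * (l + dot f a)"
    unfolding A by (simp add: det_3 mat3_nth dot_def algebra_simps)
  then have d: "l * l * (l + dot f a) = 1" using assms(2) by (simp add: SL3_iff)
  then have l: "l \<noteq> 0" by auto
  have fa: "dot f a = l powi (-2) - l"
    using d l by (simp add: power_int_minus power2_eq_square field_simps)
  from outer_shift_inverse[OF assms(2) A l fa]
  have inv: "inv3 A = mat (l\<^sup>2 + l powi (-1)) - l \<cdot> A" .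
  have t: "trace A = 2 * l + l powi (-2)"
    unfolding A by (simp add: trace_ring trace_outer fa)
  have "trace (inv3 A) = 2 * l powi (-1) + l\<^sup>2"
    unfolding inv trace_ring t using l by (simp add: power_int_minus power2_eq_square field_simps)
  with A l fa inv t show ?thesis using that by blast
qed

text \<open>Each matrix acts as a scalar on a subspace of dimension at least two, and two such
  subspaces of C^3 meet nontrivially.\<close>

lemma irr_not_both_special:
  assumes "irr y z" "special y"
  shows "ordinary z"
proof (rule ccontr)
  assume "\<not> ordinary z"
  then obtain c a f d b g where y: "y = mat c + outer a f" and z: "z = mat d + outer b g"
    using assms(2) special_iff special_def by metis
  \<comment> \<open>The zero row makes this matrix singular; its kernel consists of the vectors
    annihilated by both f and g.\<close>
  have "det (vector [f, g, 0] :: mat3) = 0" by (simp add: det_3)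
  then obtain x where "x \<noteq> 0" "(vector [f, g, 0] :: mat3) *v x = 0" using det_0_kernel by blast
  then have x: "x \<noteq> 0" "dot f x = 0" "dot g x = 0" by (simp_all add: vcoords)
  have "y *v x = c *s x" "z *v x = d *s x"
    by (simp_all add: y z matrix_vector_mult_add_rdistrib smat_vec outer_vec x)
  with assms(1) x(1) show False by (rule irr_no_eigenvector)
qed

section \<open>The defining relation\<close>

lemma SL3_pow:
  assumes "x \<in> carrier SL3"
  shows "x [^]\<^bsub>SL3\<^esub> (0 :: int) = mat 1" "x [^]\<^bsub>SL3\<^esub> (k :: int) \<in> carrier SL3"
    "x [^]\<^bsub>SL3\<^esub> (j + k) = x [^]\<^bsub>SL3\<^esub> (j :: int) ** x [^]\<^bsub>SL3\<^esub> k"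
    "inv3 (x [^]\<^bsub>SL3\<^esub> k) = x [^]\<^bsub>SL3\<^esub> (- k)"
    "x [^]\<^bsub>SL3\<^esub> (1 :: int) = x" "x [^]\<^bsub>SL3\<^esub> (- 1 :: int) = inv3 x"
proof -
  interpret group SL3 by (rule group_SL3)
  show "x [^]\<^bsub>SL3\<^esub> (0 :: int) = mat 1" by (simp add: SL3_def)
  show "x [^]\<^bsub>SL3\<^esub> (k :: int) \<in> carrier SL3" using assms by simp
  show "x [^]\<^bsub>SL3\<^esub> (j + k) = x [^]\<^bsub>SL3\<^esub> (j :: int) ** x [^]\<^bsub>SL3\<^esub> k"
    using int_pow_mult[OF assms, of j k] by (simp add: SL3_def)
  show "inv3 (x [^]\<^bsub>SL3\<^esub> k) = x [^]\<^bsub>SL3\<^esub> (- k)"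
    using assms by (simp add: int_pow_neg)
  show "x [^]\<^bsub>SL3\<^esub> (1 :: int) = x" using assms by simp
  then show "x [^]\<^bsub>SL3\<^esub> (- 1 :: int) = inv3 x" using assms by (simp add: int_pow_neg)
qed

lemma SL3_mult_closed:
  assumes "x \<in> carrier SL3" "y \<in> carrier SL3"
  shows "x ** y \<in> carrier SL3"
  using assms by (simp add: SL3_iff det_mul)

lemma SL3_inv_inv: "x \<in> carrier SL3 \<Longrightarrow> inv3 (inv3 x) = x"
  by (rule group.inv_inv[OF group_SL3])

lemma SL3_cancel:
  assumes "x \<in> carrier SL3"
  shows "A ** x ** inv3 x = A" "A ** inv3 x ** x = A"
  using SL3_inv[OF assms] by (simp_all add: matrix_mul_assoc[symmetric])

lemma SL3_inv_mult:
  assumes "x \<in> carrier SL3" "y \<in> carrier SL3"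
  shows "inv3 (x ** y) = inv3 y ** inv3 x"
  by (rule SL3_inv_unique[OF SL3_mult_closed[OF assms]])
    (simp add: matrix_mul_assoc SL3_cancel assms SL3_inv)

text \<open>Induction in both directions from k = 0: a factor x or x^-1 is absorbed by
  Cayley-Hamilton for x or x^-1.\<close>

lemma power_ch:
  assumes "x \<in> carrier SL3"
  shows "x [^]\<^bsub>SL3\<^esub> (k :: int) = ch_alpha x k \<cdot> x + ch_beta x k \<cdot> mat 1 + ch_gamma x k \<cdot> inv3 x"
proof (induction k rule: int_induct[where k = 0])
  case base
  then show ?case using SL3_pow[OF assms] by (simp add: ch_recursion)
next
  case (step1 i)
  have "x [^]\<^bsub>SL3\<^esub> (i + 1) = x [^]\<^bsub>SL3\<^esub> i ** x" using SL3_pow[OF assms] by simp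
  then show ?case
    using trace_inv3(2)[OF assms] SL3_inv[OF assms]
    by (simp add: step1 ch_recursion mat_ring) (simp add: vec_eq_iff algebra_simps)
next
  case (step2 i)
  have "x [^]\<^bsub>SL3\<^esub> (i - 1) = x [^]\<^bsub>SL3\<^esub> i ** inv3 x"
    using SL3_pow(3)[OF assms, of i "- 1"] SL3_pow[OF assms] by simp
  moreover have "inv3 x ** inv3 x = trace (inv3 x) \<cdot> inv3 x - trace x \<cdot> mat 1 + x"
    using trace_inv3(2)[OF SL3_inv(3)[OF assms]] SL3_inv_inv[OF assms] by simp
  moreover have "ch_gamma x i = ch_alpha x (i - 1)"
     "ch_beta x i = ch_gamma x (i - 1) - trace (inv3 x) * ch_alpha x (i - 1)"
     "ch_alpha x i = trace x * ch_alpha x (i - 1) + ch_beta x (i - 1)"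
    using ch_recursion(4-6)[of x "i - 1"] by simp_all
  ultimately show ?case
    using SL3_inv[OF assms]
    by (simp add: step2 mat_ring) (simp add: vec_eq_iff algebra_simps)
qed

section \<open>Commutators and reduction of the defining relation\<close>

definition commutator :: "mat3 \<Rightarrow> mat3 \<Rightarrow> mat3" where
  "commutator A B = A ** B - B ** A"

lemma commutator_simps:
  "commutator A (B + C) = commutator A B + commutator A C"
  "commutator A (B - C) = commutator A B - commutator A C"
  "commutator A (c \<cdot> B) = c \<cdot> commutator A B"
  "commutator (B + C) A = commutator B A + commutator C A"
  "commutator (B - C) A = commutator B A - commutator C A"
  "commutator (c \<cdot> B) A = c \<cdot> commutator B A"
  "commutator A A = 0" "commutator A (mat c) = 0" "commutator (mat c) A = 0" "commutator A 0 = 0"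
  by (simp_all add: commutator_def mat_ring mat_conv_smat[of c] vec_eq_iff algebra_simps)

lemma commutator_eq_0: "commutator A B = 0 \<longleftrightarrow> A ** B = B ** A"
  by (simp add: commutator_def)

text \<open>What remains of [y^-1, y^-1 A y^-1] after the term tr(y) [y^-1, A] is split off.\<close>

definition twisted_commutator :: "mat3 \<Rightarrow> mat3 \<Rightarrow> mat3" where
  "twisted_commutator y A = y ** A ** inv3 y - inv3 y ** A ** y"

lemma commutator_power:
  assumes "z \<in> carrier SL3"
  shows "commutator A (z [^]\<^bsub>SL3\<^esub> (k :: int))
    = ch_alpha z k \<cdot> commutator A z + ch_gamma z k \<cdot> commutator A (inv3 z)"
  by (simp add: power_ch[OF assms] commutator_simps)

lemma twisted_commutator_power:
  assumes "y \<in> carrier SL3" "z \<in> carrier SL3"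
  shows "twisted_commutator y (z [^]\<^bsub>SL3\<^esub> (k :: int))
    = ch_alpha z k \<cdot> twisted_commutator y z + ch_gamma z k \<cdot> twisted_commutator y (inv3 z)"
  using SL3_inv[OF assms(1)]
  by (simp add: power_ch[OF assms(2)] twisted_commutator_def mat_ring) (simp add: vec_eq_iff algebra_simps)

text \<open>Write x b x = (x b)^2 b^-1 and reduce the square of x b by Cayley-Hamilton.\<close>

lemma sandwich:
  assumes "x \<in> carrier SL3" "b \<in> carrier SL3"
  shows "x ** b ** x = trace (x ** b) \<cdot> x - trace (inv3 b ** inv3 x) \<cdot> inv3 b
    + inv3 b ** inv3 x ** inv3 b"
proof -
  have "x ** b ** x = x ** b ** (x ** b) ** inv3 b"
    by (simp add: matrix_mul_assoc SL3_cancel assms)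
  also have "\<dots> = trace (x ** b) \<cdot> x - trace (inv3 b ** inv3 x) \<cdot> inv3 b
    + inv3 b ** inv3 x ** inv3 b"
    unfolding trace_inv3(2)[OF SL3_mult_closed[OF assms]]
    by (simp add: mat_ring SL3_cancel SL3_inv_mult assms)
  finally show ?thesis .
qed

text \<open>The coefficient vector is left arbitrary, so that the linear algebra below is
  independent of the formulas for \<eta>.\<close>

definition relation_defect :: "mat3 \<Rightarrow> mat3 \<Rightarrow> complex ^ 6 \<Rightarrow> mat3" where
  "relation_defect y z e = e$1 \<cdot> commutator y z + e$2 \<cdot> commutator (inv3 y) z
    + e$3 \<cdot> commutator y (inv3 z) + e$4 \<cdot> commutator (inv3 y) (inv3 z)
    + e$5 \<cdot> twisted_commutator y z + e$6 \<cdot> twisted_commutator y (inv3 z)"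

text \<open>\<open>sandwich\<close> is applied three times: to y^-1 z^-m y^-1, to z^(m+1) y^-1
  z^(m+1), and to z^(2m+1) y z^(2m+1). Terms that are multiples of y or y^-1 disappear in the
  commutator with y^-1.\<close>

lemma commutator_sandwich:
  assumes y: "y \<in> carrier SL3" and z: "z \<in> carrier SL3"
  defines "P \<equiv> \<lambda>k :: int. z [^]\<^bsub>SL3\<^esub> k"
  shows "commutator (inv3 y) (P (m + 1) ** inv3 y ** P (- m) ** inv3 y ** P (m + 1))
    = (q_tr y z (- m) * q_tr y z (m + 1)) \<cdot> commutator (inv3 y) (P (m + 1))
    - q_tr y z (- m) \<cdot> commutator y (P (- m - 1))
    - p_tr y z m \<cdot> commutator (inv3 y) (P (3 * m + 2))
    + p_tr y z (2 * m + 1) \<cdot> commutator (inv3 y) (P (2 * m + 1))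
    + p_tr y z 0 \<cdot> commutator (inv3 y) (P (- 2 * m - 1)) + twisted_commutator y (P (- 2 * m - 1))"
proof -
  note y' = SL3_inv(3)[OF y]
  have P: "P k \<in> carrier SL3" "P j ** P k = P (j + k)" "inv3 (P k) = P (- k)"
    "A ** P j ** P k = A ** P (j + k)" for j k and A :: mat3
    unfolding P_def using SL3_pow[OF z] by (simp_all add: matrix_mul_assoc)
  have 1: "inv3 y ** P (- m) ** inv3 y
    = q_tr y z (- m) \<cdot> inv3 y - p_tr y z m \<cdot> P m + P m ** y ** P m"
    using sandwich[OF y' P(1)[of "- m"]] trace_mul_commute[of y "P m"]
    by (simp add: P SL3_inv_inv y) (simp add: p_tr_def q_tr_def P_def)
  have 2: "P (m + 1) ** inv3 y ** P (m + 1)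
    = q_tr y z (m + 1) \<cdot> P (m + 1) - trace (y ** P (- m - 1)) \<cdot> y + y ** P (- m - 1) ** y"
    using sandwich[OF P(1)[of "m + 1"] y'] trace_mul_commute[of "inv3 y" "P (m + 1)"]
    by (simp add: P SL3_inv_inv y) (simp add: q_tr_def P_def)
  have 3: "P (2 * m + 1) ** y ** P (2 * m + 1) = p_tr y z (2 * m + 1) \<cdot> P (2 * m + 1)
      - trace (inv3 y ** P (- 2 * m - 1)) \<cdot> inv3 y + inv3 y ** P (- 2 * m - 1) ** inv3 y"
    using sandwich[OF P(1)[of "2 * m + 1"] y] trace_mul_commute[of y "P (2 * m + 1)"]
    by (simp add: P) (simp add: p_tr_def P_def)
  have "P (m + 1) ** inv3 y ** P (- m) ** inv3 y ** P (m + 1)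
    = P (m + 1) ** (inv3 y ** P (- m) ** inv3 y) ** P (m + 1)"
    by (simp add: matrix_mul_assoc)
  also have "\<dots> = q_tr y z (- m) \<cdot> (P (m + 1) ** inv3 y ** P (m + 1)) - p_tr y z m \<cdot> P (3 * m + 2)
     + P (2 * m + 1) ** y ** P (2 * m + 1)"
    unfolding 1 by (simp add: mat_ring P algebra_simps)
  finally have V: "P (m + 1) ** inv3 y ** P (- m) ** inv3 y ** P (m + 1) = \<dots>" .
  have 4: "commutator (inv3 y) (y ** P (- m - 1) ** y) = - commutator y (P (- m - 1))"
    by (simp add: commutator_def mat_ring SL3_cancel SL3_inv y)
  have yy: "inv3 y ** inv3 y = trace (inv3 y) \<cdot> inv3 y - trace y \<cdot> mat 1 + y"
    using trace_inv3(2)[OF y'] by (simp add: SL3_inv_inv y)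
  have yy': "A ** inv3 y ** inv3 y = trace (inv3 y) \<cdot> (A ** inv3 y) - trace y \<cdot> A + A ** y"
    for A :: mat3
    using arg_cong[OF yy, of "(**) A"] by (simp add: mat_ring)
  \<comment> \<open>Reducing the squares of y^-1 on both sides cancels the terms y^-1 P y^-1; this
    is the source of the twisted commutator.\<close>
  have 5: "commutator (inv3 y) (inv3 y ** P k ** inv3 y)
    = trace y \<cdot> commutator (inv3 y) (P k) + twisted_commutator y (P k)" for k
    unfolding commutator_def twisted_commutator_def matrix_mul_assoc yy yy'
    by (simp add: mat_ring) (simp add: vec_eq_iff algebra_simps)
  have 6: "commutator (inv3 y) y = 0" by (simp add: commutator_eq_0 SL3_inv y)
  have "p_tr y z 0 = trace y" using SL3_pow(1)[of z] z by (simp add: p_tr_def del: int_pow_0)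
  then show ?thesis
    unfolding V 2 3 by (simp add: commutator_simps 4 5 6) (simp add: vec_eq_iff algebra_simps)
qed

lemma relation_iff:
  assumes y: "y \<in> carrier SL3" and z: "z \<in> carrier SL3"
  shows "inv3 y ** z [^]\<^bsub>SL3\<^esub> (m + 1) ** w_mat m y z [^]\<^bsub>SL3\<^esub> (n + 1)
      = z [^]\<^bsub>SL3\<^esub> (m + 1) ** w_mat m y z [^]\<^bsub>SL3\<^esub> (n + 1) ** inv3 y
    \<longleftrightarrow> relation_defect y z (\<eta> m n y z) = 0"
proof -
  define P where "P = (\<lambda>k :: int. z [^]\<^bsub>SL3\<^esub> k)"
  have P: "P k \<in> carrier SL3" "P j ** P k = P (j + k)" "inv3 (P k) = P (- k)"
    "A ** P j ** P k = A ** P (j + k)" "P 0 = mat 1" for j k and A :: mat3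
    unfolding P_def using SL3_pow[OF z] by (simp_all add: matrix_mul_assoc)
  define w where "w = w_mat m y z"
  have w: "w = P (- (m + 1)) ** y ** P m ** y" by (simp add: w_def w_mat_def P_def)
  have wS: "w \<in> carrier SL3" unfolding w by (intro SL3_mult_closed y P)
  have w': "inv3 w = inv3 y ** P (- m) ** inv3 y ** P (m + 1)"
    unfolding w using y P by (simp add: SL3_inv_mult SL3_mult_closed matrix_mul_assoc add.commute)
  \<comment> \<open>V is z^(m+1) w^-1, the part of z^(m+1) w^(n+1) that carries the gamma
    coefficient; the alpha part is z^(m+1) w = y z^m y.\<close>
  define V where "V = P (m + 1) ** inv3 y ** P (- m) ** inv3 y ** P (m + 1)"
  have u: "P (m + 1) ** w [^]\<^bsub>SL3\<^esub> (n + 1) = ch_alpha w (n + 1) \<cdot> (y ** P m ** y)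
     + ch_beta w (n + 1) \<cdot> P (m + 1) + ch_gamma w (n + 1) \<cdot> V"
    unfolding power_ch[OF wS] w' V_def by (simp add: mat_ring) (simp add: w mat_ring P)
  have 1: "commutator (inv3 y) (y ** P m ** y) = - commutator y (P m)"
    by (simp add: commutator_def mat_ring SL3_cancel SL3_inv y)
  have "commutator (inv3 y) (P (m + 1) ** w [^]\<^bsub>SL3\<^esub> (n + 1)) = relation_defect y z (\<eta> m n y z)"
    unfolding u commutator_simps 1 V_def commutator_sandwich[OF y z, of m, folded P_def]
    unfolding P_def commutator_power[OF z] twisted_commutator_power[OF y z]
      relation_defect_def \<eta>_def vector_6
    by (simp add: vec_eq_iff algebra_simps \<eta>\<^sub>1_def \<eta>\<^sub>2_def \<eta>\<^sub>3_def \<eta>\<^sub>4_def \<eta>\<^sub>5_def \<eta>\<^sub>6_def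
        \<sigma>\<^sub>1_def \<sigma>\<^sub>2_def flip: w_def)
  then show ?thesis
    using commutator_eq_0[of "inv3 y" "P (m + 1) ** w [^]\<^bsub>SL3\<^esub> (n + 1)"]
    by (simp add: P_def w_def matrix_mul_assoc)
qed

section \<open>Symmetrization\<close>

text \<open>With C = y z y^-1 z^-1 one has y z - z y = (C - 1) z y, and the characteristic
  polynomial of C at 1 is tr C - tr C^-1 up to sign, since det C = 1.\<close>

lemma det_commutator:
  assumes "y \<in> carrier SL3" "z \<in> carrier SL3"
  shows "det (commutator y z) = trace (y ** z ** inv3 y ** inv3 z) - trace (z ** y ** inv3 z ** inv3 y)"
proof -
  note [simp] = SL3_inv(3) SL3_mult_closed SL3_inv_mult SL3_inv_inv assms
  define C where "C = y ** z ** inv3 y ** inv3 z"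
  have C: "C \<in> carrier SL3" "inv3 C = z ** y ** inv3 z ** inv3 y"
    by (simp_all add: C_def matrix_mul_assoc)
  have "commutator y z = (C - mat 1) ** (z ** y)"
    by (simp add: C_def commutator_def mat_ring SL3_cancel)
  then have "det (commutator y z) = det (C - mat 1)"
    using SL3_mult_closed[OF assms(2,1)] by (simp only: det_mul SL3_iff) simp
  also have "\<dots> = trace C - trace (inv3 C)"
    using C(1) unfolding char_poly_3 trace_inv3(1)[OF C(1)] by (simp add: SL3_iff)
  finally show ?thesis by (simp only: C(2)) (simp only: C_def)
qed

text \<open>P is the Gram matrix of the form. For nonzero P, nondegeneracy comes from irreducibility
  in \<open>selfadjoint_form_det\<close>.\<close>

definition selfadjoint_form :: "mat3 \<Rightarrow> mat3 \<Rightarrow> mat3 \<Rightarrow> bool" where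
  "selfadjoint_form P y z \<longleftrightarrow>
     transpose P = P \<and> transpose (P ** y) = P ** y \<and> transpose (P ** z) = P ** z"

lemma transpose_linear:
  "transpose (A + B) = transpose A + transpose (B :: mat3)"
  "transpose (A - B) = transpose A - transpose (B :: mat3)"
  "transpose (c \<cdot> A) = c \<cdot> transpose A"
  by (simp_all add: vec_eq_iff transpose_def)

text \<open>Forms change by congruence when matrices change by conjugation, so a form may be sought
  in a convenient basis.\<close>

lemma selfadjoint_form_base_change:
  assumes "selfadjoint_form P (R ** y ** S) (R ** z ** S)" "S ** R = mat 1" "R ** S = mat 1" "P \<noteq> 0"
  shows "\<exists>P. P \<noteq> 0 \<and> selfadjoint_form P y z"
proof -
  define P' where "P' = transpose R ** P ** R"
  have SR: "A ** S ** R = A" for A :: mat3 using assms(2) by (simp flip: matrix_mul_assoc)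
  have sym: "transpose (transpose R ** M ** R) = transpose R ** M ** R" if "transpose M = M" for M
    using that by (simp add: matrix_transpose_mul matrix_mul_assoc)
  have "P' ** x = transpose R ** (P ** (R ** x ** S)) ** R" for x
    by (simp add: P'_def matrix_mul_assoc SR)
  then have "selfadjoint_form P' y z"
    using assms(1) sym by (auto simp: selfadjoint_form_def P'_def)
  moreover have "P' \<noteq> 0"
  proof
    assume "P' = 0"
    then have "transpose S ** P' ** S = 0" by (simp add: mat_ring)
    moreover have "transpose S ** P' ** S = transpose (R ** S) ** P ** (R ** S)"
      by (simp add: P'_def matrix_transpose_mul matrix_mul_assoc)
    ultimately show False using assms(3,4) by simp
  qed
  ultimately show ?thesis by blast
qed

definition cols :: "vec3 \<Rightarrow> vec3 \<Rightarrow> vec3 \<Rightarrow> mat3" where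
  "cols u v w = transpose (vector [u, v, w])"

lemma cols_nth [simp]: "cols u v w $ i $ 1 = u $ i" "cols u v w $ i $ 2 = v $ i" "cols u v w $ i $ 3 = w $ i"
  by (simp_all add: cols_def transpose_def)

lemma cols_vec: "cols u v w *v x = x$1 *s u + x$2 *s v + x$3 *s w"
  by (simp add: vec_eq_iff mat3_vec_nth mult.commute)

lemma cols_axis:
  "cols u v w *v axis 1 1 = u" "cols u v w *v axis 2 1 = v" "cols u v w *v axis 3 1 = w"
  by (simp_all add: cols_vec axis_def)

lemma cols_mult: "A ** cols u v w = cols (A *v u) (A *v v) (A *v w)"
  by (simp add: coords)

text \<open>In the basis \<open>v, y v, z v\<close>, the Gram matrix of the form \<open>(g v, h v) \<mapsto> f (g\<^sup>* h v)\<close>, where the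
  star reverses words.\<close>

lemma selfadjoint_form_coords1:
  fixes y z :: mat3
  assumes "y *v axis 1 1 = axis 2 1" "z *v axis 1 1 = axis 3 1" "y *v axis 3 1 = z *v axis 2 1"
    "f v* (y ** z - z ** y) = 0" "f \<noteq> 0"
  shows "\<exists>P. P \<noteq> 0 \<and> selfadjoint_form P y z"
proof -
  define a where "a = f$1 * y$1$2 + f$2 * y$2$2 + f$3 * y$3$2"
  define b where "b = f$1 * y$1$3 + f$2 * y$2$3 + f$3 * y$3$3"
  define c where "c = f$1 * z$1$3 + f$2 * z$2$3 + f$3 * z$3$3"
  \<comment> \<open>The rows of P are f, f y and f z. That f kills the image of the commutator gives
    the remaining symmetries of P y and P z.\<close>
  define P :: mat3 where "P = vector [vector [f$1, f$2, f$3], vector [f$2, a, b], vector [f$3, b, c]]"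
  have y: "y$1$1 = 0" "y$2$1 = 1" "y$3$1 = 0" "z$1$1 = 0" "z$2$1 = 0" "z$3$1 = 1"
    "z$1$2 = y$1$3" "z$2$2 = y$2$3" "z$3$2 = y$3$3"
    using assms(1-3) by (simp_all add: vcoords axis_def)
  have K: "(f v* (y ** z - z ** y)) $ 2 = 0" "(f v* (y ** z - z ** y)) $ 3 = 0"
    using assms(4) by simp_all
  have "P \<noteq> 0" using assms(5) by (auto simp: P_def vec_eq_iff forall_3)
  moreover have "selfadjoint_form P y z"
    using K unfolding selfadjoint_form_def
    by (simp add: vcoords transpose_def P_def y) (simp add: a_def b_def c_def algebra_simps)
  ultimately show ?thesis by blast
qed

text \<open>P is the Hankel matrix of the values f(y^k v), k = 0, ..., 4, with v the first basis
  vector. Hankel matrices make y self-adjoint in a Krylov basis; and the first column of P is f, so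
  P times the rank one part of z is \<open>outer f f\<close>.\<close>

lemma selfadjoint_form_coords2:
  fixes y z :: mat3
  assumes "y *v axis 1 1 = axis 2 1" "y *v axis 2 1 = axis 3 1"
    "z = mat d + e \<cdot> y + outer (axis 1 1) f" "f \<noteq> 0"
  shows "\<exists>P. P \<noteq> 0 \<and> selfadjoint_form P y z"
proof -
  define a where "a = f$1 * y$1$3 + f$2 * y$2$3 + f$3 * y$3$3"
  define b where "b = f$2 * y$1$3 + f$3 * y$2$3 + a * y$3$3"
  define P :: mat3 where "P = vector [vector [f$1, f$2, f$3], vector [f$2, f$3, a], vector [f$3, a, b]]"
  have y: "y$1$1 = 0" "y$2$1 = 1" "y$3$1 = 0" "y$1$2 = 0" "y$2$2 = 0" "y$3$2 = 1"
    using assms(1-2) by (simp_all add: vcoords axis_def)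
  have "P \<noteq> 0" using assms(4) by (auto simp: P_def vec_eq_iff forall_3)
  moreover have "selfadjoint_form P y z"
    unfolding selfadjoint_form_def assms(3)
    by (simp add: vcoords transpose_def P_def y axis_def) (simp add: a_def b_def algebra_simps)
  ultimately show ?thesis by blast
qed

text \<open>The span of a, y a, y^2 a is y-invariant by Cayley-Hamilton, and z-invariant because z x
  is a combination of x, y x and a. Irreducibility makes it the whole space.\<close>

lemma irr_krylov:
  assumes "irr y z" "z = mat d + e \<cdot> y + outer a f"
  shows "invertible (cols a (y *v a) (y *v (y *v a)))" "a \<noteq> 0" "f \<noteq> 0"
proof -
  have "outer a f \<noteq> 0"
  proof
    assume 0: "outer a f = 0"
    \<comment> \<open>Without the rank one part, z would be affine in y and share its
      eigenvectors.\<close>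
    obtain c x where x: "x \<noteq> 0" "y *v x = c *s x" using eigenvector_exists by blast
    have "z *v x = (d + e * c) *s x"
      using x(2) unfolding assms(2) 0
      by (simp add: matrix_vector_mult_add_rdistrib smat_vec vector_sadd_rdistrib)
    with assms(1) x show False by (rule irr_no_eigenvector)
  qed
  then show a: "a \<noteq> 0" and "f \<noteq> 0" by (simp_all add: outer_eq_0)
  define S where "S = cols a (y *v a) (y *v (y *v a))"
  \<comment> \<open>The companion matrix of the characteristic polynomial of y.\<close>
  define T :: mat3 where "T = cols (axis 2 1) (axis 3 1) (vector [det y,
    - (((trace y)\<^sup>2 - trace (y ** y)) / 2), trace y])"
  have "y *v (y *v (y *v a)) = (y ** y ** y) *v a" by (simp add: matrix_vector_mul_assoc matrix_mul_assoc)
  also have "\<dots> = trace y *s (y *v (y *v a)) - (((trace y)\<^sup>2 - trace (y ** y)) / 2) *s (y *v a) + det y *s a"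
    unfolding cayley_hamilton
    by (simp add: matrix_vector_mult_add_rdistrib matrix_vector_mult_diff_rdistrib smat_vec matrix_vector_mul_assoc)
  finally have cube: "y *v (y *v (y *v a)) = \<dots>" .
  have "y ** S = S ** T"
    unfolding S_def T_def cols_mult cols_axis cube by (simp add: cols_vec algebra_simps)
  then have yS: "y *v (S *v x) = S *v (T *v x)" for x
    by (simp add: matrix_vector_mul_assoc)
  have zS: "z *v (S *v x) = S *v (d *s x + e *s (T *v x) + dot f (S *v x) *s axis 1 1)" for x
    unfolding assms(2) by (simp add: matrix_vector_mult_add_rdistrib matrix_vector_right_distrib smat_vec outer_vec yS)
      (simp add: S_def cols_axis)
  have "vec.subspace (range ((*v) S))"
    unfolding vec.subspace_def
    by (auto simp: image_iff simp flip: matrix_vector_right_distrib smat_vec(2) intro: exI[of _ 0])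
  moreover have "\<forall>v\<in>range ((*v) S). y *v v \<in> range ((*v) S) \<and> z *v v \<in> range ((*v) S)"
    using yS zS by auto
  ultimately have "range ((*v) S) = {0} \<or> range ((*v) S) = UNIV"
    using assms(1) unfolding irr_def by blast
  moreover have "a \<in> range ((*v) S)" using cols_axis(1)[of a] unfolding S_def by (rule range_eqI[OF HOL.sym])
  ultimately have "surj ((*v) S)" using a by blast
  then show "invertible (cols a (y *v a) (y *v (y *v a)))"
    using matrix_right_invertible_surjective[of S] by (auto simp: invertible_right_inverse S_def)
qed

lemma selfadjoint_form_rank_one:
  assumes "irr y z" "z = mat d + e \<cdot> y + outer a f"
  shows "\<exists>P. P \<noteq> 0 \<and> selfadjoint_form P y z"
proof -
  define S where "S = cols a (y *v a) (y *v (y *v a))"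
  obtain R where R: "S ** R = mat 1" "R ** S = mat 1"
    using irr_krylov(1)[OF assms] unfolding S_def invertible_def by blast
  have RS: "R *v (S *v x) = x" for x using R(2) by (simp add: matrix_vector_mul_assoc)
  have "(R ** y ** S) *v axis 1 1 = axis 2 1" "(R ** y ** S) *v axis 2 1 = axis 3 1" "R *v a = axis 1 1"
    using RS[of "axis 1 1"] RS[of "axis 2 1"] RS[of "axis 3 1"]
    by (simp_all add: S_def cols_axis flip: matrix_vector_mul_assoc)
  moreover have "R ** z ** S = mat d + e \<cdot> (R ** y ** S) + outer (R *v a) (f v* S)"
    unfolding assms(2) using R by (simp add: mat_ring outer_mul mat_conv_smat[of d])
  moreover have "f v* S \<noteq> 0"
  proof
    assume "f v* S = 0"
    then have "f v* (S ** R) = 0" by (simp flip: vector_matrix_mul_assoc)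
    then show False using R irr_krylov(3)[OF assms] by simp
  qed
  ultimately have "\<exists>P. P \<noteq> 0 \<and> selfadjoint_form P (R ** y ** S) (R ** z ** S)"
    by (intro selfadjoint_form_coords2) simp_all
  then show ?thesis using selfadjoint_form_base_change R by blast
qed

text \<open>Let v be a kernel vector of the commutator. If v, y v, z v form a basis,
  \<open>selfadjoint_form_coords1\<close> applies; if they are dependent, one matrix is an affine
  function of the other plus a rank one matrix.\<close>

lemma selfadjoint_form_exists:
  assumes "irr y z" "det (commutator y z) = 0"
  shows "\<exists>P. P \<noteq> 0 \<and> selfadjoint_form P y z"
proof -
  obtain v where v: "v \<noteq> 0" "commutator y z *v v = 0" using det_0_kernel[OF assms(2)] by blast
  have yz: "y *v (z *v v) = z *v (y *v v)"
    using v(2) by (simp add: commutator_def matrix_vector_mult_diff_rdistrib matrix_vector_mul_assoc)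
  \<comment> \<open>The difference z' - d - e y' kills v, and also y' v since y' and z' commute on
    v. These vectors are independent, as v is not a common eigenvector, so the difference has rank
    at most one.\<close>
  have dep: "\<exists>a f. z' = mat d + e \<cdot> y' + outer a f"
    if "z' *v v = d *s v + e *s (y' *v v)" "y' *v (z' *v v) = z' *v (y' *v v)" "irr y' z'" for y' z' d e
  proof -
    define M where "M = z' - mat d - e \<cdot> y'"
    have "M *v v = 0" using that(1)
      by (simp add: M_def matrix_vector_mult_diff_rdistrib smat_vec)
    moreover have "M *v (y' *v v) = 0" using that(1) that(2)[symmetric]
      by (simp add: M_def matrix_vector_mult_diff_rdistrib smat_vec matrix_vector_right_distrib)
    moreover have "cross v (y' *v v) \<noteq> 0"
    proof
      assume "cross v (y' *v v) = 0"
      then obtain c where c: "y' *v v = c *s v" using cross_eq_0D v(1) by blast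
      then have "z' *v v = (d + e * c) *s v" using that(1) by (simp add: vector_sadd_rdistrib)
      with irr_no_eigenvector[OF that(3) v(1) c] show False by blast
    qed
    ultimately have "\<exists>c. M $ i = c *s cross v (y' *v v)" for i
      by (intro orthogonal_to_both) (simp_all add: vec_eq_iff mat3_vec_nth dot_def)
    then obtain c where "\<And>i. M $ i = c i *s cross v (y' *v v)" by metis
    then have "M = outer (\<chi> i. c i) (cross v (y' *v v))" by (simp add: vec_eq_iff)
    then have "z' = mat d + e \<cdot> y' + outer (\<chi> i. c i) (cross v (y' *v v))"
      unfolding M_def by (simp add: algebra_simps)
    then show ?thesis by blast
  qed
  define S where "S = cols v (y *v v) (z *v v)"
  show ?thesis
  proof (cases "det S = 0")
    case True
    then obtain x :: vec3 where x: "x \<noteq> 0" "x$1 *s v + x$2 *s (y *v v) + x$3 *s (z *v v) = 0"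
      using det_0_kernel[of S] by (auto simp: S_def cols_vec)
    show ?thesis
    proof (cases "x$3 = 0")
      case False
      have "z *v v = (1 / x$3) *s (x$3 *s (z *v v))" using False by simp
      also have "x$3 *s (z *v v) = - (x$1 *s v + x$2 *s (y *v v))"
        using x(2) by (simp only: add_eq_0_iff)
      finally have "z *v v = (- x$1 / x$3) *s v + (- x$2 / x$3) *s (y *v v)"
        by (simp add: vec_eq_iff field_simps)
      from dep[OF this yz assms(1)] show ?thesis using selfadjoint_form_rank_one[OF assms(1)] by blast
    \<comment> \<open>Here v is an eigenvector of y, and \<open>dep\<close> is used with y and z
      exchanged and slope zero.\<close>
    next
      case x3: True
      have x2: "x$2 \<noteq> 0"
      proof
        assume "x$2 = 0"
        with x x3 v(1) show False by (simp add: vec_eq_iff forall_3) 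
      qed
      have "y *v v = (1 / x$2) *s (x$2 *s (y *v v))" using x2 by simp
      also have "x$2 *s (y *v v) = - (x$1 *s v)"
        using x(2) x3 by (simp add: add_eq_0_iff)
      finally have "y *v v = (- x$1 / x$2) *s v + 0 *s (z *v v)"
        by (simp add: vec_eq_iff field_simps)
      from dep[OF this yz[symmetric]] assms(1)
      have "\<exists>P. P \<noteq> 0 \<and> selfadjoint_form P z y"
        using selfadjoint_form_rank_one irr_commute by blast
      then show ?thesis unfolding selfadjoint_form_def by blast
    qed
  next
    case False
    then obtain R where R: "S ** R = mat 1" "R ** S = mat 1"
      unfolding invertible_det_nz[symmetric] invertible_def by blast
    have RS: "R *v (S *v x) = x" for x using R(2) by (simp add: matrix_vector_mul_assoc)
    \<comment> \<open>The left kernel vector f plays the role of the functional defining the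
      form.\<close>
    have "det (transpose (commutator y z)) = 0" using assms(2) by simp
    then obtain f where f: "f \<noteq> 0" "f v* commutator y z = 0"
      using det_0_kernel by (metis transpose_matrix_vector)
    have SRS: "A ** S ** R = A" for A :: mat3 using R(1) by (simp flip: matrix_mul_assoc)
    have "\<exists>P. P \<noteq> 0 \<and> selfadjoint_form P (R ** y ** S) (R ** z ** S)"
    proof (rule selfadjoint_form_coords1)
      show "(R ** y ** S) *v axis 1 1 = axis 2 1" "(R ** z ** S) *v axis 1 1 = axis 3 1"
        "(R ** y ** S) *v axis 3 1 = (R ** z ** S) *v axis 2 1"
        using RS[of "axis 2 1"] RS[of "axis 3 1"] yz
        by (simp_all add: S_def cols_axis flip: matrix_vector_mul_assoc)
      have "R ** y ** S ** (R ** z ** S) - R ** z ** S ** (R ** y ** S) = R ** commutator y z ** S"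
        by (simp add: commutator_def mat_ring SRS)
      then have "f v* S v* (R ** y ** S ** (R ** z ** S) - R ** z ** S ** (R ** y ** S))
          = f v* (S ** R ** commutator y z ** S)"
        by (simp add: vector_matrix_mul_assoc matrix_mul_assoc)
      also have "\<dots> = f v* commutator y z v* S" using R by (simp add: vector_matrix_mul_assoc)
      finally show "f v* S v* (R ** y ** S ** (R ** z ** S) - R ** z ** S ** (R ** y ** S)) = 0"
        using f by simp
      show "f v* S \<noteq> 0"
      proof
        assume "f v* S = 0"
        then have "f v* (S ** R) = 0" by (simp flip: vector_matrix_mul_assoc)
        then show False using R f by simp
      qed
    qed
    then show ?thesis using selfadjoint_form_base_change R by blast
  qed
qed

section \<open>Orthonormal bases for complex symmetric forms\<close>

lemma symmetric_form_anisotropic: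
  assumes "transpose P = (P :: mat3)" "P \<noteq> 0"
  shows "\<exists>u. dot u (P *v u) \<noteq> 0"
proof (rule ccontr)
  assume "\<nexists>u. dot u (P *v u) \<noteq> 0"
  then have 0: "dot u (P *v u) = 0" for u by blast
  have P: "P$2$1 = P$1$2" "P$3$1 = P$1$3" "P$3$2 = P$2$3"
    using assms(1) by (simp_all add: vec_eq_iff transpose_def)
  have "P$1$1 = 0" "P$2$2 = 0" "P$3$3 = 0"
    using 0[of "axis 1 1"] 0[of "axis 2 1"] 0[of "axis 3 1"] by (simp_all add: vcoords axis_def)
  \<comment> \<open>Polarization: sums of axes detect the off-diagonal entries.\<close>
  moreover from this have "P$1$2 = 0" "P$1$3 = 0" "P$2$3 = 0"
    using 0[of "axis 1 1 + axis 2 1"] 0[of "axis 1 1 + axis 3 1"] 0[of "axis 2 1 + axis 3 1"]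
    by (simp_all add: vcoords axis_def P)
  ultimately show False using assms(2) P by (simp add: vec_eq_iff forall_3)
qed

lemma unit_vector:
  assumes "dot u (P *v u) \<noteq> 0"
  shows "\<exists>c. dot (c *s u) (P *v (c *s u)) = 1"
proof
  have "csqrt (dot u (P *v u)) * csqrt (dot u (P *v u)) = dot u (P *v u)"
    by (metis power2_csqrt power2_eq_square)
  then show "dot ((1 / csqrt (dot u (P *v u))) *s u) (P *v ((1 / csqrt (dot u (P *v u))) *s u)) = 1"
    using assms by (simp add: smat_vec dot_simps field_simps)
qed

text \<open>Gram-Schmidt over C, choosing anisotropic vectors at each stage. If S has P-orthonormal
  columns u, v, w, then Q = S^T P works.\<close>

lemma symmetric_factorization:
  assumes P: "transpose P = (P :: mat3)" and "det P \<noteq> 0"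
  shows "\<exists>Q :: mat3. transpose Q ** Q = P"
proof -
  have sym: "dot x (P *v y) = dot y (P *v x)" for x y
    using P by (metis dot_commute dot_mult transpose_matrix_vector)
  have Psym: "P$2$1 = P$1$2" "P$3$1 = P$1$3" "P$3$2 = P$2$3"
    using P by (simp_all add: vec_eq_iff transpose_def)
  have "P \<noteq> 0" using assms(2) by (auto simp: det_3)
  then obtain u where u: "dot u (P *v u) = 1"
    using symmetric_form_anisotropic[OF P] unit_vector by blast
  \<comment> \<open>The form with the u-component projected out. It is nonzero because P has rank
    greater than one.\<close>
  define P' where "P' = P - outer (P *v u) (P *v u)"
  have "P' \<noteq> 0"
  proof
    assume "P' = 0"
    then have "P = outer (P *v u) (P *v u)" by (simp add: P'_def)
    moreover have "det (outer a a) = 0" for a by (simp add: det_3)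
    ultimately show False using assms(2) by metis
  qed
  moreover have "transpose P' = P'"
    using P by (simp add: P'_def vec_eq_iff transpose_def mult.commute)
  ultimately obtain e where e: "dot e (P' *v e) \<noteq> 0" using symmetric_form_anisotropic by blast
  define x where "x = e - dot e (P *v u) *s u"
  have xu: "dot x (P *v u) = 0" by (simp add: x_def dot_simps u)
  have "dot x (P *v x) = dot e (P' *v e)"
    using u sym[of u e]
    by (simp add: x_def P'_def dot_simps matrix_vector_mult_diff_distrib matrix_vector_mult_diff_rdistrib
        smat_vec outer_vec dot_commute[of "P *v u" e])
  with e obtain c where c: "dot (c *s x) (P *v (c *s x)) = 1" using unit_vector by metis
  define v where "v = c *s x"
  have v: "dot v (P *v v) = 1" "dot v (P *v u) = 0" "dot u (P *v v) = 0"
    using c xu sym[of u v] by (simp_all add: v_def dot_simps)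
  \<comment> \<open>This vector is P-orthogonal to u and v. The cofactor identity P t = det(P) (u x
    v) and the Gram determinant of u, v show that its P-square is det P, hence nonzero.\<close>
  define t where "t = cross (P *v u) (P *v v)"
  have t: "dot t (P *v u) = 0" "dot t (P *v v) = 0"
    by (simp_all add: t_def vcoords algebra_simps)
  have "P *v t = det P *s cross u v"
    unfolding t_def by (simp add: vcoords det_3 Psym) algebra
  moreover have "dot t (cross u v) = dot u (P *v u) * dot v (P *v v) - dot u (P *v v) * dot v (P *v u)"
    unfolding t_def by (simp add: dot_def cross_nth algebra_simps)
  ultimately have "dot t (P *v t) \<noteq> 0" using assms(2) u v by (simp add: dot_simps)
  from unit_vector[OF this] obtain d where d: "dot (d *s t) (P *v (d *s t)) = 1" by blast
  define w where "w = d *s t"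
  have w: "dot w (P *v w) = 1" "dot w (P *v u) = 0" "dot w (P *v v) = 0"
    "dot u (P *v w) = 0" "dot v (P *v w) = 0"
    using d t sym[of w u] sym[of w v] by (simp_all add: w_def dot_simps)
  define S where "S = cols u v w"
  have "(transpose S ** P ** S) $ i $ j = dot (transpose S $ i) (P *v transpose S $ j)" for i j
    by (simp add: mat3_mul_nth dot_def mat3_vec_nth transpose_def algebra_simps)
  moreover have "transpose S $ 1 = u" "transpose S $ 2 = v" "transpose S $ 3 = w"
    by (simp_all add: S_def transpose_def vec_eq_iff)
  ultimately have "(transpose S ** P ** S) $ i $ j = (mat 1 :: mat3) $ i $ j" for i j
    using exhaust_3[of i] exhaust_3[of j] u v w by (elim disjE) (simp_all add: mat3_nth)
  then have "transpose S ** P ** S = mat 1" by (rule mat_eqI)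
  \<comment> \<open>The left inverse S^T P of S is also a right inverse, whence Q^T Q = P S S^T P =
    P.\<close>
  then have SP: "S ** (transpose S ** P) = mat 1" using matrix_left_right_inverse by blast
  have "transpose (transpose S ** P) ** (transpose S ** P) = P ** (S ** (transpose S ** P))"
    by (simp add: matrix_transpose_mul P matrix_mul_assoc)
  then have "transpose (transpose S ** P) ** (transpose S ** P) = P" by (simp add: SP)
  then show ?thesis by blast
qed

text \<open>Self-adjointness reads P g = g^T P, so the kernel of P is invariant under y and z; as P
  is nonzero, the kernel is trivial.\<close>

lemma selfadjoint_form_det:
  assumes "irr y z" "selfadjoint_form P y z" "P \<noteq> 0"
  shows "det P \<noteq> 0"
proof
  assume "det P = 0"
  then obtain x where x: "x \<noteq> 0" "P *v x = 0" using det_0_kernel by blast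
  have inv: "P *v (g *v v) = 0" if "transpose (P ** g) = P ** g" "P *v v = 0" for g v
  proof -
    have "P ** g = transpose g ** P"
      using that(1) assms(2) by (simp add: selfadjoint_form_def matrix_transpose_mul)
    then show ?thesis using that(2) by (metis matrix_vector_mul_assoc matrix_vector_mult_0_right)
  qed
  have "vec.subspace {v. P *v v = 0}"
    by (auto simp: vec.subspace_def matrix_vector_right_distrib smat_vec)
  moreover have "\<forall>v\<in>{v. P *v v = 0}. y *v v \<in> {v. P *v v = 0} \<and> z *v v \<in> {v. P *v v = 0}"
    using inv assms(2) by (auto simp: selfadjoint_form_def)
  ultimately have "{v. P *v v = 0} = {0} \<or> {v. P *v v = 0} = UNIV"
    using assms(1) unfolding irr_def by blast
  then have "P *v v = 0" for v using x by blast
  then show False using assms(3) matrix_eq[of P 0] by simp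
qed

section \<open>Symmetric pairs and commutator traces\<close>

lemma transpose_inv3:
  assumes "y \<in> carrier SL3"
  shows "transpose (inv3 y) = inv3 (transpose y)"
proof -
  have "transpose y ** transpose (inv3 y) = mat 1"
    using SL3_inv(2)[OF assms] by (simp flip: matrix_transpose_mul)
  then show ?thesis
    using SL3_inv_unique[of "transpose y" "transpose (inv3 y)"] assms by (simp add: SL3_iff)
qed

lemma conj_SL3:
  fixes Q R :: mat3
  assumes "Q ** R = mat 1" "y \<in> carrier SL3"
  shows "Q ** y ** R \<in> carrier SL3" "inv3 (Q ** y ** R) = Q ** inv3 y ** R"
proof -
  have "det Q * det R = 1" using assms(1) by (metis det_I det_mul)
  then show S: "Q ** y ** R \<in> carrier SL3"
    using assms(2) by (simp add: SL3_iff det_mul mult.commute)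
  have "R ** Q = mat 1" using assms(1) matrix_left_right_inverse by blast
  then have "A ** R ** Q = A" for A :: mat3 by (simp flip: matrix_mul_assoc)
  then have "Q ** y ** R ** (Q ** inv3 y ** R) = mat 1"
    using assms by (simp add: matrix_mul_assoc SL3_cancel)
  from SL3_inv_unique[OF S this] show "inv3 (Q ** y ** R) = Q ** inv3 y ** R" .
qed

lemma tr_word_simps:
  "tr_word [a] = trace a" "tr_word [a, b] = trace (a ** b)" "tr_word [a, b, c] = trace (a ** b ** c)"
  "tr_word [a, b, c, d] = trace (a ** b ** c ** d)"
  "tr_word [a, b, c, d, e] = trace (a ** b ** c ** d ** e)"
  by (simp_all add: tr_word_def matrix_mul_assoc)

lemma trace_conj:
  fixes R Q :: mat3
  assumes "R ** Q = mat 1"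
  shows "trace (Q ** A ** R) = trace (A :: mat3)"
  using trace_mul_commute[of "Q ** A" R] assms by (simp add: matrix_mul_assoc)

lemma matrix_inv_inverse:
  assumes "invertible (Q :: mat3)"
  shows "Q ** matrix_inv Q = mat 1" "matrix_inv Q ** Q = mat 1"
  using someI_ex[OF assms[unfolded invertible_def]] unfolding matrix_inv_def by auto

text \<open>Transposition preserves traces and reverses words in symmetric matrices, which exchanges
  the two commutator words up to cyclic rotation.\<close>

lemma trace_symmetric_if_symmetrizable:
  assumes "y \<in> carrier SL3" "z \<in> carrier SL3" "simultaneously_symmetrizable y z"
  shows "trace_symmetric y z"
proof -
  obtain Q :: mat3 where Q: "invertible Q" "transpose (Q ** y ** matrix_inv Q) = Q ** y ** matrix_inv Q"
     "transpose (Q ** z ** matrix_inv Q) = Q ** z ** matrix_inv Q"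
    using assms(3) unfolding simultaneously_symmetrizable_def by blast
  define R where "R = matrix_inv Q"
  have QR: "Q ** R = mat 1" "R ** Q = mat 1"
    using Q(1) by (simp_all add: R_def matrix_inv_inverse)
  have RQ: "A ** R ** Q = A" for A :: mat3 using QR by (simp flip: matrix_mul_assoc)
  define Y Z where "Y = Q ** y ** R" and "Z = Q ** z ** R"
  have S: "Y \<in> carrier SL3" "Z \<in> carrier SL3" "inv3 Y = Q ** inv3 y ** R" "inv3 Z = Q ** inv3 z ** R"
    using conj_SL3[OF QR(1)] assms by (simp_all add: Y_def Z_def)
  have T: "transpose Y = Y" "transpose Z = Z" using Q by (simp_all add: Y_def Z_def R_def)
  have T': "transpose (inv3 Y) = inv3 Y" "transpose (inv3 Z) = inv3 Z"
    using transpose_inv3[OF S(1)] transpose_inv3[OF S(2)] T by simp_all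
  have "trace (Y ** Z ** inv3 Y ** inv3 Z) = trace (transpose (Y ** Z ** inv3 Y ** inv3 Z))"
    by (simp add: trace_transpose3)
  also have "\<dots> = trace (inv3 Z ** inv3 Y ** (Z ** Y))"
    by (simp add: matrix_transpose_mul T T' matrix_mul_assoc)
  also have "\<dots> = trace (Z ** Y ** (inv3 Z ** inv3 Y))" by (rule trace_mul_commute)
  finally have "trace (Y ** Z ** inv3 Y ** inv3 Z) = trace (Z ** Y ** inv3 Z ** inv3 Y)"
    by (simp add: matrix_mul_assoc)
  moreover have "Y ** Z ** inv3 Y ** inv3 Z = Q ** (y ** z ** inv3 y ** inv3 z) ** R"
    "Z ** Y ** inv3 Z ** inv3 Y = Q ** (z ** y ** inv3 z ** inv3 y) ** R"
    unfolding S(3,4) by (simp_all add: Y_def Z_def matrix_mul_assoc RQ)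
  ultimately show ?thesis
    using trace_conj[OF QR(2)] by (simp add: trace_symmetric_def tr_word_simps)
qed

text \<open>Equal commutator traces mean det [y, z] = 0, which yields a nondegenerate form P = Q^T
  Q. Conjugation by Q turns P-self-adjoint matrices into symmetric ones.\<close>

lemma symmetrizable_if_trace_symmetric:
  assumes "y \<in> carrier SL3" "z \<in> carrier SL3" "irr y z" "trace_symmetric y z"
  shows "simultaneously_symmetrizable y z"
proof -
  have "det (commutator y z) = 0"
    using assms(4) unfolding det_commutator[OF assms(1,2)]
    by (simp add: trace_symmetric_def tr_word_simps)
  then obtain P where P: "P \<noteq> 0" "selfadjoint_form P y z"
    using selfadjoint_form_exists[OF assms(3)] by blast
  then have d: "det P \<noteq> 0" using selfadjoint_form_det[OF assms(3)] by blast
  obtain Q :: mat3 where Q: "transpose Q ** Q = P"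
    using symmetric_factorization[OF _ d] P(2) unfolding selfadjoint_form_def by blast
  then have "det Q \<noteq> 0" using d by (auto simp: det_mul)
  then have inv: "invertible Q" by (simp add: invertible_det_nz)
  define R where "R = matrix_inv Q"
  have QR: "Q ** R = mat 1" "R ** Q = mat 1"
    using inv by (simp_all add: R_def matrix_inv_inverse)
  have RQ: "A ** R ** Q = A" for A :: mat3 using QR by (simp flip: matrix_mul_assoc)
  have "transpose (Q ** g ** R) = Q ** g ** R" if "transpose (P ** g) = P ** g" for g
  proof -
    have "transpose (Q ** g ** R) = transpose R ** (transpose g ** (transpose Q ** Q)) ** R"
      using QR by (simp add: matrix_transpose_mul matrix_mul_assoc) (simp add: QR flip: matrix_mul_assoc)
    also have "transpose g ** (transpose Q ** Q) = transpose Q ** Q ** g"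
      using that P(2) unfolding Q by (simp add: selfadjoint_form_def matrix_transpose_mul)
    also have "transpose R ** (transpose Q ** Q ** g) ** R = transpose (Q ** R) ** Q ** g ** R"
      by (simp add: matrix_transpose_mul matrix_mul_assoc)
    finally show ?thesis by (simp add: QR)
  qed
  then show ?thesis
    using inv P(2) unfolding simultaneously_symmetrizable_def selfadjoint_form_def R_def by blast
qed

section \<open>One special matrix\<close>

text \<open>A nontrivial quadratic or linear relation would make A a scalar plus a matrix of rank at
  most one.\<close>

lemma ordinary_independent:
  assumes "ordinary A" "mat c\<^sub>0 + c\<^sub>1 \<cdot> A + c\<^sub>2 \<cdot> (A ** A) = 0"
  shows "c\<^sub>1 = 0" "c\<^sub>2 = 0"
proof -
  have no: "\<nexists>c a f. A = mat c + outer a f" using assms(1) special_iff special_def by blast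
  then show c2: "c\<^sub>2 = 0" using quadratic_outer_shift assms(2) by blast
  have "A = mat (- c\<^sub>0 / c\<^sub>1) + outer 0 0" if "c\<^sub>1 \<noteq> 0"
    using assms(2) that by (simp add: c2 coords field_simps eq_neg_iff_add_eq_0)
  then show "c\<^sub>1 = 0" using no by blast
qed

lemma ordinary_inv_independent:
  assumes "ordinary A" "A \<in> carrier SL3" "s \<cdot> A + t \<cdot> inv3 A = mat c"
  shows "s = 0" "t = 0"
proof -
  have "(s \<cdot> A + t \<cdot> inv3 A) ** A = c \<cdot> A"
    unfolding assms(3) mat_conv_smat[of c] by (simp add: mat_ring)
  then have 0: "mat t + (- c) \<cdot> A + s \<cdot> (A ** A) = 0"
    using SL3_inv[OF assms(2)] by (simp add: mat_ring mat_conv_smat[of t] vec_eq_iff algebra_simps)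
  from ordinary_independent[OF assms(1) 0] show "s = 0" "t = 0"
    using 0 by (simp_all add: coords)
qed

text \<open>A vanishing combination says that s z + t z^-1 commutes with y; it commutes with z too,
  so it is scalar by Schur, and z is ordinary.\<close>

lemma special_y_independent:
  assumes "irr y z" "z \<in> carrier SL3" "ordinary z"
    "s \<cdot> commutator y z + t \<cdot> commutator y (inv3 z) = 0"
  shows "s = 0" "t = 0"
proof -
  have "commutator y (s \<cdot> z + t \<cdot> inv3 z) = 0" using assms(4) by (simp add: commutator_simps)
  then have 1: "(s \<cdot> z + t \<cdot> inv3 z) ** y = y ** (s \<cdot> z + t \<cdot> inv3 z)"
    by (simp add: commutator_eq_0)
  have 2: "(s \<cdot> z + t \<cdot> inv3 z) ** z = z ** (s \<cdot> z + t \<cdot> inv3 z)"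
    using SL3_inv[OF assms(2)] by (simp add: mat_ring)
  from irr_schur[OF assms(1) 1 2] ordinary_inv_independent[OF assms(3,2)]
  show "s = 0" "t = 0" by blast+
qed

text \<open>The combination is expanded as column vectors times row vectors, with the columns in the
  basis a, y a, y^2 a. All three row coefficients must vanish.\<close>

lemma special_z_independent:
  assumes "irr y z" "y \<in> carrier SL3" "z = mat l + outer a f"
    "r \<cdot> commutator y z + s \<cdot> commutator (inv3 y) z + t \<cdot> twisted_commutator y z = 0"
  shows "r = 0" "s = 0" "t = 0"
proof -
  have z: "z = mat l + 0 \<cdot> y + outer a f" using assms(3) by simp
  note k = irr_krylov[OF assms(1) z]
  define S where "S = cols a (y *v a) (y *v (y *v a))"
  define h where "h = s *s f - t *s (f v* y)"
  define g where "g = r *s f + t *s (f v* inv3 y)"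
  note ya = inv3_vec[OF assms(2), of a]
  have tw: "twisted_commutator y z = outer (y *v a) (f v* inv3 y) - outer (inv3 y *v a) (f v* y)"
    using SL3_inv[OF assms(2)]
    by (simp add: twisted_commutator_def assms(3) mat_ring mat_conv_smat[of l] outer_mul)
  have co: "commutator g z = outer (g *v a) f - outer a (f v* g)" for g
    by (simp add: commutator_def assms(3) mat_ring mat_conv_smat[of l] outer_mul)
  \<comment> \<open>The rows are the coefficients of a, y a and y^2 a after y^-1 a is replaced by
    its expression in these.\<close>
  have "S ** vector [trace (inv3 y) *s h - r *s (f v* y) - s *s (f v* inv3 y), g - trace y *s h, h]
    = r \<cdot> commutator y z + s \<cdot> commutator (inv3 y) z + t \<cdot> twisted_commutator y z"
    unfolding tw co ya S_def g_def h_def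
    by (simp add: vec_eq_iff mat3_mul_nth algebra_simps)
  then have "S ** vector [trace (inv3 y) *s h - r *s (f v* y) - s *s (f v* inv3 y), g - trace y *s h, h] = 0"
    using assms(4) by simp
  moreover obtain R where "R ** S = mat 1" using k(1) unfolding invertible_def S_def by blast
  moreover have "R ** (S ** V) = V" for V :: mat3 using \<open>R ** S = mat 1\<close> by (simp add: matrix_mul_assoc)
  ultimately have 0: "(vector [trace (inv3 y) *s h - r *s (f v* y) - s *s (f v* inv3 y), g - trace y *s h, h] :: mat3) = 0"
    by (metis mat_ring(10))
  have h: "h = 0" using arg_cong[OF 0, of "\<lambda>M. M $ 3"] by simp
  have g: "g = 0" using arg_cong[OF 0, of "\<lambda>M. M $ 2"] h by simp
  show t: "t = 0"
  \<comment> \<open>For t nonzero, h = 0 makes f a left eigenvector of y; it is one of z as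
    well.\<close>
  proof (rule ccontr)
    assume "t \<noteq> 0"
    then have "f v* y = (s / t) *s f" using h by (simp add: h_def vec_eq_iff field_simps)
    moreover have "f v* z = (l + dot f a) *s f"
      unfolding assms(3) by (simp add: algebra_simps smat_vec vec_outer)
    ultimately show False using irr_no_left_eigenvector[OF assms(1) k(3)] by blast
  qed
  show "r = 0" "s = 0" using g h k(3) by (simp_all add: g_def h_def t)
qed

text \<open>The trace conditions only test E = y^-1 + l y - c, where c = l^2 + l^-1, against 1, z
  and z^-1. Irreducibility upgrades this to E = 0.\<close>

lemma special_if_traces:
  assumes "irr y z" "y \<in> carrier SL3" "z \<in> carrier SL3" "l \<noteq> 0"
    "trace y = 2 * l + l powi (-2)" "trace (inv3 y) = 2 * l powi (-1) + l\<^sup>2"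
    "trace (inv3 y ** z) = (l\<^sup>2 + l powi (-1)) * trace z - l * trace (y ** z)"
    "trace (inv3 y ** inv3 z) = (l\<^sup>2 + l powi (-1)) * trace (inv3 z) - l * trace (y ** inv3 z)"
  shows "inv3 y = mat (l\<^sup>2 + l powi (-1)) - l \<cdot> y"
proof -
  define E where "E = inv3 y + l \<cdot> y - mat (l\<^sup>2 + l powi (-1))"
  have tE: "trace E = 0" "trace (E ** z) = 0" "trace (E ** inv3 z) = 0"
    unfolding E_def mat_conv_smat[of "l\<^sup>2 + _"]
    using assms(4) by (simp_all add: mat_ring trace_ring assms(5-8) trace3[of "mat 1"] mat3_nth
       power_int_minus power2_eq_square field_simps)
  define M where "M = y - mat l"
  have yy: "y ** y = trace y \<cdot> y - trace (inv3 y) \<cdot> mat 1 + inv3 y" by (rule trace_inv3(2)[OF assms(2)])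
  \<comment> \<open>The two traces of y make its eigenvalues l, l, l^-2, and E = l y^-1 (y - l)(y -
    l^-2), so the factor y - l kills E by Cayley-Hamilton.\<close>
  have ME: "M ** E = 0" and EM: "E ** M = 0"
    unfolding M_def E_def mat_conv_smat[of "l\<^sup>2 + _"] mat_conv_smat[of l]
    using assms(4) SL3_inv[OF assms(2)]
    by (simp_all add: mat_ring yy assms(5,6), simp_all add: vec_eq_iff power_int_minus power2_eq_square field_simps)
  have "E = 0"
  proof (rule ccontr)
    assume E: "E \<noteq> 0"
    from product_zero_outer[OF ME] show False
    proof (elim disjE exE)
      fix a f assume "M = outer a f"
      then have y: "y = mat l + outer a f" by (simp add: M_def algebra_simps)
      have fa: "dot f a = l powi (-2) - l"
        using assms(5) by (simp add: y trace_ring trace_outer eq_diff_eq add.commute)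
      from outer_shift_inverse[OF assms(2) y assms(4) fa] E show False by (simp add: E_def)
    next
      fix k f' assume Ek: "E = outer k f'"
      with E have nz: "k \<noteq> 0" "f' \<noteq> 0" by (auto simp: outer_eq_0)
      have "outer (M *v k) f' = 0" "outer k (f' v* M) = 0"
        using ME EM by (simp_all add: Ek outer_mul)
      with nz have "M *v k = 0" "f' v* M = 0" by (simp_all add: outer_eq_0)
      then have yk: "y *v k = l *s k" and fy: "f' v* y = l *s f'"
        by (simp_all add: M_def matrix_vector_mult_diff_rdistrib vector_matrix_mult_diff_rdistrib smat_vec)
      \<comment> \<open>The three traces of E become values of f' on k, z k, z^-1 k. Then f' also
        kills z^2 k, so f' and f' z are both normal to the plane of k and z k: a common left
        eigenvector.\<close>
      have d: "dot f' k = 0" "dot f' (z *v k) = 0" "dot f' (inv3 z *v k) = 0"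
        using tE by (simp_all add: Ek trace_outer outer_mul dot_mult)
      have c: "cross k (z *v k) \<noteq> 0"
        using cross_eq_0D nz(1) irr_no_eigenvector[OF assms(1) nz(1) yk] by blast
      obtain e where e: "f' = e *s cross k (z *v k)" using orthogonal_to_both[OF d(1,2) c] by blast
      with nz(2) have "e \<noteq> 0" by auto
      have zz: "z ** z = trace z \<cdot> z - trace (inv3 z) \<cdot> mat 1 + inv3 z" by (rule trace_inv3(2)[OF assms(3)])
      have "z *v (z *v k) = trace z *s (z *v k) - trace (inv3 z) *s k + inv3 z *v k"
        unfolding matrix_vector_mul_assoc zz
        by (simp add: matrix_vector_mult_add_rdistrib matrix_vector_mult_diff_rdistrib smat_vec)
      then have zzk: "dot f' (z *v (z *v k)) = 0" by (simp add: dot_simps d)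
      have "dot (f' v* z) k = 0" "dot (f' v* z) (z *v k) = 0"
        using d zzk by (simp_all flip: dot_mult)
      from orthogonal_to_both[OF this c] obtain b where "f' v* z = b *s cross k (z *v k)" by blast
      then have "f' v* z = (b / e) *s f'" using \<open>e \<noteq> 0\<close> by (simp add: e)
      with irr_no_left_eigenvector[OF assms(1) nz(2) fy] show False by blast
    qed
  qed
  then show ?thesis by (simp add: E_def algebra_simps)
qed

lemma special_if_inv:
  assumes "y \<in> carrier SL3" "inv3 y = mat c - l \<cdot> y"
  shows "special y"
proof (rule ccontr)
  assume "\<not> special y"
  then have "ordinary y" by (simp add: special_def)
  moreover have "l \<cdot> y + 1 \<cdot> inv3 y = mat c" by (simp add: assms(2))
  ultimately have "(1 :: complex) = 0" using ordinary_inv_independent(2) assms(1) by blast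
  then show False by simp
qed

section \<open>Two ordinary matrices\<close>

text \<open>For antisymmetric M this is the vector v with \<open>M *v x = cross v x\<close>.\<close>

definition axial :: "mat3 \<Rightarrow> vec3" where
  "axial M = vector [M$3$2, M$1$3, M$2$1]"

lemma axial_nth: "axial M $ 1 = M$3$2" "axial M $ 2 = M$1$3" "axial M $ 3 = M$2$1"
  by (simp_all add: axial_def)

lemma axial_simps: "axial (A + B) = axial A + axial B" "axial (c \<cdot> A) = c *s axial A"
  by (simp_all add: vec_eq_iff forall_3 axial_nth)

lemma dot_minus: "dot x (- y) = - dot x y"
  by (simp add: dot_def)

lemma antisymmetric_nth:
  assumes "transpose M = - (M :: mat3)"
  shows "M$1$1 = 0" "M$2$2 = 0" "M$3$3 = 0" "M$1$2 = - M$2$1" "M$2$3 = - M$3$2" "M$3$1 = - M$1$3"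
proof -
  have "M $ j $ i = - (M $ i $ j)" for i j
    using arg_cong[OF assms, of "\<lambda>X. X $ i $ j"] by (simp add: transpose_def)
  from this[of 1 1] this[of 2 2] this[of 3 3] this[of 2 1] this[of 3 2] this[of 1 3]
  show "M$1$1 = 0" "M$2$2 = 0" "M$3$3 = 0" "M$1$2 = - M$2$1" "M$2$3 = - M$3$2" "M$3$1 = - M$1$3"
    by simp_all
qed

lemma symmetric_nth:
  assumes "transpose M = (M :: mat3)"
  shows "M$2$1 = M$1$2" "M$3$1 = M$1$3" "M$3$2 = M$2$3"
  using arg_cong[OF assms, of "\<lambda>X. X $ 1 $ 2"] arg_cong[OF assms, of "\<lambda>X. X $ 1 $ 3"]
    arg_cong[OF assms, of "\<lambda>X. X $ 2 $ 3"] by (simp_all add: transpose_def)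

lemma axial_eq_0:
  assumes "transpose M = - M" "axial M = 0"
  shows "M = 0"
  using assms(2) by (simp add: vec_eq_iff forall_3 axial_nth antisymmetric_nth[OF assms(1)])

lemma trace_axial:
  assumes "transpose M = - M" "transpose N = - N"
  shows "trace (N ** M) = - 2 * dot (axial N) (axial M)"
  by (simp add: trace3 mat3_mul_nth dot_def axial_nth antisymmetric_nth[OF assms(1)] antisymmetric_nth[OF assms(2)])

lemma axial_triple:
  assumes "transpose M = - M"
  shows "dot (cross a b) (axial M) = - dot a (M *v b)"
  by (simp add: vcoords axial_nth antisymmetric_nth[OF assms] algebra_simps)

lemma axial_rank_one:
  assumes "transpose z = z"
  shows "axial (commutator (outer a a) z) = - cross a (z *v a)"
  by (simp add: vec_eq_iff forall_3 axial_nth commutator_def mat3_mul_nth cross_nth mat3_vec_nth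
      symmetric_nth[OF assms] algebra_simps)

lemma transpose_commutator:
  "transpose p = p \<Longrightarrow> transpose q = q \<Longrightarrow> transpose (commutator p q) = - commutator p q"
  by (simp add: commutator_def transpose_linear matrix_transpose_mul)

text \<open>The kernel of q - \<mu> is z-invariant and contains a, so it is not a line, or a would
  be a common eigenvector. Hence q - \<mu> has rank one, symmetry gives it the form c b b^T, and its
  image line is preserved by whatever commutes with q.\<close>

lemma commuting_rank_one:
  assumes "irr y z" "transpose q = q" "q ** z = z ** q" "\<And>c. q \<noteq> mat c" "a \<noteq> 0"
    "y *v a = \<alpha> *s a" "q *v a = \<mu> *s a"
  shows "\<exists>b c. b \<noteq> 0 \<and> q = mat \<mu> + c \<cdot> outer b b \<and> dot a b = 0 \<and>
    (\<forall>r. r ** q = q ** r \<longrightarrow> (\<exists>\<beta>. r *v b = \<beta> *s b))"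
proof -
  define M where "M = q - mat \<mu>"
  have Ma: "M *v a = 0" by (simp add: M_def matrix_vector_mult_diff_rdistrib smat_vec assms(7))
  from outer_or_kernel_line[of M] show ?thesis
  proof (elim disjE exE)
    fix k assume k: "\<forall>x. M *v x = 0 \<longrightarrow> (\<exists>c. x = c *s k)"
    have "M ** z = z ** M" using assms(3) by (simp add: M_def mat_ring mat_conv_smat[of \<mu>])
    then have "M *v (z *v a) = z *v (M *v a)" by (simp add: matrix_vector_mul_assoc)
    then have "M *v (z *v a) = 0" by (simp add: Ma)
    with k Ma obtain c d where c: "a = c *s k" and d: "z *v a = d *s k" by blast
    with assms(5) have "c \<noteq> 0" by auto
    then have "z *v a = (d / c) *s a" unfolding d by (simp add: c)
    with irr_no_eigenvector[OF assms(1,5,6)] show ?thesis by blast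
  next
    fix b g assume M: "M = outer b g"
    have "M \<noteq> 0" using assms(4)[of \<mu>] by (simp add: M_def)
    then have nz: "b \<noteq> 0" "g \<noteq> 0" by (simp_all add: M outer_eq_0)
    have "transpose M = M" using assms(2) by (simp add: M_def vec_eq_iff transpose_def mat_def)
    then have "outer g b = outer b g"
      unfolding M by (simp add: vec_eq_iff transpose_def mult.commute)
    from outer_eqD[OF this nz(1)] obtain c where c: "g = c *s b" by blast
    have "q = mat \<mu> + M" by (simp add: M_def)
    then have q: "q = mat \<mu> + c \<cdot> outer b b" by (simp add: M c outer_add)
    have "dot g a = 0" using Ma nz(1) by (simp add: M outer_vec)
    then have ab: "dot a b = 0" using nz(2) by (auto simp: c dot_simps dot_commute[of b a])
    have "\<exists>\<beta>. r *v b = \<beta> *s b" if "r ** q = q ** r" for r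
    proof -
      have "outer (r *v b) g = outer b (g v* r)"
        using that by (simp add: \<open>q = mat \<mu> + M\<close> M mat_ring mat_conv_smat[of \<mu>] outer_mul)
      from outer_eqD[OF this nz(2)] show ?thesis .
    qed
    with nz(1) q ab show ?thesis by blast
  qed
qed

lemma binary_quadratic_zero:
  "\<exists>s t :: complex. (s, t) \<noteq> (0, 0) \<and> a * s\<^sup>2 + b * s * t + c * t\<^sup>2 = 0"
proof (cases "a = 0")
  case True
  then show ?thesis by (intro exI[of _ 1] exI[of _ 0]) simp
next
  case False
  then have "\<not> constant (poly [:c, b, a:])" by (simp add: constant_degree)
  then obtain s where "poly [:c, b, a:] s = 0" using fundamental_theorem_of_algebra by blast
  then show ?thesis by (intro exI[of _ s] exI[of _ 1]) (simp add: power2_eq_square algebra_simps)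
qed

text \<open>A bilinear map of planes kills a pure tensor: the determinant of its restriction to
  \<open>(s', t')\<close> is a binary quadratic form. Here the target plane is the orthogonal complement of \<open>v\<close>.\<close>

lemma bilinear_plane_zero:
  assumes "v \<noteq> 0" "dot v w\<^sub>1 = 0" "dot v w\<^sub>2 = 0" "dot v w\<^sub>3 = 0" "dot v w\<^sub>4 = 0"
  shows "\<exists>s t s' t'. (s, t) \<noteq> (0, 0) \<and> (s', t') \<noteq> (0, 0) \<and>
    s *s (s' *s w\<^sub>1 + t' *s w\<^sub>3) + t *s (s' *s w\<^sub>2 + t' *s w\<^sub>4) = 0"
proof -
  \<comment> \<open>The cross product of two vectors orthogonal to v is a multiple of v, so its k-th
    coordinate measures their dependence.\<close>
  obtain k where k: "v $ k \<noteq> 0" using assms(1) by (auto simp: vec_eq_iff)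
  obtain s' t' where st: "(s', t') \<noteq> (0, 0)"
    "cross w\<^sub>1 w\<^sub>2 $ k * s'\<^sup>2 + (cross w\<^sub>1 w\<^sub>4 $ k + cross w\<^sub>3 w\<^sub>2 $ k) * s' * t' + cross w\<^sub>3 w\<^sub>4 $ k * t'\<^sup>2 = 0"
    using binary_quadratic_zero by blast
  define A B where "A = s' *s w\<^sub>1 + t' *s w\<^sub>3" and "B = s' *s w\<^sub>2 + t' *s w\<^sub>4"
  have "cross A B $ k = 0"
    using st(2) exhaust_3[of k]
    by (auto simp: A_def B_def cross_nth power2_eq_square algebra_simps)
  have "dot v A = 0" "dot v B = 0" using assms by (simp_all add: A_def B_def dot_simps)
  moreover have "cross v (cross A B) = dot v B *s A - dot v A *s B"
    by (simp add: vcoords algebra_simps)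
  ultimately have "cross v (cross A B) = 0" by simp
  then obtain c where c: "cross A B = c *s v" using cross_eq_0D assms(1) by blast
  with \<open>cross A B $ k = 0\<close> k have "cross A B = 0" by simp
  have "\<exists>s t. (s, t) \<noteq> (0, 0) \<and> s *s A + t *s B = 0"
  proof (cases "A = 0")
    case True
    then show ?thesis by (intro exI[of _ 1] exI[of _ 0]) simp
  next
    case False
    then obtain c where "B = c *s A" using cross_eq_0D \<open>cross A B = 0\<close> by blast
    then show ?thesis by (intro exI[of _ "- c"] exI[of _ 1]) simp
  qed
  with st(1) show ?thesis unfolding A_def B_def by blast
qed

text \<open>Some nonscalar combinations \<open>p\<close> of \<open>y, y\<^sup>-\<^sup>1\<close> and \<open>q\<close> of \<open>z, z\<^sup>-\<^sup>1\<close> commute. Up to scalars they are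
  \<open>a a\<^sup>T\<close> and \<open>b b\<^sup>T\<close> with \<open>a \<bottom> b\<close>, and the axial vector of \<open>N\<close> lies in \<open>span(a, z a)\<close> and in
  \<open>span(b, y b)\<close>, hence is orthogonal to both \<open>a\<close> and \<open>b\<close>. This makes \<open>b\<close> a common eigenvector.\<close>

lemma commutators_span:
  assumes y: "y \<in> carrier SL3" "transpose y = y" "ordinary y"
    and z: "z \<in> carrier SL3" "transpose z = z" "ordinary z"
    and irr: "irr y z" and N: "transpose N = - N"
    and tr: "trace (N ** commutator y z) = 0" "trace (N ** commutator (inv3 y) z) = 0"
      "trace (N ** commutator y (inv3 z)) = 0" "trace (N ** commutator (inv3 y) (inv3 z)) = 0"
  shows "N = 0"
proof (rule ccontr)
  assume "N \<noteq> 0"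
  define v where "v = axial N"
  have v: "v \<noteq> 0" using axial_eq_0[OF N] \<open>N \<noteq> 0\<close> by (auto simp: v_def)
  have y': "transpose (inv3 y) = inv3 y" and z': "transpose (inv3 z) = inv3 z"
    using transpose_inv3[OF y(1)] transpose_inv3[OF z(1)] y(2) z(2) by simp_all
  note anti = transpose_commutator[OF y(2) z(2)] transpose_commutator[OF y' z(2)]
    transpose_commutator[OF y(2) z'] transpose_commutator[OF y' z']
  have va: "dot v (axial (commutator y z)) = 0" "dot v (axial (commutator (inv3 y) z)) = 0"
    "dot v (axial (commutator y (inv3 z))) = 0" "dot v (axial (commutator (inv3 y) (inv3 z))) = 0"
    using tr by (simp_all add: trace_axial N anti v_def)
  obtain s t s' t' where st: "(s, t) \<noteq> (0, 0)" "(s', t') \<noteq> (0, 0)"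
    "s *s (s' *s axial (commutator y z) + t' *s axial (commutator y (inv3 z)))
      + t *s (s' *s axial (commutator (inv3 y) z) + t' *s axial (commutator (inv3 y) (inv3 z))) = 0"
    using bilinear_plane_zero[OF v va] by blast
  define p where "p = s \<cdot> y + t \<cdot> inv3 y"
  define q where "q = s' \<cdot> z + t' \<cdot> inv3 z"
  have pT: "transpose p = p" and qT: "transpose q = q"
    using y(2) y' z(2) z' by (simp_all add: p_def q_def vec_eq_iff transpose_def)
  have "axial (commutator p q) = 0"
    using st(3) by (simp add: p_def q_def commutator_simps axial_simps algebra_simps)
  with axial_eq_0[OF transpose_commutator[OF pT qT]] have pq: "p ** q = q ** p"
    by (simp add: commutator_eq_0)
  have pn: "p \<noteq> mat c" and qn: "q \<noteq> mat c" for c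
    using st ordinary_inv_independent[OF y(3,1)] ordinary_inv_independent[OF z(3,1)]
    unfolding p_def q_def by blast+
  have py: "p ** y = y ** p" and qz: "q ** z = z ** q"
    using SL3_inv[OF y(1)] SL3_inv[OF z(1)] by (simp_all add: p_def q_def mat_ring)
  \<comment> \<open>A common eigenvector of y and q puts q into rank one form; the resulting b is a
    common eigenvector of z and p, which then puts p into rank one form.\<close>
  obtain a\<^sub>0 where a0: "a\<^sub>0 \<noteq> 0" "\<And>r. p ** r = r ** p \<Longrightarrow> \<exists>\<mu>. r *v a\<^sub>0 = \<mu> *s a\<^sub>0"
    using commutant_eigenvector[OF pn] by blast
  obtain \<alpha> \<mu> where "y *v a\<^sub>0 = \<alpha> *s a\<^sub>0" "q *v a\<^sub>0 = \<mu> *s a\<^sub>0"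
    using a0(2)[OF py] a0(2)[OF pq] by blast
  from commuting_rank_one[OF irr qT qz qn a0(1) this] obtain b c where b: "b \<noteq> 0"
    "q = mat \<mu> + c \<cdot> outer b b" "\<And>r. r ** q = q ** r \<Longrightarrow> \<exists>\<beta>. r *v b = \<beta> *s b"
    by blast
  obtain \<beta> \<nu> where zb: "z *v b = \<beta> *s b" and pb: "p *v b = \<nu> *s b"
    using b(3)[OF qz[symmetric]] b(3)[OF pq] by blast
  have "irr z y" using irr irr_commute by blast
  from commuting_rank_one[OF this pT py pn b(1) zb pb] obtain a d where a: "a \<noteq> 0"
    "p = mat \<nu> + d \<cdot> outer a a" "dot b a = 0" "\<And>r. r ** p = p ** r \<Longrightarrow> \<exists>\<beta>. r *v a = \<beta> *s a"
    by blast
  obtain \<alpha>' where ya: "y *v a = \<alpha>' *s a" using a(4)[OF py[symmetric]] by blast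
  have d0: "d \<noteq> 0" using pn[of \<nu>] a(2) by auto
  have c0: "c \<noteq> 0" using qn[of \<mu>] b(2) by auto
  \<comment> \<open>Since p is a combination of y and y^-1, its commutator with z is orthogonal to
    v; by the rank one form this places v in the plane of a and z a.\<close>
  have "commutator p z = d \<cdot> commutator (outer a a) z" by (simp add: a(2) commutator_simps)
  then have "dot v (axial (commutator p z)) = - d * dot v (cross a (z *v a))"
    by (simp add: axial_simps axial_rank_one[OF z(2)] dot_def algebra_simps)
  moreover have "dot v (axial (commutator p z)) = 0"
    using va by (simp add: p_def commutator_simps axial_simps dot_simps)
  ultimately have va1: "dot v (cross a (z *v a)) = 0" using d0 by simp
  have "commutator q y = c \<cdot> commutator (outer b b) y" by (simp add: b(2) commutator_simps)
  then have "dot v (axial (commutator q y)) = - c * dot v (cross b (y *v b))"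
    by (simp add: axial_simps axial_rank_one[OF y(2)] dot_def algebra_simps)
  moreover have "axial (commutator q y) = - axial (commutator y q)"
    by (simp add: vec_eq_iff forall_3 axial_nth commutator_def)
  moreover have "dot v (axial (commutator y q)) = 0"
    using va by (simp add: q_def commutator_simps axial_simps dot_simps)
  ultimately have va2: "dot v (cross b (y *v b)) = 0" using c0 by (simp add: dot_minus)
  have sa: "dot x (z *v x') = dot (z *v x) x'" "dot x (y *v x') = dot (y *v x) x'" for x x'
    using y(2) z(2) by (metis dot_mult transpose_matrix_vector)+
  have na: "cross a (z *v a) \<noteq> 0"
    using cross_eq_0D[OF _ a(1)] irr_no_eigenvector[OF irr a(1) ya] by blast
  have nb: "cross b (y *v b) \<noteq> 0"
    using cross_eq_0D[OF _ b(1)] irr_no_eigenvector[OF irr b(1) _ zb] by blast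
  have o: "dot b a = 0" "dot b (z *v a) = 0" "dot a b = 0" "dot a (y *v b) = 0"
    using a(3) by (simp_all add: sa zb ya dot_simps dot_commute[of a b])
  obtain x1 x2 where "v = x1 *s a + x2 *s (z *v a)" using coplanarD[OF va1 na] by blast
  then have vb: "dot v b = 0" using o by (simp add: dot_simps dot_commute[of _ b])
  obtain x1 x2 where "v = x1 *s b + x2 *s (y *v b)" using coplanarD[OF va2 nb] by blast
  then have va: "dot v a = 0" using o by (simp add: dot_simps dot_commute[of _ a])
  have "cross a b \<noteq> 0"
  proof
    assume "cross a b = 0"
    then obtain e where "b = e *s a" using cross_eq_0D a(1) by blast
    then have "y *v b = \<alpha>' *s b" by (simp add: smat_vec ya mult.commute)
    with irr_no_eigenvector[OF irr b(1) _ zb] show False by blast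
  qed
  from orthogonal_to_both[OF va vb this] obtain e where e: "v = e *s cross a b" by blast
  with v have "e \<noteq> 0" by auto
  \<comment> \<open>As v is parallel to a x b, testing [y, z] makes y b orthogonal to z a. Both b
    and y b are then normal to the plane of a and z a, hence parallel.\<close>
  have "dot (cross a b) (axial (commutator y z)) = 0"
    using \<open>e \<noteq> 0\<close> \<open>dot v (axial (commutator y z)) = 0\<close> by (simp add: e dot_simps)
  then have "dot a (commutator y z *v b) = 0"
    by (simp add: axial_triple[OF anti(1)])
  moreover have "dot a (commutator y z *v b) = dot a (y *v (z *v b)) - dot a (z *v (y *v b))"
    by (simp add: commutator_def matrix_vector_mult_diff_rdistrib dot_simps matrix_vector_mul_assoc)
  moreover have "dot a (y *v (z *v b)) = 0" by (simp add: zb smat_vec dot_simps o)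
  ultimately have "dot (y *v b) (z *v a) = 0" by (simp add: sa(1)[of a] dot_commute[of "z *v a"])
  moreover have "dot (y *v b) a = 0" using o by (simp add: dot_commute)
  ultimately obtain e1 where e1: "y *v b = e1 *s cross a (z *v a)"
    using orthogonal_to_both na by blast
  obtain e2 where e2: "b = e2 *s cross a (z *v a)" using orthogonal_to_both[OF o(1,2) na] by blast
  with b(1) have "e2 \<noteq> 0" by auto
  then have "y *v b = (e1 / e2) *s b" unfolding e1 by (subst e2) simp
  with irr_no_eigenvector[OF irr b(1) _ zb] show False by blast
qed

lemma UNIV_6: "(UNIV :: 6 set) = {1, 2, 3, 4, 5, 6}"
proof (rule HOL.sym, rule card_subset_eq)
  have "distinct [1, 2, 3, 4, 5, 6 :: 6]" by simp
  then show "card {1, 2, 3, 4, 5, 6 :: 6} = card (UNIV :: 6 set)" by simp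
qed auto

lemma sum_6: "sum f (UNIV :: 6 set) = f 1 + f 2 + f 3 + f 4 + f 5 + f 6"
  unfolding UNIV_6 by (simp add: algebra_simps)

section \<open>Traces against the relation defect\<close>

lemma trace_mult_relation_defect:
  "trace (T ** relation_defect y z e) = e$1 * trace (T ** commutator y z)
    + e$2 * trace (T ** commutator (inv3 y) z) + e$3 * trace (T ** commutator y (inv3 z))
    + e$4 * trace (T ** commutator (inv3 y) (inv3 z)) + e$5 * trace (T ** twisted_commutator y z)
    + e$6 * trace (T ** twisted_commutator y (inv3 z))"
  by (simp add: relation_defect_def mat_ring trace_ring)

lemma trace_rotate:
  "trace (x ** a ** b) = trace (a ** b ** (x :: mat3))"
  "trace (x ** a ** b ** c) = trace (b ** c ** x ** (a :: mat3))"
  "trace (x ** x ** a ** b ** c) = trace (b ** c ** x ** x ** (a :: mat3))"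
  using trace_mul_commute[of x "a ** b"] trace_mul_commute[of "x ** a" "b ** c"]
    trace_mul_commute[of "x ** x ** a" "b ** c"] by (simp_all add: matrix_mul_assoc)

lemma trace_mult_commutator:
  fixes p q p' q' :: mat3
  shows
  "trace (p ** q ** commutator p' q') = trace (p ** q ** p' ** q') - trace (p' ** p ** q ** q')"
  using trace_mul_commute[of "p ** q ** q'" p']
  by (simp add: commutator_def mat_ring trace_ring)

lemma trace_mult_twisted_commutator:
  fixes p q y A :: mat3
  shows
  "trace (p ** q ** twisted_commutator y A)
    = trace (inv3 y ** p ** q ** y ** A) - trace (y ** p ** q ** inv3 y ** A)"
  using trace_mul_commute[of "p ** q ** y ** A" "inv3 y"] trace_mul_commute[of "p ** q ** inv3 y ** A" y]
  by (simp add: twisted_commutator_def mat_ring trace_ring)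

text \<open>Words are matched by cyclic rotation. Trace symmetry identifies the words y z^-1 y^-1 z
  and y z y^-1 z^-1, which are reversals of each other up to rotation.\<close>

lemma A_mat_column:
  assumes y: "y \<in> carrier SL3" and z: "z \<in> carrier SL3" and sym: "trace_symmetric y z"
  shows "(e v* A_mat y z) $ 1 = trace (y ** z ** relation_defect y z e)"
    "(e v* A_mat y z) $ 2 = trace (inv3 y ** z ** relation_defect y z e)"
    "(e v* A_mat y z) $ 3 = trace (y ** inv3 z ** relation_defect y z e)"
    "(e v* A_mat y z) $ 4 = trace (inv3 y ** inv3 z ** relation_defect y z e)"
proof -
  define y' z' where "y' = inv3 y" and "z' = inv3 z"
  have c: "y ** y' = mat 1" "y' ** y = mat 1" "z ** z' = mat 1" "z' ** z = mat 1"
    "A ** y ** y' = A" "A ** y' ** y = A" "A ** z ** z' = A" "A ** z' ** z = A" for A :: mat3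
    using SL3_inv y z SL3_cancel by (simp_all add: y'_def z'_def)
  have r: "trace (y' ** a ** y ** b) = trace (y ** b ** y' ** a)"
    "trace (y' ** y' ** a ** y ** b) = trace (y ** b ** y' ** y' ** a)"
    "trace (z ** y ** b) = trace (y ** b ** z)" "trace (z' ** y ** b) = trace (y ** b ** z')"
    "trace (z ** y' ** b) = trace (y' ** b ** z)" "trace (z' ** y' ** b) = trace (y' ** b ** z')"
    "trace (y ** z' ** y ** z) = trace (y ** z ** y ** z')"
    "trace (y' ** z' ** y' ** z) = trace (y' ** z ** y' ** z')" for a b :: mat3
    by (rule trace_rotate)+
  have s: "trace (y ** z' ** y' ** z) = trace (y ** z ** y' ** z')"
    using sym trace_mul_commute[of z "y ** z' ** y'"]
    by (simp add: trace_symmetric_def tr_word_simps y'_def z'_def matrix_mul_assoc)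
  \<comment> \<open>Reducing y^2 extends the matching to the same words with y^2 in front.\<close>
  have "y ** y = trace y \<cdot> y - trace y' \<cdot> mat 1 + y'"
    using trace_inv3(2)[OF y] by (simp add: y'_def)
  then have s2: "trace (y ** y ** z' ** y' ** z) = trace (y ** y ** z ** y' ** z')"
    by (simp add: mat_ring trace_ring c r s)
  note rules = trace_mult_relation_defect trace_mult_commutator trace_mult_twisted_commutator
    A_mat_def Let_def vector_matrix_mult_def sum_6 vector_6 vector_4 tr_word_simps
  show "(e v* A_mat y z) $ 1 = trace (y ** z ** relation_defect y z e)"
    by (simp add: rules flip: y'_def z'_def) (simp add: matrix_mul_assoc c r s s2 trace_ring algebra_simps)
  show "(e v* A_mat y z) $ 2 = trace (inv3 y ** z ** relation_defect y z e)"
    by (simp add: rules flip: y'_def z'_def) (simp add: matrix_mul_assoc c r s s2 trace_ring algebra_simps)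
  show "(e v* A_mat y z) $ 3 = trace (y ** inv3 z ** relation_defect y z e)"
    by (simp add: rules flip: y'_def z'_def) (simp add: matrix_mul_assoc c r s s2 trace_ring algebra_simps)
  show "(e v* A_mat y z) $ 4 = trace (inv3 y ** inv3 z ** relation_defect y z e)"
    by (simp add: rules flip: y'_def z'_def) (simp add: matrix_mul_assoc c r s s2 trace_ring algebra_simps)
qed

section \<open>Simultaneous conjugation and the matrix criterion\<close>

lemma irr_conj:
  assumes QR: "Q ** R = mat 1" "R ** Q = (mat 1 :: mat3)" and "irr y z"
  shows "irr (Q ** y ** R) (Q ** z ** R)"
  unfolding irr_def
proof (intro allI impI)
  fix W assume W: "vec.subspace W" "\<forall>v\<in>W. (Q ** y ** R) *v v \<in> W \<and> (Q ** z ** R) *v v \<in> W"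
  have RQ: "R *v (Q *v v) = v" "Q *v (R *v v) = v" for v
    using QR by (simp_all add: matrix_vector_mul_assoc)
  define U where "U = {v. Q *v v \<in> W}"
  have "vec.subspace U"
    using W(1) by (auto simp: vec.subspace_def U_def matrix_vector_right_distrib smat_vec)
  moreover have "\<forall>v\<in>U. y *v v \<in> U \<and> z *v v \<in> U"
  proof
    fix v assume "v \<in> U"
    then have "(Q ** y ** R) *v (Q *v v) \<in> W" "(Q ** z ** R) *v (Q *v v) \<in> W"
      using W(2) by (auto simp: U_def)
    then show "y *v v \<in> U \<and> z *v v \<in> U"
      by (simp add: U_def RQ flip: matrix_vector_mul_assoc)
  qed
  ultimately have "U = {0} \<or> U = UNIV" using assms(3) unfolding irr_def by blast
  then show "W = {0} \<or> W = UNIV"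
  proof
    assume "U = {0}"
    then have "v = 0" if "v \<in> W" for v
      using that unfolding U_def by (metis (mono_tags) RQ(2) mem_Collect_eq singletonD matrix_vector_mult_0_right)
    then show ?thesis using vec.subspace_0[OF W(1)] by blast
  next
    assume "U = UNIV"
    then have "v \<in> W" for v
      using RQ(2)[of v] unfolding U_def by (metis UNIV_I mem_Collect_eq)
    then show ?thesis by blast
  qed
qed

lemma ordinary_conj:
  assumes QR: "Q ** R = mat 1" "R ** Q = (mat 1 :: mat3)" and "ordinary A"
  shows "ordinary (Q ** A ** R)"
proof (rule ccontr)
  assume "\<not> ordinary (Q ** A ** R)"
  then obtain c a f where *: "Q ** A ** R = mat c + outer a f"
    using special_iff special_def by blast
  have "R ** (Q ** A ** R) ** Q = A"
    using QR by (simp add: matrix_mul_assoc) (simp flip: matrix_mul_assoc)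
  then have "A = mat c + outer (R *v a) (f v* Q)"
    unfolding * using QR by (simp add: mat_ring outer_mul mat_conv_smat[of c])
  then show False using assms(3) special_iff special_def by blast
qed

lemma relation_defect_conj:
  assumes QR: "Q ** R = mat 1" "R ** Q = mat 1" and "y \<in> carrier SL3" "z \<in> carrier SL3"
  shows "relation_defect (Q ** y ** R) (Q ** z ** R) e = Q ** relation_defect y z e ** R"
proof -
  have RQ: "A ** R ** Q = A" for A :: mat3 using QR by (simp flip: matrix_mul_assoc)
  show ?thesis
    using conj_SL3[OF QR(1)] assms(3,4)
    by (simp add: relation_defect_def commutator_def twisted_commutator_def mat_ring RQ)
qed

lemma relation_defect_0_iff:
  assumes y: "y \<in> carrier SL3" "ordinary y" and z: "z \<in> carrier SL3" "ordinary z"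
    and irr: "irr y z" and sym: "trace_symmetric y z"
  shows "relation_defect y z e = 0 \<longleftrightarrow> e v* A_mat y z = 0"
proof
  assume 0: "relation_defect y z e = 0"
  show "e v* A_mat y z = 0"
    using A_mat_column[OF y(1) z(1) sym, of e] unfolding 0 by (simp add: vec_eq_iff forall_4 mat_ring trace_ring)
next
  assume A: "e v* A_mat y z = 0"
  obtain Q :: mat3 where Q: "invertible Q" "transpose (Q ** y ** matrix_inv Q) = Q ** y ** matrix_inv Q"
     "transpose (Q ** z ** matrix_inv Q) = Q ** z ** matrix_inv Q"
    using symmetrizable_if_trace_symmetric[OF y(1) z(1) irr sym]
    unfolding simultaneously_symmetrizable_def by blast
  define R where "R = matrix_inv Q"
  have QR: "Q ** R = mat 1" "R ** Q = mat 1"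
    using Q(1) by (simp_all add: R_def matrix_inv_inverse)
  have RQ: "A ** R ** Q = A" "A ** Q ** R = A" for A :: mat3 using QR by (simp_all flip: matrix_mul_assoc)
  define Y Z where "Y = Q ** y ** R" and "Z = Q ** z ** R"
  have S: "Y \<in> carrier SL3" "Z \<in> carrier SL3" "inv3 Y = Q ** inv3 y ** R" "inv3 Z = Q ** inv3 z ** R"
    using conj_SL3[OF QR(1)] y(1) z(1) by (simp_all add: Y_def Z_def)
  have T: "transpose Y = Y" "transpose Z = Z" using Q by (simp_all add: Y_def Z_def R_def)
  have T': "transpose (inv3 Y) = inv3 Y" "transpose (inv3 Z) = inv3 Z"
    using transpose_inv3[OF S(1)] transpose_inv3[OF S(2)] T by simp_all
  define D where "D = relation_defect y z e"
  define N where "N = Q ** D ** R"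
  have N: "N = relation_defect Y Z e"
    unfolding N_def D_def Y_def Z_def by (rule relation_defect_conj[OF QR y(1) z(1), symmetric])
  have anti: "transpose N = - N"
    unfolding N relation_defect_def commutator_def twisted_commutator_def
    by (simp add: transpose_linear matrix_transpose_mul T T' matrix_mul_assoc) (simp add: vec_eq_iff algebra_simps)
  \<comment> \<open>Transposing turns tr(q p N) into -tr(N p q), so the trace against a product
    controls the trace against the commutator.\<close>
  have tr: "trace (N ** commutator p q) = 0"
    if "transpose p = p" "transpose q = q" "trace (p ** q ** N) = 0" for p q
  proof -
    have "trace (q ** p ** N) = trace (transpose (q ** p ** N))" by (simp add: trace_transpose3)
    also have "\<dots> = - trace (N ** (p ** q))"
      by (simp add: matrix_transpose_mul that anti mat_ring trace_ring)
    also have "\<dots> = 0" using that(3) trace_mul_commute[of N "p ** q"] by simp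
    finally show ?thesis
      using that(3) trace_mul_commute[of N "p ** q"] trace_mul_commute[of N "q ** p"]
      by (simp add: commutator_def mat_ring trace_ring)
  qed
  have "trace (Q ** p ** R ** (Q ** q ** R) ** N) = trace (p ** q ** D)" for p q
    using trace_conj[OF QR(2), of "p ** q ** D"] by (simp add: N_def matrix_mul_assoc RQ)
  then have 0: "trace (Y ** Z ** N) = 0" "trace (inv3 Y ** Z ** N) = 0"
    "trace (Y ** inv3 Z ** N) = 0" "trace (inv3 Y ** inv3 Z ** N) = 0"
    using A_mat_column[OF y(1) z(1) sym, of e] unfolding S(3,4)
    unfolding Y_def Z_def by (simp_all add: A D_def)
  have "N = 0"
    using commutators_span[OF S(1) T(1) _ S(2) T(2) _ _ anti tr[OF T(1,2) 0(1)] tr[OF T'(1) T(2) 0(2)]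
      tr[OF T(1) T'(2) 0(3)] tr[OF T' 0(4)]]
      ordinary_conj[OF QR y(2)] ordinary_conj[OF QR z(2)] irr_conj[OF QR irr]
    by (simp add: Y_def Z_def)
  have "D = R ** N ** Q"
    using QR by (simp add: N_def RQ matrix_mul_assoc)
  then show "relation_defect y z e = 0" by (simp add: D_def \<open>N = 0\<close> mat_ring)
qed

section \<open>Representations of the link group\<close>

lemma word_eval_simps:
  "word_eval y z [] = mat 1" "word_eval y z (a # u) = letter_eval y z a ** word_eval y z u"
  by (simp_all add: word_eval_def)

lemma word_eval_inv_word:
  assumes "y \<in> carrier SL3" "z \<in> carrier SL3"
  shows "word_eval y z (inv_word u) = inv3 (word_eval y z u)"
proof (rule HOL.sym, rule SL3_inv_unique[OF word_eval_in_SL3[OF assms]])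
  have "word_eq {} (inv_word u @ u) []" by (rule word_eq_inv_word)
  then have "word_eval y z (inv_word u) ** word_eval y z u = mat 1"
    using word_eval_cong[OF assms] by (metis word_eval_append word_eval_simps(1))
  then show "word_eval y z u ** word_eval y z (inv_word u) = mat 1"
    using matrix_left_right_inverse by blast
qed

lemma word_eval_word_power:
  assumes "y \<in> carrier SL3" "z \<in> carrier SL3"
  shows "word_eval y z (word_power u k) = word_eval y z u [^]\<^bsub>SL3\<^esub> k"
proof -
  have nat: "word_eval y z (concat (replicate n v)) = word_eval y z v [^]\<^bsub>SL3\<^esub> n" for n :: nat and v
  proof (induction n)
    case 0
    show ?case by (simp add: word_eval_simps) (simp add: SL3_def)
  next
    case (Suc n)
    have "word_eval y z v \<otimes>\<^bsub>SL3\<^esub> word_eval y z v [^]\<^bsub>SL3\<^esub> n = word_eval y z v [^]\<^bsub>SL3\<^esub> Suc n"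
      using monoid.nat_pow_Suc2[OF group.is_monoid[OF group_SL3] word_eval_in_SL3[OF assms]] by simp
    then show ?case by (simp add: word_eval_append Suc) (simp add: SL3_def)
  qed
  show ?thesis
  proof (cases "0 \<le> k")
    case True
    then have "\<not> k < 0" by simp
    with True show ?thesis by (simp only: word_power_def int_pow_def2 if_True if_False nat)
  next
    case False
    then have "word_eval y z (word_power u k) = inv3 (word_eval y z u) [^]\<^bsub>SL3\<^esub> nat (- k)"
      by (simp only: word_power_def if_False nat word_eval_inv_word[OF assms])
    also have "\<dots> = inv3 (word_eval y z u [^]\<^bsub>SL3\<^esub> nat (- k))"
      by (rule group.nat_pow_inv[OF group_SL3 word_eval_in_SL3[OF assms]])
    finally show ?thesis using False by (simp only: int_pow_def2 not_le if_True)
  qed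
qed

lemma word_eval_rel_cong:
  assumes "y \<in> carrier SL3" "z \<in> carrier SL3"
    and "\<And>r s. (r, s) \<in> R \<Longrightarrow> word_eval y z r = word_eval y z s" and "word_eq R u v"
  shows "word_eval y z u = word_eval y z v"
  using assms(4)
proof (induction)
  case (cancel u b x v)
  have "word_eval y z [(b, x), (\<not> b, x)] = mat 1"
    using letter_eval_cancel[OF assms(1,2)] by (simp add: word_eval_def)
  then show ?case by (simp only: word_eval_append) simp
next
  case (relator r s u v)
  then show ?case using assms(3) by (simp add: word_eval_append)
qed auto

text \<open>Evaluation respecting the relations is constant on classes, so the image whose single
  element \<open>pair_rep\<close> takes is a singleton.\<close>

lemma pair_rep_presented_group:
  assumes "y \<in> carrier SL3" "z \<in> carrier SL3"
    and "\<And>r s. (r, s) \<in> R \<Longrightarrow> word_eval y z r = word_eval y z s"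
  shows "pair_rep y z (word_class R u) = word_eval y z u"
    and "pair_rep y z \<in> hom (presented_group R) SL3"
proof -
  have c: "pair_rep y z (word_class R u) = word_eval y z u" for u
  proof -
    have "word_eval y z v = word_eval y z u" if "v \<in> word_class R u" for v
      using word_eval_rel_cong[where R = R and u = u and v = v, OF assms] that by (simp add: word_class_def)
    moreover have "u \<in> word_class R u" by (simp add: word_class_def word_eq.refl)
    ultimately have "word_eval y z ` word_class R u = {word_eval y z u}" by blast
    then show ?thesis by (simp add: pair_rep_def)
  qed
  then show "pair_rep y z (word_class R u) = word_eval y z u" .
  show "pair_rep y z \<in> hom (presented_group R) SL3"
  proof (rule homI)
    fix A assume "A \<in> carrier (presented_group R)"
    then show "pair_rep y z A \<in> carrier SL3"
      using c word_eval_in_SL3[OF assms(1,2)] by (auto simp: presented_group_def)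
  next
    fix A B assume "A \<in> carrier (presented_group R)" "B \<in> carrier (presented_group R)"
    then obtain u v where "A = word_class R u" "B = word_class R v"
      by (auto simp: presented_group_def)
    then show "pair_rep y z (A \<otimes>\<^bsub>presented_group R\<^esub> B) = pair_rep y z A \<otimes>\<^bsub>SL3\<^esub> pair_rep y z B"
      by (simp add: word_class_mult c word_eval_append) (simp add: SL3_def)
  qed
qed

lemma hom_presented_group:
  assumes "\<rho> \<in> hom (presented_group R) SL3"
  shows "\<rho> (word_class R u) = word_eval (\<rho> (word_class R gy)) (\<rho> (word_class R gz)) u"
    and "\<rho> (word_class R v) \<in> carrier SL3"
proof -
  interpret group_hom "presented_group R" SL3 \<rho>
    using assms by (simp add: group_hom_def group_hom_axioms_def group_presented_group group_SL3)
  have car: "word_class R v \<in> carrier (presented_group R)" for v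
    by (simp add: presented_group_def)
  then show "\<rho> (word_class R v) \<in> carrier SL3" by (rule hom_closed)
  have mult: "\<rho> (word_class R (u @ v)) = \<rho> (word_class R u) ** \<rho> (word_class R v)" for u v
    using hom_mult[OF car car, of u v] by (simp add: word_class_mult) (simp add: SL3_def)
  have one: "\<rho> (word_class R []) = mat 1"
    using hom_one by (simp add: presented_group_def SL3_def)
  have inv: "\<rho> (word_class R [(False, g)]) = inv3 (\<rho> (word_class R [(True, g)]))" for g
  proof (rule HOL.sym, rule SL3_inv_unique)
    show "\<rho> (word_class R [(True, g)]) \<in> carrier SL3" by (rule hom_closed[OF car])
    have "word_class R ([(True, g)] @ [(False, g)]) = word_class R []"
      using word_eq.cancel[of R "[]" True g "[]"] by (simp add: word_class_eq_iff)
    then show "\<rho> (word_class R [(True, g)]) ** \<rho> (word_class R [(False, g)]) = mat 1"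
      by (simp only: mult[symmetric] one)
  qed
  show "\<rho> (word_class R u) = word_eval (\<rho> (word_class R gy)) (\<rho> (word_class R gz)) u"
  proof (induction u)
    case Nil
    then show ?case by (simp add: one word_eval_simps)
  next
    case (Cons a u)
    have "\<rho> (word_class R [a]) = letter_eval (\<rho> (word_class R gy)) (\<rho> (word_class R gz)) a"
      by (cases "(undefined, undefined, a) :: mat3 \<times> mat3 \<times> _" rule: letter_eval.cases) (auto simp: inv)
    then show ?case using mult[of "[a]" u] Cons by (simp add: word_eval_simps)
  qed
qed

text \<open>Both notions have the same invariant subspaces: words are products of letters, and
  \<open>inv3_vec\<close> handles the inverse letters.\<close>

lemma irreducible_rep_iff_irr:
  assumes "y \<in> carrier SL3" "z \<in> carrier SL3" "\<And>u. \<rho> (word_class R u) = word_eval y z u"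
  shows "irreducible_rep (presented_group R) \<rho> \<longleftrightarrow> irr y z"
proof -
  have yz: "word_eval y z gy = y" "word_eval y z gz = z" by (simp_all add: word_eval_def)
  have inv: "inv3 x *v v \<in> W"
    if "vec.subspace W" "\<And>v. v \<in> W \<Longrightarrow> x *v v \<in> W" "x \<in> carrier SL3" "v \<in> W" for x v W
  proof -
    have "inv3 x *v v = x *v (x *v v) - trace x *s (x *v v) + trace (inv3 x) *s v"
      by (rule inv3_vec[OF that(3)])
    also have "\<dots> \<in> W"
      using that by (intro vec.subspace_add vec.subspace_diff vec.subspace_scale) auto
    finally show ?thesis .
  qed
  have "(\<forall>g\<in>carrier (presented_group R). \<forall>v\<in>W. \<rho> g *v v \<in> W) \<longleftrightarrow> (\<forall>v\<in>W. y *v v \<in> W \<and> z *v v \<in> W)"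
    if W: "vec.subspace W" for W
  proof
    assume *: "\<forall>g\<in>carrier (presented_group R). \<forall>v\<in>W. \<rho> g *v v \<in> W"
    have "\<forall>v\<in>W. word_eval y z u *v v \<in> W" for u
    proof -
      have "word_class R u \<in> carrier (presented_group R)" by (simp add: presented_group_def)
      then show ?thesis using * by (simp flip: assms(3))
    qed
    from this[of gy] this[of gz] show "\<forall>v\<in>W. y *v v \<in> W \<and> z *v v \<in> W" by (simp add: yz)
  next
    assume *: "\<forall>v\<in>W. y *v v \<in> W \<and> z *v v \<in> W"
    have letter: "letter_eval y z a *v v \<in> W" if "v \<in> W" for a v
      using * that inv[OF W _ assms(1)] inv[OF W _ assms(2)]
      by (cases "(y, z, a)" rule: letter_eval.cases) auto
    have "word_eval y z u *v v \<in> W" if "v \<in> W" for u v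
      using that by (induction u) (auto simp: word_eval_simps letter simp flip: matrix_vector_mul_assoc)
    then show "\<forall>g\<in>carrier (presented_group R). \<forall>v\<in>W. \<rho> g *v v \<in> W"
      by (auto simp: presented_group_def assms(3))
  qed
  then show ?thesis unfolding irreducible_rep_def irr_def by blast
qed

lemma irreducible_pair_iff:
  "irreducible_pair y z \<longleftrightarrow> y \<in> carrier SL3 \<and> z \<in> carrier SL3 \<and> irr y z"
proof (cases "y \<in> carrier SL3 \<and> z \<in> carrier SL3")
  case True
  then have "irreducible_rep (presented_group {}) (pair_rep y z) \<longleftrightarrow> irr y z"
    by (intro irreducible_rep_iff_irr) (simp_all add: pair_rep_word_class)
  with True show ?thesis by (simp add: irreducible_pair_def F2_def)
qed (auto simp: irreducible_pair_def)

section \<open>From representations of the link group to matrix pairs\<close>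

lemma \<Gamma>_relation_iff:
  assumes "y \<in> carrier SL3" "z \<in> carrier SL3"
  shows "(\<forall>r s. (r, s) \<in> \<Gamma>_relations m n \<longrightarrow> word_eval y z r = word_eval y z s)
    \<longleftrightarrow> relation_defect y z (\<eta> m n y z) = 0"
proof -
  have "word_eval y z gy = y" "word_eval y z gz = z" by (simp_all add: word_eval_def)
  then have "word_eval y z (w_word m) = w_mat m y z"
    by (simp only: w_word_def w_mat_def word_eval_append word_eval_word_power[OF assms] matrix_mul_assoc)
  then show ?thesis
    unfolding relation_iff[OF assms, symmetric] \<Gamma>_relations_def
    using \<open>word_eval y z gy = y\<close> \<open>word_eval y z gz = z\<close>
    by (simp add: word_eval_append word_eval_word_power assms word_eval_inv_word matrix_mul_assoc)
qed

lemma irr_reps_image: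
  "\<rho> \<in> irr_reps m n \<Longrightarrow> \<rho> (\<Gamma>_y m n) \<in> carrier SL3 \<and> \<rho> (\<Gamma>_z m n) \<in> carrier SL3 \<and>
    irr (\<rho> (\<Gamma>_y m n)) (\<rho> (\<Gamma>_z m n)) \<and>
    relation_defect (\<rho> (\<Gamma>_y m n)) (\<rho> (\<Gamma>_z m n)) (\<eta> m n (\<rho> (\<Gamma>_y m n)) (\<rho> (\<Gamma>_z m n))) = 0"
proof -
  assume \<rho>: "\<rho> \<in> irr_reps m n"
  define R where "R = \<Gamma>_relations m n"
  have hom: "\<rho> \<in> hom (presented_group R) SL3" and ir: "irreducible_rep (presented_group R) \<rho>"
    using \<rho> by (simp_all add: irr_reps_def \<Gamma>_def R_def)
  define y z where "y = \<rho> (\<Gamma>_y m n)" and "z = \<rho> (\<Gamma>_z m n)"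
  have eval: "\<rho> (word_class R u) = word_eval y z u" for u
    unfolding y_def z_def \<Gamma>_y_def \<Gamma>_z_def R_def[symmetric] by (rule hom_presented_group(1)[OF hom])
  have S: "y \<in> carrier SL3" "z \<in> carrier SL3"
    using hom_presented_group(2)[OF hom] by (simp_all add: y_def z_def \<Gamma>_y_def \<Gamma>_z_def R_def)
  have "word_eval y z r = word_eval y z s" if "(r, s) \<in> R" for r s
  proof -
    have "word_eq R r s" using word_eq.relator[OF that, of "[]" "[]"] by simp
    then have "word_class R r = word_class R s" by (simp add: word_class_eq_iff)
    then show ?thesis by (simp flip: eval)
  qed
  then have "relation_defect y z (\<eta> m n y z) = 0"
    using \<Gamma>_relation_iff[OF S] unfolding R_def by blast
  then show ?thesis
    using S ir irreducible_rep_iff_irr[OF S eval] unfolding y_def z_def by blast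
qed

lemma irr_reps_realize:
  assumes "y \<in> carrier SL3" "z \<in> carrier SL3" "irr y z" "relation_defect y z (\<eta> m n y z) = 0"
  shows "\<exists>\<rho>\<in>irr_reps m n. \<rho> (\<Gamma>_y m n) = y \<and> \<rho> (\<Gamma>_z m n) = z"
proof
  have rel: "\<And>r s. (r, s) \<in> \<Gamma>_relations m n \<Longrightarrow> word_eval y z r = word_eval y z s"
    using \<Gamma>_relation_iff[OF assms(1,2)] assms(4) by blast
  have eval: "pair_rep y z (word_class (\<Gamma>_relations m n) u) = word_eval y z u" for u
    using rel by (rule pair_rep_presented_group(1)[OF assms(1,2)])
  have hom: "pair_rep y z \<in> hom (presented_group (\<Gamma>_relations m n)) SL3"
    using rel by (rule pair_rep_presented_group(2)[OF assms(1,2)])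
  have "irreducible_rep (presented_group (\<Gamma>_relations m n)) (pair_rep y z) \<longleftrightarrow> irr y z"
    by (rule irreducible_rep_iff_irr[OF assms(1,2)]) (rule eval)
  then show "pair_rep y z \<in> irr_reps m n"
    using hom assms(3) unfolding irr_reps_def \<Gamma>_def by blast
  show "pair_rep y z (\<Gamma>_y m n) = y \<and> pair_rep y z (\<Gamma>_z m n) = z"
    unfolding \<Gamma>_y_def \<Gamma>_z_def eval by (simp add: word_eval_def)
qed

text \<open>Restriction to the generators and evaluation of words translate between irreducible
  representations and irreducible pairs with zero defect. The parameter \<Phi> serves all three
  components.\<close>

lemma view_character_image:
  "view_character m n ` {\<rho> \<in> sym_irr_reps m n. \<Phi> (\<rho> (\<Gamma>_y m n)) (\<rho> (\<Gamma>_z m n))}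
    = {pair_character y z | y z. irreducible_pair y z \<and> trace_symmetric y z \<and>
        relation_defect y z (\<eta> m n y z) = 0 \<and> \<Phi> y z}" (is "?L = ?R")
proof
  show "?L \<subseteq> ?R"
  proof
    fix c assume "c \<in> ?L"
    then obtain \<rho> where "c = view_character m n \<rho>" "\<rho> \<in> irr_reps m n"
      "trace_symmetric (\<rho> (\<Gamma>_y m n)) (\<rho> (\<Gamma>_z m n))" "\<Phi> (\<rho> (\<Gamma>_y m n)) (\<rho> (\<Gamma>_z m n))"
      unfolding sym_irr_reps_def by blast
    then show "c \<in> ?R"
      using irr_reps_image[of \<rho> m n] unfolding view_character_def irreducible_pair_iff by blast
  qed
  show "?R \<subseteq> ?L"
  proof
    fix c assume "c \<in> ?R"
    then obtain y z where *: "c = pair_character y z" "irreducible_pair y z" "trace_symmetric y z"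
      "relation_defect y z (\<eta> m n y z) = 0" "\<Phi> y z" by blast
    then obtain \<rho> where \<rho>: "\<rho> \<in> irr_reps m n" "\<rho> (\<Gamma>_y m n) = y" "\<rho> (\<Gamma>_z m n) = z"
      using irr_reps_realize[of y z m n] unfolding irreducible_pair_iff by blast
    show "c \<in> ?L"
    proof (rule image_eqI)
      show "c = view_character m n \<rho>" by (simp add: * view_character_def \<rho>)
      show "\<rho> \<in> {\<rho> \<in> sym_irr_reps m n. \<Phi> (\<rho> (\<Gamma>_y m n)) (\<rho> (\<Gamma>_z m n))}"
        using * by (simp add: sym_irr_reps_def \<rho>)
    qed
  qed
qed

section \<open>Components with one special matrix\<close>

lemma relation_defect_special_y:
  assumes "inv3 y = mat c - l \<cdot> y"
  shows "relation_defect y z e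
    = (e$1 - l * e$2 + c * e$5) \<cdot> commutator y z + (e$3 - l * e$4 + c * e$6) \<cdot> commutator y (inv3 z)"
proof -
  have "twisted_commutator y A = c \<cdot> commutator y A" for A
    by (simp add: twisted_commutator_def assms commutator_def mat_ring mat_conv_smat[of c])
      (simp add: vec_eq_iff algebra_simps)
  then show ?thesis
    unfolding relation_defect_def by (simp add: assms commutator_simps) (simp add: vec_eq_iff algebra_simps)
qed

lemma relation_defect_special_z:
  assumes "inv3 z = mat c - l \<cdot> z" "y \<in> carrier SL3"
  shows "relation_defect y z e = (e$1 - l * e$3) \<cdot> commutator y z
    + (e$2 - l * e$4) \<cdot> commutator (inv3 y) z + (e$5 - l * e$6) \<cdot> twisted_commutator y z"
proof -
  \<comment> \<open>The scalar part of z^-1 contributes nothing, since conjugation by y and by y^-1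
    both fix it.\<close>
  have "twisted_commutator y (inv3 z) = - l \<cdot> twisted_commutator y z"
    using SL3_inv[OF assms(2)]
    by (simp add: twisted_commutator_def assms(1) mat_ring mat_conv_smat[of c])
      (simp add: vec_eq_iff algebra_simps)
  then show ?thesis
    unfolding relation_defect_def by (simp add: assms(1) commutator_simps) (simp add: vec_eq_iff algebra_simps)
qed

lemma \<eta>_nth:
  "\<eta> m n y z $ 1 = \<eta>\<^sub>1 m n y z" "\<eta> m n y z $ 2 = \<eta>\<^sub>2 m n y z" "\<eta> m n y z $ 3 = \<eta>\<^sub>3 m n y z"
  "\<eta> m n y z $ 4 = \<eta>\<^sub>4 m n y z" "\<eta> m n y z $ 5 = \<eta>\<^sub>5 m n y z" "\<eta> m n y z $ 6 = \<eta>\<^sub>6 m n y z"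
  by (simp_all add: \<eta>_def vector_6)

text \<open>The relation reduces to two independent commutators, whose coefficients are the last two
  equations. For the converse, the trace equations force y to be special, and then z is ordinary
  because two special matrices share an eigenvector.\<close>

lemma sp_od_iff:
  assumes y: "y \<in> carrier SL3" and z: "z \<in> carrier SL3" and irr: "irr y z"
  shows "relation_defect y z e = 0 \<and> special y \<and> ordinary z \<longleftrightarrow>
    (\<exists>l. l \<noteq> 0 \<and> trace y = 2 * l + l powi (-2) \<and> trace (inv3 y) = 2 * l powi (-1) + l\<^sup>2 \<and>
      trace (inv3 y ** z) = (l\<^sup>2 + l powi (-1)) * trace z - l * trace (y ** z) \<and>
      trace (inv3 y ** inv3 z) = (l\<^sup>2 + l powi (-1)) * trace (inv3 z) - l * trace (y ** inv3 z) \<and>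
      e$1 - l * e$2 + (l\<^sup>2 + l powi (-1)) * e$5 = 0 \<and>
      e$3 - l * e$4 + (l\<^sup>2 + l powi (-1)) * e$6 = 0)" (is "?L \<longleftrightarrow> (\<exists>l. ?R l)")
proof
  assume L: ?L
  from special_SL3[OF _ y] L obtain l where l: "l \<noteq> 0"
    "inv3 y = mat (l\<^sup>2 + l powi (-1)) - l \<cdot> y" "trace y = 2 * l + l powi (-2)"
    "trace (inv3 y) = 2 * l powi (-1) + l\<^sup>2" by blast
  have "trace (inv3 y ** A) = (l\<^sup>2 + l powi (-1)) * trace A - l * trace (y ** A)" for A
    unfolding l(2) mat_conv_smat[of "_ + _"] by (simp add: mat_ring trace_ring)
  moreover have "e$1 - l * e$2 + (l\<^sup>2 + l powi (-1)) * e$5 = 0" "e$3 - l * e$4 + (l\<^sup>2 + l powi (-1)) * e$6 = 0"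
    using special_y_independent[OF irr z] L unfolding relation_defect_special_y[OF l(2)] by blast+
  ultimately show "\<exists>l. ?R l" using l(1,3,4) by blast
next
  assume "\<exists>l. ?R l"
  then obtain l where R: "?R l" by blast
  then have inv: "inv3 y = mat (l\<^sup>2 + l powi (-1)) - l \<cdot> y"
    by (intro special_if_traces[OF irr y z]) blast+
  then have "special y" by (rule special_if_inv[OF y])
  moreover from this have "ordinary z" by (rule irr_not_both_special[OF irr])
  moreover have "relation_defect y z e = 0"
    unfolding relation_defect_special_y[OF inv] using R by simp
  ultimately show ?L by blast
qed

lemma od_sp_iff:
  assumes y: "y \<in> carrier SL3" and z: "z \<in> carrier SL3" and irr: "irr y z"
  shows "relation_defect y z e = 0 \<and> ordinary y \<and> special z \<longleftrightarrow>
    (\<exists>l. l \<noteq> 0 \<and> trace z = 2 * l + l powi (-2) \<and> trace (inv3 z) = 2 * l powi (-1) + l\<^sup>2 \<and>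
      trace (y ** inv3 z) = (l\<^sup>2 + l powi (-1)) * trace y - l * trace (y ** z) \<and>
      trace (inv3 y ** inv3 z) = (l\<^sup>2 + l powi (-1)) * trace (inv3 y) - l * trace (inv3 y ** z) \<and>
      e$1 - l * e$3 = 0 \<and> e$2 - l * e$4 = 0 \<and> e$5 - l * e$6 = 0)" (is "?L \<longleftrightarrow> (\<exists>l. ?R l)")
proof
  assume L: ?L
  from special_SL3[OF _ z] L obtain l a f where l: "z = mat l + outer a f" "l \<noteq> 0"
    "inv3 z = mat (l\<^sup>2 + l powi (-1)) - l \<cdot> z" "trace z = 2 * l + l powi (-2)"
    "trace (inv3 z) = 2 * l powi (-1) + l\<^sup>2" by blast
  have "trace (A ** inv3 z) = (l\<^sup>2 + l powi (-1)) * trace A - l * trace (A ** z)" for A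
    unfolding l(3) mat_conv_smat[of "_ + _"] by (simp add: mat_ring trace_ring)
  moreover have "e$1 - l * e$3 = 0" "e$2 - l * e$4 = 0" "e$5 - l * e$6 = 0"
    using special_z_independent[OF irr y l(1)] L unfolding relation_defect_special_z[OF l(3) y] by blast+
  ultimately show "\<exists>l. ?R l" using l(2,4,5) by blast
next
  assume "\<exists>l. ?R l"
  then obtain l where R: "?R l" by blast
  have irr': "irr z y" using irr irr_commute by blast
  have inv: "inv3 z = mat (l\<^sup>2 + l powi (-1)) - l \<cdot> z"
    using R by (intro special_if_traces[OF irr' z y]) (simp_all add: trace_mul_commute[of "inv3 z" y]
        trace_mul_commute[of "inv3 z" "inv3 y"] trace_mul_commute[of z y] trace_mul_commute[of z "inv3 y"])
  then have "special z" by (rule special_if_inv[OF z])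
  moreover from this have "ordinary y" by (rule irr_not_both_special[OF irr'])
  moreover have "relation_defect y z e = 0"
    unfolding relation_defect_special_z[OF inv y] using R by simp
  ultimately show ?L by blast
qed

lemma view_character_image_cong:
  assumes "\<And>y z. y \<in> carrier SL3 \<Longrightarrow> z \<in> carrier SL3 \<Longrightarrow> irr y z \<Longrightarrow> trace_symmetric y z \<Longrightarrow>
    relation_defect y z (\<eta> m n y z) = 0 \<and> \<Phi> y z \<longleftrightarrow> \<Psi> y z"
  shows "view_character m n ` {\<rho> \<in> sym_irr_reps m n. \<Phi> (\<rho> (\<Gamma>_y m n)) (\<rho> (\<Gamma>_z m n))}
    = {pair_character y z | y z. irreducible_pair y z \<and> trace_symmetric y z \<and> \<Psi> y z}"
proof -
  have "irreducible_pair y z \<and> trace_symmetric y z \<and> relation_defect y z (\<eta> m n y z) = 0 \<and> \<Phi> y z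
    \<longleftrightarrow> irreducible_pair y z \<and> trace_symmetric y z \<and> \<Psi> y z" for y z
    using assms[of y z] unfolding irreducible_pair_iff by blast
  then show ?thesis unfolding view_character_image by simp
qed

theorem theorem4p3:
  fixes m n :: int
  shows
    "(\<forall>\<rho>\<in>irr_reps m n.
        trace_symmetric (\<rho> (\<Gamma>_y m n)) (\<rho> (\<Gamma>_z m n)) \<longleftrightarrow>
        simultaneously_symmetrizable (\<rho> (\<Gamma>_y m n)) (\<rho> (\<Gamma>_z m n))) \<and>
     X_sym_irr m n = X_sp_od m n \<union> X_od_sp m n \<union> X_od_od m n \<and>
     X_sp_od m n =
      {pair_character y z | y z.
         irreducible_pair y z \<and> trace_symmetric y z \<and>
         (let y' = inv\<^bsub>SL3\<^esub> y; z' = inv\<^bsub>SL3\<^esub> z in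
          \<exists>l. l \<noteq> 0 \<and>
            tr_word [y] = 2 * l + l powi (-2) \<and> tr_word [y'] = 2 * l powi (-1) + l ^ 2 \<and>
            tr_word [y', z] = (l ^ 2 + l powi (-1)) * tr_word [z] - l * tr_word [y, z] \<and>
            tr_word [y', z'] = (l ^ 2 + l powi (-1)) * tr_word [z'] - l * tr_word [y, z'] \<and>
            \<eta>\<^sub>1 m n y z - l * \<eta>\<^sub>2 m n y z + (l ^ 2 + l powi (-1)) * \<eta>\<^sub>5 m n y z = 0 \<and>
            \<eta>\<^sub>3 m n y z - l * \<eta>\<^sub>4 m n y z + (l ^ 2 + l powi (-1)) * \<eta>\<^sub>6 m n y z = 0)} \<and>
     X_od_sp m n =
      {pair_character y z | y z.
         irreducible_pair y z \<and> trace_symmetric y z \<and>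
         (let y' = inv\<^bsub>SL3\<^esub> y; z' = inv\<^bsub>SL3\<^esub> z in
          \<exists>l. l \<noteq> 0 \<and>
            tr_word [z] = 2 * l + l powi (-2) \<and> tr_word [z'] = 2 * l powi (-1) + l ^ 2 \<and>
            tr_word [y, z'] = (l ^ 2 + l powi (-1)) * tr_word [y] - l * tr_word [y, z] \<and>
            tr_word [y', z'] = (l ^ 2 + l powi (-1)) * tr_word [y'] - l * tr_word [y', z] \<and>
            \<eta>\<^sub>1 m n y z - l * \<eta>\<^sub>3 m n y z = 0 \<and>
            \<eta>\<^sub>2 m n y z - l * \<eta>\<^sub>4 m n y z = 0 \<and>
            \<eta>\<^sub>5 m n y z - l * \<eta>\<^sub>6 m n y z = 0)} \<and>
     X_od_od m n =
      {pair_character y z | y z.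
         irreducible_pair y z \<and> trace_symmetric y z \<and> ordinary y \<and> ordinary z \<and>
         \<eta> m n y z v* A_mat y z = 0}"
proof (intro conjI)
  show "\<forall>\<rho>\<in>irr_reps m n.
        trace_symmetric (\<rho> (\<Gamma>_y m n)) (\<rho> (\<Gamma>_z m n)) \<longleftrightarrow>
        simultaneously_symmetrizable (\<rho> (\<Gamma>_y m n)) (\<rho> (\<Gamma>_z m n))"
    using irr_reps_image symmetrizable_if_trace_symmetric trace_symmetric_if_symmetrizable by blast
  \<comment> \<open>Of the four combinations of types, the one with two special matrices is excluded
    by irreducibility.\<close>
  have "{\<rho> \<in> sym_irr_reps m n. special (\<rho> (\<Gamma>_y m n)) \<and> special (\<rho> (\<Gamma>_z m n))} = {}"
    using irr_reps_image irr_not_both_special unfolding sym_irr_reps_def special_def by blast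
  then have "sym_irr_reps m n
      = {\<rho> \<in> sym_irr_reps m n. special (\<rho> (\<Gamma>_y m n)) \<and> ordinary (\<rho> (\<Gamma>_z m n))}
      \<union> {\<rho> \<in> sym_irr_reps m n. ordinary (\<rho> (\<Gamma>_y m n)) \<and> special (\<rho> (\<Gamma>_z m n))}
      \<union> {\<rho> \<in> sym_irr_reps m n. ordinary (\<rho> (\<Gamma>_y m n)) \<and> ordinary (\<rho> (\<Gamma>_z m n))}"
    unfolding special_def by blast
  then show "X_sym_irr m n = X_sp_od m n \<union> X_od_sp m n \<union> X_od_od m n"
    unfolding X_sym_irr_def X_sp_od_def X_od_sp_def X_od_od_def image_Un[symmetric] by simp
  show "X_sp_od m n =
      {pair_character y z | y z.
         irreducible_pair y z \<and> trace_symmetric y z \<and>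
         (let y' = inv\<^bsub>SL3\<^esub> y; z' = inv\<^bsub>SL3\<^esub> z in
          \<exists>l. l \<noteq> 0 \<and>
            tr_word [y] = 2 * l + l powi (-2) \<and> tr_word [y'] = 2 * l powi (-1) + l ^ 2 \<and>
            tr_word [y', z] = (l ^ 2 + l powi (-1)) * tr_word [z] - l * tr_word [y, z] \<and>
            tr_word [y', z'] = (l ^ 2 + l powi (-1)) * tr_word [z'] - l * tr_word [y, z'] \<and>
            \<eta>\<^sub>1 m n y z - l * \<eta>\<^sub>2 m n y z + (l ^ 2 + l powi (-1)) * \<eta>\<^sub>5 m n y z = 0 \<and>
            \<eta>\<^sub>3 m n y z - l * \<eta>\<^sub>4 m n y z + (l ^ 2 + l powi (-1)) * \<eta>\<^sub>6 m n y z = 0)}"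
    unfolding X_sp_od_def Let_def tr_word_simps \<eta>_nth[symmetric]
    by (rule view_character_image_cong[where \<Phi> = "\<lambda>y z. special y \<and> ordinary z"]) (rule sp_od_iff)
  show "X_od_sp m n =
      {pair_character y z | y z.
         irreducible_pair y z \<and> trace_symmetric y z \<and>
         (let y' = inv\<^bsub>SL3\<^esub> y; z' = inv\<^bsub>SL3\<^esub> z in
          \<exists>l. l \<noteq> 0 \<and>
            tr_word [z] = 2 * l + l powi (-2) \<and> tr_word [z'] = 2 * l powi (-1) + l ^ 2 \<and>
            tr_word [y, z'] = (l ^ 2 + l powi (-1)) * tr_word [y] - l * tr_word [y, z] \<and>
            tr_word [y', z'] = (l ^ 2 + l powi (-1)) * tr_word [y'] - l * tr_word [y', z] \<and>
            \<eta>\<^sub>1 m n y z - l * \<eta>\<^sub>3 m n y z = 0 \<and>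
            \<eta>\<^sub>2 m n y z - l * \<eta>\<^sub>4 m n y z = 0 \<and>
            \<eta>\<^sub>5 m n y z - l * \<eta>\<^sub>6 m n y z = 0)}"
    unfolding X_od_sp_def Let_def tr_word_simps \<eta>_nth[symmetric]
    by (rule view_character_image_cong[where \<Phi> = "\<lambda>y z. ordinary y \<and> special z"]) (rule od_sp_iff)
  show "X_od_od m n =
      {pair_character y z | y z.
         irreducible_pair y z \<and> trace_symmetric y z \<and> ordinary y \<and> ordinary z \<and>
         \<eta> m n y z v* A_mat y z = 0}"
    unfolding X_od_od_def
  proof (rule view_character_image_cong[where \<Phi> = "\<lambda>y z. ordinary y \<and> ordinary z"])
    fix y z assume "y \<in> carrier SL3" "z \<in> carrier SL3" "irr y z" "trace_symmetric y z"
    then show "relation_defect y z (\<eta> m n y z) = 0 \<and> ordinary y \<and> ordinary z \<longleftrightarrow>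
        ordinary y \<and> ordinary z \<and> \<eta> m n y z v* A_mat y z = 0"
      using relation_defect_0_iff[of y z "\<eta> m n y z"] by blast
  qed
qed

end
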